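(* Assuming Gap-ETH, there exist constants $\zeta,\chi>0$ and $k_0\in\mathbb{N}$ such that, for any constant $k\ge k_0$, there is no algorithm that takes as input a 2-CSP instance $\Gamma$ with a $3$-regular constraint graph $H$ such that $|V(H)|\le k$, runs in time $O\left(|\Gamma|^{\zeta\cdot\frac{k}{\log k}}\right)$, and distinguishes between the following two cases: (Completeness) $\mathrm{CSP}(\Gamma)=|E(H)|$; and (Soundness) $\mathrm{CSP}(\Gamma)<\left(1-\frac{\chi}{\log k}\right)\cdot|E(H)|$.
   Context: 2-CSP: an instance $\Gamma=(H,\Sigma,X)$ consists of a constraint graph $H$, an alphabet $\Sigma$, and constraints $X=\{X_{(u,v)}\}_{(u,v)\in E(H)}$ with $\emptyset\ne X_{(u,v)}\subseteq\Sigma\times\Sigma$ for every $(u,v)\in E(H)$. An assignment is a function $\lambda:V(H)\to\Sigma$; it satisfies an edge $(u,v)\in E(H)$ iff $(\lambda(u),\lambda(v))\in X_{(u,v)}$. $\mathrm{CSP}(\Gamma)$ is the maximum number of edges satisfied by an assignment. $|\Gamma|$ is the encoding size of $\Gamma$. Graphs are simple, with each edge given one fixed orientation (edges $(u,v)$ are oriented so that $u$ precedes $v$ in a fixed total order of the vertices); a graph is $3$-regular if every vertex has exactly three adjacent edges (ignoring orientation). 3-SAT$(D)$: an instance is $\phi=(V,C)$, where $V$ is a set of variables and $C$ a set of clauses, each a disjunction of three literals (variables of $V$ or their negations), such that each variable appears in at most $D$ clauses. $\mathrm{SAT}(\phi)$ is the maximum number of clauses satisfied by a single assignment $V\to\{0,1\}$.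 Gap-ETH is the hypothesis: there exist constants $D\in\mathbb{N}$ and $\delta,\varepsilon\in(0,1)$ such that no algorithm, given a 3-SAT$(D)$ instance $\phi$ with $n$ variables and $m$ clauses, distinguishes between $\mathrm{SAT}(\phi)=m$ and $\mathrm{SAT}(\phi)<(1-\varepsilon)m$ in time $O(2^{\delta n})$. *)

theory Defs
  imports Complex_Main "HOL-Library.FuncSet" "HOL-Library.Log_Nat"
begin

text \<open>
  Algorithms are programs of a unit-cost random access machine on natural numbers. The
  machine has registers and arrays; a program mentions only finitely many of them, addressed
  by constants, while array cells are addressed by computed values. The only arithmetic is
  addition and truncated subtraction, so that after \<open>t\<close> steps numbers are only \<open>O(t)\<close> bits
  longer than the input numbers. Hence the model is polynomially equivalent to Turing
  machines. It would not be if unit-cost multiplication were added.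
\<close>

datatype exp =
    Const nat
  | Reg nat
  | Read nat exp
  | Plus exp exp
  | Minus exp exp

datatype test = Less exp exp

datatype prog =
    Skip
  | SetReg nat exp
  | SetArr nat exp exp
  | Seq prog prog
  | If test prog prog
  | While test prog

type_synonym store = "(nat \<Rightarrow> nat) \<times> (nat \<Rightarrow> nat \<Rightarrow> nat)"

fun exp_val :: "exp \<Rightarrow> store \<Rightarrow> nat" where
  "exp_val (Const n) s = n"
| "exp_val (Reg r) s = fst s r"
| "exp_val (Read a e) s = snd s a (exp_val e s)"
| "exp_val (Plus e1 e2) s = exp_val e1 s + exp_val e2 s"
| "exp_val (Minus e1 e2) s = exp_val e1 s - exp_val e2 s"

fun test_val :: "test \<Rightarrow> store \<Rightarrow> bool" where
  "test_val (Less e1 e2) s \<longleftrightarrow> exp_val e1 s < exp_val e2 s"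

text \<open>
  \<open>exec p s t s'\<close>: started in \<open>s\<close>, program \<open>p\<close> halts in \<open>s'\<close> after \<open>t\<close> steps. Every
  assignment and every evaluation of a test is one step. Expressions are part of the fixed
  program, so their sizes affect the running time by a constant factor only.
\<close>

inductive exec :: "prog \<Rightarrow> store \<Rightarrow> nat \<Rightarrow> store \<Rightarrow> bool" where
  Skip: "exec Skip s 1 s"
| SetReg: "exec (SetReg r e) s 1 ((fst s)(r := exp_val e s), snd s)"
| SetArr: "exec (SetArr a i e) s 1
    (fst s, (snd s)(a := (snd s a)(exp_val i s := exp_val e s)))"
| Seq: "exec p s t s' \<Longrightarrow> exec q s' t' s'' \<Longrightarrow> exec (Seq p q) s (t + t') s''"
| IfTrue: "test_val b s \<Longrightarrow> exec p s t s' \<Longrightarrow> exec (If b p q) s (Suc t) s'"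
| IfFalse: "\<not> test_val b s \<Longrightarrow> exec q s t s' \<Longrightarrow> exec (If b p q) s (Suc t) s'"
| WhileFalse: "\<not> test_val b s \<Longrightarrow> exec (While b p) s 1 s"
| WhileTrue: "test_val b s \<Longrightarrow> exec p s t s' \<Longrightarrow> exec (While b p) s' t' s'' \<Longrightarrow>
    exec (While b p) s (Suc (t + t')) s''"

text \<open>
  The input word is in array 0 and its length in register 0; everything else is 0. The
  program accepts iff it halts with 1 in register 0.
\<close>

definition init_store :: "nat list \<Rightarrow> store" where
  "init_store w =
    ((\<lambda>r. if r = 0 then length w else 0),
     (\<lambda>a i. if a = 0 \<and> i < length w then w ! i else 0))"

definition runs :: "prog \<Rightarrow> nat list \<Rightarrow> nat \<Rightarrow> bool \<Rightarrow> bool" where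
  "runs p w t accept \<longleftrightarrow> (\<exists>s. exec p (init_store w) t s \<and> (accept \<longleftrightarrow> fst s 0 = 1))"

text \<open>Total binary length of the numbers in a word, with one separator after each number.\<close>

definition enc_size :: "nat list \<Rightarrow> nat" where
  "enc_size w = (\<Sum>x\<leftarrow>w. floorlog 2 x + 1)"


datatype literal = Pos nat | Neg nat

fun lit_var :: "literal \<Rightarrow> nat" where
  "lit_var (Pos v) = v"
| "lit_var (Neg v) = v"

fun lit_true :: "(nat \<Rightarrow> bool) \<Rightarrow> literal \<Rightarrow> bool" where
  "lit_true \<alpha> (Pos v) = \<alpha> v"
| "lit_true \<alpha> (Neg v) = (\<not> \<alpha> v)"

type_synonym clause = "literal \<times> literal \<times> literal"

fun clause_vars :: "clause \<Rightarrow> nat set" where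
  "clause_vars (l1, l2, l3) = {lit_var l1, lit_var l2, lit_var l3}"

fun clause_true :: "(nat \<Rightarrow> bool) \<Rightarrow> clause \<Rightarrow> bool" where
  "clause_true \<alpha> (l1, l2, l3) \<longleftrightarrow> lit_true \<alpha> l1 \<or> lit_true \<alpha> l2 \<or> lit_true \<alpha> l3"

text \<open>
  The variables are \<open>0, \<dots>, n - 1\<close>. With arbitrary variable names the input length would not
  be bounded in terms of \<open>n\<close>, and Gap-ETH would hold for the trivial reason that the input
  cannot be read in time \<open>O(2 powr (\<delta> * n))\<close>.
\<close>

record sat3 =
  nvars :: nat
  clauses :: "clause set"

definition is_sat3 :: "nat \<Rightarrow> sat3 \<Rightarrow> bool" where
  "is_sat3 D \<phi> \<longleftrightarrow>
    (\<forall>c\<in>clauses \<phi>. clause_vars c \<subseteq> {..<nvars \<phi>}) \<and>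
    (\<forall>v<nvars \<phi>. card {c \<in> clauses \<phi>. v \<in> clause_vars c} \<le> D)"

definition SAT :: "sat3 \<Rightarrow> nat" where
  "SAT \<phi> = Max ((\<lambda>\<alpha>. card {c \<in> clauses \<phi>. clause_true \<alpha> c}) `
    ({..<nvars \<phi>} \<rightarrow>\<^sub>E UNIV))"

fun lit_word :: "literal \<Rightarrow> nat list" where
  "lit_word (Pos v) = [1, v]"
| "lit_word (Neg v) = [0, v]"

fun clause_word :: "clause \<Rightarrow> nat list" where
  "clause_word (l1, l2, l3) = lit_word l1 @ lit_word l2 @ lit_word l3"

text \<open>The clauses may be listed in any order, so an instance has several encodings.\<close>

definition encodes_sat3 :: "nat list \<Rightarrow> sat3 \<Rightarrow> bool" where
  "encodes_sat3 w \<phi> \<longleftrightarrow> (\<exists>cs. distinct cs \<and> set cs = clauses \<phi> \<and>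
    w = [nvars \<phi>, length cs] @ concat (map clause_word cs))"

definition gap_eth :: bool where
  "gap_eth \<longleftrightarrow>
    (\<exists>(D::nat) (\<delta>::real) (\<epsilon>::real). 0 < \<delta> \<and> \<delta> < 1 \<and> 0 < \<epsilon> \<and> \<epsilon> < 1 \<and>
      \<not> (\<exists>p (C::real). \<forall>\<phi> w. is_sat3 D \<phi> \<and> encodes_sat3 w \<phi> \<longrightarrow>
          (\<exists>t accept. runs p w t accept \<and>
            real t \<le> C * 2 powr (\<delta> * real (nvars \<phi>)) \<and>
            (SAT \<phi> = card (clauses \<phi>) \<longrightarrow> accept) \<and>
            (real (SAT \<phi>) < (1 - \<epsilon>) * real (card (clauses \<phi>)) \<longrightarrow> \<not> accept))))"


text \<open>Vertices are natural numbers; each edge is oriented from the smaller to the larger end.\<close>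

record csp2 =
  verts :: "nat set"
  edges :: "(nat \<times> nat) set"
  alphabet :: "nat set"
  constr :: "nat \<times> nat \<Rightarrow> (nat \<times> nat) set"

definition is_csp2 :: "csp2 \<Rightarrow> bool" where
  "is_csp2 \<Gamma> \<longleftrightarrow>
    finite (verts \<Gamma>) \<and> finite (alphabet \<Gamma>) \<and>
    (\<forall>(u, v)\<in>edges \<Gamma>. u \<in> verts \<Gamma> \<and> v \<in> verts \<Gamma> \<and> u < v) \<and>
    (\<forall>e\<in>edges \<Gamma>. constr \<Gamma> e \<noteq> {} \<and> constr \<Gamma> e \<subseteq> alphabet \<Gamma> \<times> alphabet \<Gamma>)"

definition three_regular :: "csp2 \<Rightarrow> bool" where
  "three_regular \<Gamma> \<longleftrightarrow>
    (\<forall>x\<in>verts \<Gamma>. card {(u, v) \<in> edges \<Gamma>. u = x \<or> v = x} = 3)"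

definition CSP :: "csp2 \<Rightarrow> nat" where
  "CSP \<Gamma> = Max ((\<lambda>\<sigma>. card {(u, v) \<in> edges \<Gamma>. (\<sigma> u, \<sigma> v) \<in> constr \<Gamma> (u, v)}) `
    (verts \<Gamma> \<rightarrow>\<^sub>E alphabet \<Gamma>))"

fun constr_word :: "(nat \<times> nat) \<times> (nat \<times> nat) list \<Rightarrow> nat list" where
  "constr_word ((u, v), ps) = [u, v, length ps] @ concat (map (\<lambda>(a, b). [a, b]) ps)"

text \<open>
  Vertices, alphabet, edges and the pairs of each constraint are listed explicitly, each in
  any order. All encodings \<open>w\<close> of an instance have the same \<open>enc_size w\<close>, which is the
  encoding size of the instance.
\<close>

definition encodes_csp2 :: "nat list \<Rightarrow> csp2 \<Rightarrow> bool" where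
  "encodes_csp2 w \<Gamma> \<longleftrightarrow> (\<exists>vs as xs.
    distinct vs \<and> set vs = verts \<Gamma> \<and>
    distinct as \<and> set as = alphabet \<Gamma> \<and>
    distinct (map fst xs) \<and> set (map fst xs) = edges \<Gamma> \<and>
    (\<forall>(e, ps)\<in>set xs. distinct ps \<and> set ps = constr \<Gamma> e) \<and>
    w = [length vs] @ vs @ [length as] @ as @ [length xs] @ concat (map constr_word xs))"

end

theory Submission
  imports Defs
begin

text \<open>
  An occurrence of a literal is a packet that carries the value of its variable from a
  representative occurrence to its own clause. Packets are routed through a cyclic
  three-regular butterfly network with \<open>2 ^ r\<close> rows and \<open>4 * r\<close> stages, where \<open>r\<close> is maximal
  with \<open>4 * r * 2 ^ r \<le> k\<close>: the first half of the network moves a packet to an intermediate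
  row, the second half to its destination. If the packets with the same source and destination
  use all intermediate rows in turn, every vertex is visited by only \<open>O (m / 2 ^ r)\<close> of the
  packets of \<open>m\<close> clauses. A label of a vertex lists the bits of its packets, hence the alphabet
  has size \<open>2 ^ O (n * log k / k)\<close>, and an algorithm of running time \<open>|\<Gamma>| ^ (\<zeta> * k / log k)\<close>
  decides the formula in time \<open>2 ^ (\<delta> * n)\<close>. An unsatisfied clause leaves a violated constraint
  on the way of one of its packets, and a violated constraint accounts for \<open>O (m / 2 ^ r)\<close>
  clauses. Hence \<open>\<epsilon> * m\<close> unsatisfied clauses force \<open>\<Omega> (2 ^ r)\<close> violated constraints among the
  \<open>O (r * 2 ^ r)\<close> constraints, a fraction of order \<open>1 / log k\<close>.
\<close>

section \<open>Programs\<close>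

text \<open>Degree 3 shapes the network. With both butterfly arcs on either side a vertex would have
  degree 4; stages of straight arcs are therefore interleaved, which leaves one arc on one side and
  two on the other and doubles the \<open>2 * r\<close> stages of two passes over the bits. A route
  is then exactly as long as the cycle, and its two ends lie in the same stage: the vertex where the
  packet of a representative arrives is the one from which the packets of its variable depart, and
  they start from the very bit that it delivers. Consistency of a variable needs no extra
  constraint. Taking turns costs a rounding error of \<open>2 ^ r * 2 ^ r\<close> in the load, which
  is dominated by \<open>m / 2 ^ r\<close> only if \<open>m\<close> is at least
  \<open>2 ^ (3 * r)\<close>; smaller formulas are copied. As \<open>k\<close> is a constant, the
  network and its tables are compiled into the program. This is how a machine without
  multiplication, division and bit operations computes routes. The representatives and the number of
  bits per label depend on the input and are found at run time.\<close>

primrec wregs :: "prog \<Rightarrow> nat set" where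
  "wregs Skip = {}"
| "wregs (SetReg r e) = {r}"
| "wregs (SetArr a i e) = {}"
| "wregs (Seq p q) = wregs p \<union> wregs q"
| "wregs (If b p q) = wregs p \<union> wregs q"
| "wregs (While b p) = wregs p"

primrec warrs :: "prog \<Rightarrow> nat set" where
  "warrs Skip = {}"
| "warrs (SetReg r e) = {}"
| "warrs (SetArr a i e) = {a}"
| "warrs (Seq p q) = warrs p \<union> warrs q"
| "warrs (If b p q) = warrs p \<union> warrs q"
| "warrs (While b p) = warrs p"

definition framed :: "nat set \<Rightarrow> nat set \<Rightarrow> store \<Rightarrow> store \<Rightarrow> bool" where
  "framed W A s s' \<longleftrightarrow>
    (\<forall>r. r \<notin> W \<longrightarrow> fst s' r = fst s r) \<and> (\<forall>a. a \<notin> A \<longrightarrow> snd s' a = snd s a)"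

lemma framed_reg: "framed W A s s' \<Longrightarrow> r \<notin> W \<Longrightarrow> fst s' r = fst s r"
  and framed_arr: "framed W A s s' \<Longrightarrow> a \<notin> A \<Longrightarrow> snd s' a = snd s a"
  by (auto simp: framed_def)

lemma framed_refl [simp]: "framed W A s s"
  by (simp add: framed_def)

lemma framed_trans: "framed W A s s' \<Longrightarrow> framed W A s' s'' \<Longrightarrow> framed W A s s''"
  by (simp add: framed_def)

lemma framed_mono: "framed W A s s' \<Longrightarrow> W \<subseteq> W' \<Longrightarrow> A \<subseteq> A' \<Longrightarrow> framed W' A' s s'"
  by (auto simp: framed_def)

lemma exec_framed: "exec p s t s' \<Longrightarrow> framed (wregs p) (warrs p) s s'"
  by (induction rule: exec.induct) (auto simp: framed_def)

text \<open>A Hoare triple for total correctness with a time bound. The start store is given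
  explicitly instead of by a precondition, so straight-line code can be executed
  symbolically.\<close>

definition runs_to :: "prog \<Rightarrow> store \<Rightarrow> nat \<Rightarrow> (store \<Rightarrow> bool) \<Rightarrow> bool" where
  "runs_to p s T Q \<longleftrightarrow> (\<exists>t s'. exec p s t s' \<and> t \<le> T \<and> Q s')"

text \<open>Besides consequence, this supplies the frame read off the program text. Postconditions
  therefore mention only what a program computes; preserved data are recovered where they are
  used.\<close>

lemma runs_to_weaken:
  assumes "runs_to p s T Q" "T \<le> T'"
    "\<And>s'. Q s' \<Longrightarrow> framed (wregs p) (warrs p) s s' \<Longrightarrow> Q' s'"
  shows "runs_to p s T' Q'"
  using assms exec_framed unfolding runs_to_def by (meson le_trans)

lemma runs_to_Skip: "1 \<le> T \<Longrightarrow> Q s \<Longrightarrow> runs_to Skip s T Q"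
  unfolding runs_to_def using exec.Skip by blast

lemma runs_to_SetReg:
  "1 \<le> T \<Longrightarrow> Q ((fst s)(r := exp_val e s), snd s) \<Longrightarrow> runs_to (SetReg r e) s T Q"
  unfolding runs_to_def using exec.SetReg by blast

lemma runs_to_SetArr:
  "1 \<le> T \<Longrightarrow> Q (fst s, (snd s)(a := (snd s a)(exp_val i s := exp_val e s)))
    \<Longrightarrow> runs_to (SetArr a i e) s T Q"
  unfolding runs_to_def using exec.SetArr by blast

lemma runs_to_Seq:
  assumes "runs_to p s U P"
    "\<And>s'. P s' \<Longrightarrow> framed (wregs p) (warrs p) s s' \<Longrightarrow> runs_to q s' V Q" "U + V \<le> T"
  shows "runs_to (Seq p q) s T Q"
proof -
  obtain t s' where 1: "exec p s t s'" "t \<le> U" "P s'"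
    using assms(1) unfolding runs_to_def by blast
  obtain t' s'' where 2: "exec q s' t' s''" "t' \<le> V" "Q s''"
    using assms(2)[OF 1(3) exec_framed[OF 1(1)]] unfolding runs_to_def by blast
  have "exec (Seq p q) s (t + t') s''" using 1 2 by (blast intro: exec.Seq)
  then show ?thesis using 1 2 assms(3) unfolding runs_to_def
    by (meson add_mono le_trans)
qed

lemma runs_to_SetReg_Seq:
  "1 \<le> T \<Longrightarrow> runs_to q ((fst s)(r := exp_val e s), snd s) (T - 1) Q
    \<Longrightarrow> runs_to (Seq (SetReg r e) q) s T Q"
  by (rule runs_to_Seq[where U = 1 and V = "T - 1",
        OF runs_to_SetReg[where Q = "\<lambda>s'. s' = ((fst s)(r := exp_val e s), snd s)"]]) auto

lemma runs_to_SetArr_Seq: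
  "1 \<le> T \<Longrightarrow> runs_to q (fst s, (snd s)(a := (snd s a)(exp_val i s := exp_val e s))) (T - 1) Q
    \<Longrightarrow> runs_to (Seq (SetArr a i e) q) s T Q"
  by (rule runs_to_Seq[where U = 1 and V = "T - 1", OF runs_to_SetArr[where Q =
      "\<lambda>s'. s' = (fst s, (snd s)(a := (snd s a)(exp_val i s := exp_val e s)))"]]) auto

lemma runs_to_If:
  assumes "1 \<le> T" "test_val b s \<Longrightarrow> runs_to p s (T - 1) Q"
    "\<not> test_val b s \<Longrightarrow> runs_to q s (T - 1) Q"
  shows "runs_to (prog.If b p q) s T Q"
proof (cases "test_val b s")
  case True
  then obtain t s' where "exec p s t s'" "t \<le> T - 1" "Q s'"
    using assms unfolding runs_to_def by blast
  then show ?thesis using True assms(1) exec.IfTrue[of b s p t s' q] unfolding runs_to_def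
    by (intro exI[of _ "Suc t"] exI[of _ s']) auto
next
  case False
  then obtain t s' where "exec q s t s'" "t \<le> T - 1" "Q s'"
    using assms unfolding runs_to_def by blast
  then show ?thesis using False assms(1) exec.IfFalse[of b s q t s' p] unfolding runs_to_def
    by (intro exI[of _ "Suc t"] exI[of _ s']) auto
qed

text \<open>A general \<open>Seq\<close> is absent because its intermediate assertion has to be
  supplied by hand.\<close>

lemmas runs_to_intros = runs_to_SetReg_Seq runs_to_SetArr_Seq runs_to_If runs_to_Skip
  runs_to_SetReg runs_to_SetArr

section \<open>Counted and unrolled loops\<close>

definition For :: "nat \<Rightarrow> exp \<Rightarrow> prog \<Rightarrow> prog" where
  "For r e p = Seq (SetReg r (Const 0))
    (While (Less (Reg r) e) (Seq p (SetReg r (Plus (Reg r) (Const 1)))))"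

lemma wregs_For [simp]: "wregs (For r e p) = insert r (wregs p)"
  and warrs_For [simp]: "warrs (For r e p) = warrs p"
  by (auto simp: For_def)

text \<open>The invariant speaks of the store with the counter already advanced. A round costs two
  steps beyond the body, test and increment; initialisation and the final test give the last 2. The
  bound is evaluated anew in every round, so its value must depend on nothing that the body
  writes.\<close>

lemma runs_to_For:
  assumes init: "I 0 ((fst s)(r := 0), snd s)"
    and bound: "\<And>s'. framed (insert r (wregs p)) (warrs p) s s' \<Longrightarrow> exp_val e s' = n"
    and step: "\<And>i s'. i < n \<Longrightarrow> I i s' \<Longrightarrow> fst s' r = i \<Longrightarrow>
      framed (insert r (wregs p)) (warrs p) s s' \<Longrightarrow>
      runs_to p s' T (\<lambda>s''. I (Suc i) ((fst s'')(r := Suc i), snd s''))"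
    and r: "r \<notin> wregs p"
  shows "runs_to (For r e p) s (n * (T + 2) + 2) (I n)"
proof -
  let ?F = "framed (insert r (wregs p)) (warrs p) s"
  let ?W = "While (Less (Reg r) e) (Seq p (SetReg r (Plus (Reg r) (Const 1))))"
  have loop: "i + d = n \<Longrightarrow> I i s' \<Longrightarrow> fst s' r = i \<Longrightarrow> ?F s' \<Longrightarrow>
      runs_to ?W s' (d * (T + 2) + 1) (I n)" for d i s'
  proof (induction d arbitrary: i s')
    case 0
    then have "\<not> test_val (Less (Reg r) e) s'" using bound by simp
    from exec.WhileFalse[OF this] show ?case
      using 0 unfolding runs_to_def by (intro exI[of _ 1] exI[of _ s']) auto
  next
    case (Suc d)
    have b: "test_val (Less (Reg r) e) s'" using Suc.prems bound by simp
    obtain t s1 where 1: "exec p s' t s1" "t \<le> T"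
        "I (Suc i) ((fst s1)(r := Suc i), snd s1)"
      using step[of i s'] Suc.prems unfolding runs_to_def by auto
    have f1: "framed (wregs p) (warrs p) s' s1" using 1(1) by (rule exec_framed)
    have ri: "fst s1 r = i" using framed_reg[OF f1 r] Suc.prems(3) by simp
    let ?s2 = "((fst s1)(r := Suc i), snd s1)"
    have 2: "exec (Seq p (SetReg r (Plus (Reg r) (Const 1)))) s' (t + 1) ?s2"
      using exec.Seq[OF 1(1) exec.SetReg[of r "Plus (Reg r) (Const 1)" s1]] ri by simp
    have "framed (insert r (wregs p)) (warrs p) s' ?s2"
      using f1 by (auto simp: framed_def)
    then have f2: "?F ?s2" using Suc.prems(4) framed_trans by blast
    have "runs_to ?W ?s2 (d * (T + 2) + 1) (I n)"
      by (rule Suc.IH[of "Suc i"]) (use Suc.prems(1) 1(3) f2 in auto)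
    then obtain t' s3 where 3: "exec ?W ?s2 t' s3" "t' \<le> d * (T + 2) + 1" "I n s3"
      unfolding runs_to_def by blast
    have "exec ?W s' (Suc (t + 1 + t')) s3" using exec.WhileTrue[OF b 2 3(1)] .
    then show ?case using 1(2) 3 unfolding runs_to_def
      by (intro exI[of _ "Suc (t + 1 + t')"] exI[of _ s3]) auto
  qed
  have "runs_to ?W ((fst s)(r := 0), snd s) (n * (T + 2) + 1) (I n)"
    by (rule loop[of 0]) (use init in \<open>auto simp: framed_def\<close>)
  then show ?thesis unfolding For_def
    by (intro runs_to_SetReg_Seq) auto
qed

primrec seqs :: "prog list \<Rightarrow> prog" where
  "seqs [] = Skip"
| "seqs (p # ps) = Seq p (seqs ps)"

lemma wregs_seqs [simp]: "wregs (seqs ps) = (\<Union>p\<in>set ps. wregs p)"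
  and warrs_seqs [simp]: "warrs (seqs ps) = (\<Union>p\<in>set ps. warrs p)"
  by (induction ps) auto

text \<open>For loops over the fixed network (stages, vertices, edges), which are unrolled: array
  numbers are constants of the program, so a run-time counter could not select them.\<close>

lemma runs_to_seqs:
  assumes "I 0 s"
    and "\<And>i s'. i < n \<Longrightarrow> I i s' \<Longrightarrow> framed (\<Union>j<n. wregs (f j)) (\<Union>j<n. warrs (f j)) s s' \<Longrightarrow>
      runs_to (f i) s' T (I (Suc i))"
  shows "runs_to (seqs (map f [0..<n])) s (n * T + 1) (I n)"
proof -
  let ?F = "framed (\<Union>j<n. wregs (f j)) (\<Union>j<n. warrs (f j)) s"
  have "i + d = n \<Longrightarrow> I i s' \<Longrightarrow> ?F s' \<Longrightarrow>
      runs_to (seqs (map f [i..<n])) s' (d * T + 1) (I n)" for d i s'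
  proof (induction d arbitrary: i s')
    case 0
    then show ?case by (auto intro: runs_to_Skip)
  next
    case (Suc d)
    then have e: "[i..<n] = i # [Suc i..<n]" by (simp add: upt_rec)
    have "runs_to (Seq (f i) (seqs (map f [Suc i..<n]))) s' (Suc d * T + 1) (I n)"
    proof (rule runs_to_Seq)
      show "runs_to (f i) s' T (I (Suc i))" using assms(2)[of i s'] Suc.prems by simp
      fix s1 assume "I (Suc i) s1" and f: "framed (wregs (f i)) (warrs (f i)) s' s1"
      have "framed (\<Union>j<n. wregs (f j)) (\<Union>j<n. warrs (f j)) s' s1"
        by (rule framed_mono[OF f]) (use Suc.prems(1) in \<open>auto intro!: bexI[of _ i]\<close>)
      then have "?F s1" using framed_trans Suc.prems(3) by blast
      then show "runs_to (seqs (map f [Suc i..<n])) s1 (d * T + 1) (I n)"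
        using Suc \<open>I (Suc i) s1\<close> by simp
    qed simp
    then show ?case using e by simp
  qed
  from this[of 0 n s] assms(1) show ?thesis by simp
qed

text \<open>Truth values are 0 and 1. With truncated subtraction the sum of both differences
  vanishes exactly for equal arguments.\<close>

definition eq_exp :: "exp \<Rightarrow> exp \<Rightarrow> exp" where
  "eq_exp e1 e2 = Minus (Const 1) (Plus (Minus e1 e2) (Minus e2 e1))"

definition and_exp :: "exp \<Rightarrow> exp \<Rightarrow> exp" where
  "and_exp e1 e2 = Minus (Plus e1 e2) (Const 1)"

definition not_exp :: "exp \<Rightarrow> exp" where
  "not_exp e = Minus (Const 1) e"

primrec times_exp :: "nat \<Rightarrow> exp \<Rightarrow> exp" where
  "times_exp 0 e = Const 0"
| "times_exp (Suc c) e = Plus e (times_exp c e)"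

definition sum_exp :: "exp list \<Rightarrow> exp" where
  "sum_exp es = foldr Plus es (Const 0)"

text \<open>A finite function is looked up in one step, at the price of a huge expression.\<close>

definition table_exp :: "(nat \<Rightarrow> nat) \<Rightarrow> nat \<Rightarrow> exp \<Rightarrow> exp" where
  "table_exp f n e = sum_exp (map (\<lambda>c. times_exp (f c) (eq_exp e (Const c))) [0..<n])"

lemma exp_val_eq_exp [simp]: "exp_val (eq_exp e1 e2) s = of_bool (exp_val e1 s = exp_val e2 s)"
  by (auto simp: eq_exp_def)

lemma exp_val_times_exp [simp]: "exp_val (times_exp c e) s = c * exp_val e s"
  by (induction c) auto

lemma exp_val_sum_exp [simp]: "exp_val (sum_exp es) s = (\<Sum>e\<leftarrow>es. exp_val e s)"
  by (induction es) (auto simp: sum_exp_def)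

lemma exp_val_table_exp [simp]:
  "exp_val e s < n \<Longrightarrow> exp_val (table_exp f n e) s = f (exp_val e s)"
proof -
  assume a: "exp_val e s < n"
  have "exp_val (table_exp f n e) s = (\<Sum>c<n. f c * of_bool (exp_val e s = c))"
    by (simp add: table_exp_def comp_def interv_sum_list_conv_sum_set_nat atLeast0LessThan)
  also have "\<dots> = (\<Sum>c<n. if exp_val e s = c then f c else 0)"
    by (rule sum.cong) auto
  also have "\<dots> = f (exp_val e s)" using a by simp
  finally show ?thesis .
qed

section \<open>Relocation of a program to higher registers and arrays\<close>

primrec shift_exp :: "nat \<Rightarrow> exp \<Rightarrow> exp" where
  "shift_exp k (Const n) = Const n"
| "shift_exp k (Reg r) = Reg (r + k)"
| "shift_exp k (Read a e) = Read (a + k) (shift_exp k e)"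
| "shift_exp k (Plus e1 e2) = Plus (shift_exp k e1) (shift_exp k e2)"
| "shift_exp k (Minus e1 e2) = Minus (shift_exp k e1) (shift_exp k e2)"

primrec shift_test :: "nat \<Rightarrow> test \<Rightarrow> test" where
  "shift_test k (Less e1 e2) = Less (shift_exp k e1) (shift_exp k e2)"

primrec shift_prog :: "nat \<Rightarrow> prog \<Rightarrow> prog" where
  "shift_prog k Skip = Skip"
| "shift_prog k (SetReg r e) = SetReg (r + k) (shift_exp k e)"
| "shift_prog k (SetArr a i e) = SetArr (a + k) (shift_exp k i) (shift_exp k e)"
| "shift_prog k (Seq p q) = Seq (shift_prog k p) (shift_prog k q)"
| "shift_prog k (prog.If b p q) = prog.If (shift_test k b) (shift_prog k p) (shift_prog k q)"
| "shift_prog k (While b p) = While (shift_test k b) (shift_prog k p)"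

definition shifted :: "nat \<Rightarrow> store \<Rightarrow> store \<Rightarrow> bool" where
  "shifted k s S \<longleftrightarrow> (\<forall>r. fst S (r + k) = fst s r) \<and> (\<forall>a. snd S (a + k) = snd s a)"

lemma exp_val_shift_exp: "shifted k s S \<Longrightarrow> exp_val (shift_exp k e) S = exp_val e s"
  by (induction e) (auto simp: shifted_def)

lemma test_val_shift_test: "shifted k s S \<Longrightarrow> test_val (shift_test k b) S = test_val b s"
  by (cases b) (simp add: exp_val_shift_exp)

text \<open>The relocated program never touches anything below \<open>k\<close>, so whatever the
  reduction left there is invisible to it, and the simulation is step by step.\<close>

lemma exec_shift_prog:
  "exec p s t s' \<Longrightarrow> shifted k s S \<Longrightarrow> \<exists>S'. exec (shift_prog k p) S t S' \<and> shifted k s' S'"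
proof (induction arbitrary: S rule: exec.induct)
  case (Skip s)
  then show ?case by (metis exec.Skip shift_prog.simps(1))
next
  case (SetReg r e s)
  have "shifted k ((fst s)(r := exp_val e s), snd s)
      ((fst S)(r + k := exp_val (shift_exp k e) S), snd S)"
    using SetReg by (simp add: exp_val_shift_exp[OF SetReg]) (simp add: shifted_def)
  then show ?case using exec.SetReg[of "r + k" "shift_exp k e" S] by auto
next
  case (SetArr a i e s)
  have "shifted k (fst s, (snd s)(a := (snd s a)(exp_val i s := exp_val e s)))
      (fst S, (snd S)(a + k := (snd S (a + k))(exp_val (shift_exp k i) S := exp_val (shift_exp k e) S)))"
    using SetArr by (simp add: exp_val_shift_exp[OF SetArr]) (simp add: shifted_def)
  then show ?case using exec.SetArr[of "a + k" "shift_exp k i" "shift_exp k e" S] by auto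
next
  case (Seq p s t s' q t' s'')
  then show ?case by (simp, blast intro: exec.Seq)
next
  case (IfTrue b s p t s' q)
  then show ?case by (simp, blast intro: exec.IfTrue test_val_shift_test[THEN iffD2])
next
  case (IfFalse b s q t s' p)
  then show ?case by (simp, blast intro: exec.IfFalse dest: test_val_shift_test[THEN iffD1])
next
  case (WhileFalse b s p)
  then show ?case using exec.WhileFalse[of "shift_test k b" S "shift_prog k p"]
      test_val_shift_test[of k s S b] by (metis shift_prog.simps(6))
next
  case (WhileTrue b s p t s' t' s'')
  then obtain S' S'' where "exec (shift_prog k p) S t S'" "shifted k s' S'"
    "exec (shift_prog k (While b p)) S' t' S''" "shifted k s'' S''" by blast
  then show ?case using exec.WhileTrue[of "shift_test k b" S "shift_prog k p" t S' t' S'']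
      WhileTrue.hyps(1) test_val_shift_test[OF WhileTrue.prems] by (metis shift_prog.simps(6))
qed

section \<open>The switching network\<close>

text \<open>The row on the greedy route from \<open>s\<close> to \<open>w\<close> after the lowest
  \<open>l\<close> bits have been corrected.\<close>

primrec mix :: "nat \<Rightarrow> nat \<Rightarrow> nat \<Rightarrow> nat" where
  "mix 0 s w = s"
| "mix (Suc l) s w = (if bit w l then set_bit l (mix l s w) else unset_bit l (mix l s w))"

lemma bit_mix: "bit (mix l s w) i \<longleftrightarrow> (if i < l then bit w i else bit s i)"
  by (induction l) (auto simp: bit_set_bit_iff bit_unset_bit_iff less_Suc_eq)

lemma less_power_iff_bit: "(x::nat) < 2 ^ r \<longleftrightarrow> (\<forall>i\<ge>r. \<not> bit x i)"
proof -
  have "x < 2 ^ r \<longleftrightarrow> take_bit r x = x" by (simp add: take_bit_nat_eq_self_iff)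
  also have "\<dots> \<longleftrightarrow> (\<forall>i\<ge>r. \<not> bit x i)"
  proof
    assume e: "take_bit r x = x"
    have "bit (take_bit r x) i \<longleftrightarrow> i < r \<and> bit x i" for i by (rule bit_take_bit_iff)
    then show "\<forall>i\<ge>r. \<not> bit x i" unfolding e by (meson not_less)
  next
    assume h: "\<forall>i\<ge>r. \<not> bit x i"
    show "take_bit r x = x"
      by (rule bit_eqI) (use h in \<open>simp add: bit_take_bit_iff, meson not_less\<close>)
  qed
  finally show ?thesis .
qed

lemma mix_less: "s < 2 ^ r \<Longrightarrow> w < 2 ^ r \<Longrightarrow> mix l s w < 2 ^ r"
  by (auto simp: less_power_iff_bit bit_mix)

lemma mix_full: "s < 2 ^ r \<Longrightarrow> w < 2 ^ r \<Longrightarrow> mix r s w = w"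
  by (rule bit_eqI) (auto simp: less_power_iff_bit bit_mix)

lemma mix_Suc: "mix (Suc l) s w \<in> {mix l s w, flip_bit l (mix l s w)}"
proof -
  have "mix (Suc l) s w = (if bit w l \<longleftrightarrow> bit s l then mix l s w else flip_bit l (mix l s w))"
    by (rule bit_eqI) (auto simp: bit_flip_bit_iff bit_mix less_Suc_eq simp del: mix.simps)
  then show ?thesis by (simp only: insert_iff) (meson)
qed

lemma flip_bit_flip_bit: "flip_bit l (flip_bit l x) = (x :: nat)"
  by (rule bit_eqI) (auto simp: bit_flip_bit_iff)

lemma flip_bit_neq: "flip_bit l x \<noteq> (x :: nat)"
proof
  assume "flip_bit l x = x"
  then have "bit (flip_bit l x) l = bit x l" by simp
  then show False by (simp add: bit_flip_bit_iff)
qed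

lemma flip_bit_less: "l < r \<Longrightarrow> x < 2 ^ r \<Longrightarrow> flip_bit l x < (2 ^ r :: nat)"
  by (auto simp: less_power_iff_bit bit_flip_bit_iff)

text \<open>Swapping the low bits of \<open>s\<close> and \<open>w\<close> is injective, hence few routes share a row.\<close>

lemma card_mix_fibre:
  "card {(s, w). s < 2 ^ r \<and> w < 2 ^ r \<and> mix l s w = x} \<le> 2 ^ r" (is "card ?S \<le> _")
proof -
  let ?f = "\<lambda>(s, w). mix l w s"
  have "inj_on ?f ?S"
  proof (rule inj_onI)
    fix p p' assume *: "p \<in> ?S" "p' \<in> ?S" "?f p = ?f p'"
    obtain s w s' w' where p: "p = (s, w)" "p' = (s', w')" by (metis surj_pair)
    have e: "mix l w s = mix l w' s'" "mix l s w = mix l s' w'" using * p by auto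
    have "bit s i = bit s' i" "bit w i = bit w' i" for i
      using arg_cong[OF e(1), of "\<lambda>x. bit x i"] arg_cong[OF e(2), of "\<lambda>x. bit x i"]
      by (auto simp: bit_mix split: if_splits)
    then have "s = s'" "w = w'" by (blast intro: bit_eqI)+
    then show "p = p'" using p by simp
  qed
  moreover have "?f ` ?S \<subseteq> {..<2 ^ r}" by (auto simp: mix_less)
  ultimately have "card ?S \<le> card {..<2 ^ r :: nat}" by (intro card_inj_on_le) auto
  then show ?thesis by simp
qed

text \<open>At odd stages \<open>\<tau> div 2\<close> runs through \<open>2 * r\<close> values, so
  \<open>mod r\<close> offers every bit twice: once on the way to the intermediate row, once on the
  way to the destination.\<close>

definition next_rows :: "nat \<Rightarrow> nat \<Rightarrow> nat \<Rightarrow> nat set" where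
  "next_rows r \<tau> x = (if even \<tau> then {x} else {x, flip_bit ((\<tau> div 2) mod r) x})"

text \<open>Numbering stage by stage makes the vertices of stage 0, the homes, the numbers below
  \<open>2 ^ r\<close>; a home is thus the smaller end of each of its edges.\<close>

definition vertex :: "nat \<Rightarrow> nat \<Rightarrow> nat \<Rightarrow> nat" where
  "vertex r \<tau> x = \<tau> * 2 ^ r + x"

definition arcs :: "nat \<Rightarrow> (nat \<times> nat) set" where
  "arcs r = {(vertex r \<tau> x, vertex r (Suc \<tau> mod (4 * r)) y) | \<tau> x y.
    \<tau> < 4 * r \<and> x < 2 ^ r \<and> y \<in> next_rows r \<tau> x}"

text \<open>Arcs point along the packets, edges upwards in the numbering. The two disagree on the
  arcs that close the cycle.\<close>

definition network_edges :: "nat \<Rightarrow> (nat \<times> nat) set" where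
  "network_edges r = {(u, v). u < v \<and> ((u, v) \<in> arcs r \<or> (v, u) \<in> arcs r)}"

section \<open>Regularity of the network\<close>

lemma vertex_inj:
  "x < 2 ^ r \<Longrightarrow> y < 2 ^ r \<Longrightarrow> vertex r \<tau> x = vertex r \<tau>' y \<longleftrightarrow> \<tau> = \<tau>' \<and> x = y"
proof
  assume a: "x < 2 ^ r" "y < 2 ^ r" and e: "vertex r \<tau> x = vertex r \<tau>' y"
  have "vertex r \<tau> x div 2 ^ r = \<tau>" "vertex r \<tau>' y div 2 ^ r = \<tau>'"
    using a by (simp_all add: vertex_def)
  then have "\<tau> = \<tau>'" using e by simp
  then show "\<tau> = \<tau>' \<and> x = y" using e by (simp add: vertex_def)
qed auto

lemma vertex_less: "x < 2 ^ r \<Longrightarrow> \<tau> < n \<Longrightarrow> vertex r \<tau> x < n * 2 ^ r"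
proof -
  assume "x < 2 ^ r" "\<tau> < n"
  then have "\<tau> * 2 ^ r + x < Suc \<tau> * 2 ^ r" by simp
  also have "\<dots> \<le> n * 2 ^ r" using \<open>\<tau> < n\<close> by (intro mult_right_mono) auto
  finally show ?thesis by (simp add: vertex_def)
qed

lemma vertexE:
  assumes "u < n * 2 ^ r"
  obtains \<tau> x where "\<tau> < n" "x < 2 ^ r" "u = vertex r \<tau> x"
proof
  show "u div 2 ^ r < n" using assms by (simp add: less_mult_imp_div_less)
  show "u mod 2 ^ r < 2 ^ r" by simp
  show "u = vertex r (u div 2 ^ r) (u mod 2 ^ r)" unfolding vertex_def by (simp only: div_mult_mod_eq)
qed

lemma next_rows_less: "0 < r \<Longrightarrow> x < 2 ^ r \<Longrightarrow> y \<in> next_rows r \<tau> x \<Longrightarrow> y < 2 ^ r"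
  by (auto simp: next_rows_def flip_bit_less split: if_splits)

lemma next_rows_sym: "y \<in> next_rows r \<tau> x \<longleftrightarrow> x \<in> next_rows r \<tau> y"
  by (auto simp: next_rows_def flip_bit_flip_bit)

lemma card_next_rows: "card (next_rows r \<tau> x) = (if even \<tau> then 1 else 2)"
  using flip_bit_neq[of "(\<tau> div 2) mod r" x] by (auto simp: next_rows_def)

lemma finite_next_rows [simp]: "finite (next_rows r \<tau> x)"
  by (auto simp: next_rows_def)

definition neighbours :: "nat \<Rightarrow> nat \<Rightarrow> nat set" where
  "neighbours r u = {v. (u, v) \<in> arcs r \<or> (v, u) \<in> arcs r}"

text \<open>In a cycle of length above 2 a stage, its successor and its predecessor are distinct,
  which excludes loops and double edges.\<close>

lemma mod_cycle:
  assumes "\<tau> < n" "2 < (n::nat)"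
  shows "Suc \<tau> mod n \<noteq> (\<tau> + n - 1) mod n" "Suc ((\<tau> + n - 1) mod n) mod n = \<tau>"
    "\<tau>' < n \<Longrightarrow> Suc \<tau>' mod n = \<tau> \<Longrightarrow> \<tau>' = (\<tau> + n - 1) mod n"
    "Suc \<tau> mod n \<noteq> \<tau>"
proof -
  have p: "(\<tau> + n - 1) mod n = (if \<tau> = 0 then n - 1 else \<tau> - 1)"
    using assms by (auto simp: mod_if)
  have s: "\<tau> < n \<Longrightarrow> Suc \<tau> mod n = (if \<tau> = n - 1 then 0 else Suc \<tau>)" for \<tau>
    using assms by auto
  show "Suc \<tau> mod n \<noteq> (\<tau> + n - 1) mod n" "Suc \<tau> mod n \<noteq> \<tau>"
    "Suc ((\<tau> + n - 1) mod n) mod n = \<tau>"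
    using assms p s by (auto split: if_splits)
  show "\<tau>' < n \<Longrightarrow> Suc \<tau>' mod n = \<tau> \<Longrightarrow> \<tau>' = (\<tau> + n - 1) mod n"
    using assms p s[of \<tau>'] by (auto split: if_splits)
qed

text \<open>Flipping a bit is an involution, so the arcs entering a vertex are described by the same
  rows as those leaving the previous stage.\<close>

lemma neighbours_vertex:
  assumes r: "0 < r" and \<tau>: "\<tau> < 4 * r" and x: "x < 2 ^ r"
  defines "\<tau>' \<equiv> (\<tau> + 4 * r - 1) mod (4 * r)"
  shows "neighbours r (vertex r \<tau> x) =
    vertex r (Suc \<tau> mod (4 * r)) ` next_rows r \<tau> x \<union> vertex r \<tau>' ` next_rows r \<tau>' x"
proof -
  note mc = mod_cycle[of \<tau> "4 * r"]
  have 1: "(vertex r \<tau> x, v) \<in> arcs r \<longleftrightarrow>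
      v \<in> vertex r (Suc \<tau> mod (4 * r)) ` next_rows r \<tau> x" for v
  proof
    assume "(vertex r \<tau> x, v) \<in> arcs r"
    then obtain t z y where "t < 4 * r" "z < 2 ^ r" "y \<in> next_rows r t z"
      "vertex r \<tau> x = vertex r t z" "v = vertex r (Suc t mod (4 * r)) y"
      unfolding arcs_def by auto
    then show "v \<in> vertex r (Suc \<tau> mod (4 * r)) ` next_rows r \<tau> x"
      using vertex_inj x by auto
  qed (use \<tau> x in \<open>auto simp: arcs_def\<close>)
  have 2: "(v, vertex r \<tau> x) \<in> arcs r \<longleftrightarrow> v \<in> vertex r \<tau>' ` next_rows r \<tau>' x" for v
  proof
    assume "(v, vertex r \<tau> x) \<in> arcs r"
    then obtain t z y where *: "t < 4 * r" "z < 2 ^ r" "y \<in> next_rows r t z"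
      "vertex r \<tau> x = vertex r (Suc t mod (4 * r)) y" "v = vertex r t z"
      unfolding arcs_def by auto
    then have "\<tau> = Suc t mod (4 * r)" "x = y"
      using vertex_inj[OF x next_rows_less[OF r]] by blast+
    then have "t = \<tau>'" using mc(3) \<tau> * r unfolding \<tau>'_def by auto
    then show "v \<in> vertex r \<tau>' ` next_rows r \<tau>' x"
      using * \<open>x = y\<close> next_rows_sym by auto
  next
    assume "v \<in> vertex r \<tau>' ` next_rows r \<tau>' x"
    then obtain y where y: "y \<in> next_rows r \<tau>' x" "v = vertex r \<tau>' y" by auto
    have "Suc \<tau>' mod (4 * r) = \<tau>" "\<tau>' < 4 * r" using mc(2) \<tau> r by (auto simp: \<tau>'_def)
    moreover have "y < 2 ^ r" "x \<in> next_rows r \<tau>' y"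
      using y next_rows_less[OF r x] next_rows_sym by auto
    ultimately show "(v, vertex r \<tau> x) \<in> arcs r" using y unfolding arcs_def by force
  qed
  show ?thesis using 1 2 unfolding neighbours_def by auto
qed

lemma card_neighbours:
  assumes r: "0 < r" and u: "u < 4 * r * 2 ^ r"
  shows "card (neighbours r u) = 3" "finite (neighbours r u)" "u \<notin> neighbours r u"
    "neighbours r u \<subseteq> {..<4 * r * 2 ^ r}"
proof -
  obtain \<tau> x where *: "\<tau> < 4 * r" "x < 2 ^ r" "u = vertex r \<tau> x" using u by (rule vertexE)
  define \<tau>' where "\<tau>' = (\<tau> + 4 * r - 1) mod (4 * r)"
  have mc: "Suc \<tau> mod (4 * r) \<noteq> \<tau>'" "Suc \<tau>' mod (4 * r) = \<tau>" "Suc \<tau> mod (4 * r) \<noteq> \<tau>"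
    using mod_cycle[of \<tau> "4 * r"] * r unfolding \<tau>'_def by auto
  have l: "\<tau>' < 4 * r" "Suc \<tau> mod (4 * r) < 4 * r" using r by (auto simp: \<tau>'_def)
  have "Suc \<tau>' mod (4 * r) \<noteq> \<tau>'" using mod_cycle(4)[of \<tau>' "4 * r"] l r by auto
  then have ne: "\<tau>' \<noteq> \<tau>" using mc by auto
  \<comment> \<open>The length \<open>4 * r\<close> of the cycle is even, so the parity of stages
    alternates all around, and exactly one of the two sides offers two rows.\<close>
  have par: "even \<tau>' \<longleftrightarrow> odd \<tau>"
  proof -
    have "even (Suc \<tau>' mod (4 * r)) \<longleftrightarrow> even (Suc \<tau>')" by (simp add: dvd_mod_iff)
    then show ?thesis using mc by simp
  qed
  have nb: "neighbours r u =
      vertex r (Suc \<tau> mod (4 * r)) ` next_rows r \<tau> x \<union> vertex r \<tau>' ` next_rows r \<tau>' x"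
    using neighbours_vertex[OF r] * unfolding \<tau>'_def by simp
  have nl: "\<And>y t. y \<in> next_rows r t x \<Longrightarrow> y < 2 ^ r" using next_rows_less r * by blast
  have inj: "inj_on (vertex r t) (next_rows r t' x)" for t t'
    using nl by (auto simp: inj_on_def vertex_inj)
  have disj: "vertex r (Suc \<tau> mod (4 * r)) ` next_rows r \<tau> x \<inter> vertex r \<tau>' ` next_rows r \<tau>' x = {}"
    using mc nl by (auto simp: vertex_inj)
  show "card (neighbours r u) = 3"
    unfolding nb using disj par by (subst card_Un_disjoint) (auto simp: card_image[OF inj] card_next_rows)
  show "finite (neighbours r u)" unfolding nb by simp
  show "u \<notin> neighbours r u"
    unfolding nb using mc ne nl * by (auto simp: vertex_inj)
  show "neighbours r u \<subseteq> {..<4 * r * 2 ^ r}"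
    unfolding nb using nl l by (auto intro!: vertex_less)
qed

lemma neighbours_sym: "v \<in> neighbours r u \<longleftrightarrow> u \<in> neighbours r v"
  by (auto simp: neighbours_def)

lemma network_edges_neighbours: "(u, v) \<in> network_edges r \<longleftrightarrow> u < v \<and> v \<in> neighbours r u"
  by (auto simp: network_edges_def neighbours_def)

lemma arcs_verts: "0 < r \<Longrightarrow> (u, v) \<in> arcs r \<Longrightarrow> u < 4 * r * 2 ^ r \<and> v < 4 * r * 2 ^ r"
  unfolding arcs_def by (auto intro!: vertex_less) (rule next_rows_less; simp)

lemma network_edges_verts:
  "0 < r \<Longrightarrow> (u, v) \<in> network_edges r \<Longrightarrow> u < 4 * r * 2 ^ r \<and> v < 4 * r * 2 ^ r \<and> u < v"
  unfolding network_edges_def using arcs_verts by auto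

lemma finite_network_edges: "0 < r \<Longrightarrow> finite (network_edges r)"
  by (rule finite_subset[of _ "{..<4 * r * 2 ^ r} \<times> {..<4 * r * 2 ^ r}"])
     (auto dest: network_edges_verts)

lemma network_regular:
  assumes r: "0 < r" and x: "x < 4 * r * 2 ^ r"
  shows "card {(u, v) \<in> network_edges r. u = x \<or> v = x} = 3"
proof -
  let ?f = "\<lambda>y. (min x y, max x y)"
  have "{(u, v) \<in> network_edges r. u = x \<or> v = x} = ?f ` neighbours r x"
  proof (intro set_eqI iffI; clarify)
    fix u v assume e: "(u, v) \<in> network_edges r" and "u = x \<or> v = x"
    then consider "u = x" | "v = x" by blast
    then show "(u, v) \<in> ?f ` neighbours r x"
    proof cases
      case 1
      then show ?thesis using e by (intro image_eqI[of _ _ v]) (auto simp: network_edges_neighbours)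
    next
      case 2
      then have "u < x" "u \<in> neighbours r x"
        using e neighbours_sym[of x r u] by (simp_all add: network_edges_neighbours)
      then show ?thesis using 2 by (intro image_eqI[of _ _ u]) auto
    qed
  next
    fix u v y assume y: "y \<in> neighbours r x"
    then have "y \<noteq> x" "x \<in> neighbours r y"
      using card_neighbours(3)[OF r x] neighbours_sym by blast+
    then show "(min x y, max x y) \<in> network_edges r \<and> (min x y = x \<or> max x y = x)"
      using y by (cases "x < y") (auto simp: network_edges_neighbours)
  qed
  moreover have "inj_on ?f (neighbours r x)"
    by (auto simp: inj_on_def min_def max_def split: if_splits)
  ultimately show ?thesis using card_neighbours(1)[OF r x] by (simp add: card_image)
qed

text \<open>Summing the degrees counts every edge twice; the lost factor only enters the constant in
  \<open>\<chi>\<close>.\<close>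

lemma card_network_edges_le:
  assumes r: "0 < r"
  shows "card (network_edges r) \<le> 12 * r * 2 ^ r"
proof -
  have "network_edges r \<subseteq> (SIGMA u:{..<4 * r * 2 ^ r}. neighbours r u)"
    using network_edges_verts[OF r] by (auto simp: network_edges_neighbours)
  then have "card (network_edges r) \<le> card (SIGMA u:{..<4 * r * 2 ^ r}. neighbours r u)"
    using card_neighbours(2)[OF r] by (intro card_mono) auto
  also have "\<dots> = (\<Sum>u<4 * r * 2 ^ r. card (neighbours r u))"
    using card_neighbours(2)[OF r] by (subst card_SigmaI) auto
  also have "\<dots> = (\<Sum>u<4 * r * 2 ^ r. 3)" by (rule sum.cong) (use card_neighbours(1)[OF r] in auto)
  finally show ?thesis by simp
qed

section \<open>Balanced routing\<close>

text \<open>A residue class has at most \<open>n div R + 1\<close> elements. The form multiplied by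
  \<open>R\<close> lets such estimates be added without rounding again.\<close>

lemma card_mod_le: "0 < R \<Longrightarrow> R * card {i. i < n \<and> i mod R = w} \<le> n + (R :: nat)"
proof -
  assume R: "0 < R"
  have "{i. i < n \<and> i mod R = w} \<subseteq> (\<lambda>j. j * R + w) ` {..n div R}"
  proof
    fix i assume "i \<in> {i. i < n \<and> i mod R = w}"
    then have i: "i < n" "i mod R = w" by auto
    then have "i = (i div R) * R + w" by auto
    moreover have "i div R \<le> n div R" using i by (intro div_le_mono) auto
    ultimately show "i \<in> (\<lambda>j. j * R + w) ` {..n div R}" by blast
  qed
  then have "card {i. i < n \<and> i mod R = w} \<le> card ((\<lambda>j. j * R + w) ` {..n div R})"
    by (intro card_mono) auto
  also have "\<dots> \<le> n div R + 1" using card_image_le[of "{..n div R}"] by fastforce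
  finally have "R * card {i. i < n \<and> i mod R = w} \<le> R * (n div R + 1)" by (rule mult_left_mono) simp
  also have "\<dots> \<le> n + R" by (simp add: algebra_simps)
  finally show ?thesis .
qed

text \<open>Numbers the members of each fibre of \<open>f\<close> in increasing order. It serves
  both as round robin counter of a pair of terminals and as slot of a packet at a vertex; a single
  pass with one counter per fibre computes it.\<close>

definition rank :: "(nat \<Rightarrow> 'a) \<Rightarrow> nat \<Rightarrow> nat" where
  "rank f q = card {q'. q' < q \<and> f q' = f q}"

lemma rank_less:
  assumes "q < q'" "f q = f q'"
  shows "rank f q < rank f q'"
  unfolding rank_def by (rule psubset_card_mono) (use assms in auto)

lemma rank_inj: "f q = f q' \<Longrightarrow> rank f q = rank f q' \<Longrightarrow> q = q'"
  using rank_less[of q q' f] rank_less[of q' q f] by (cases q q' rule: linorder_cases) auto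

lemma rank_less_card: "q < n \<Longrightarrow> rank f q < card {q'. q' < n \<and> f q' = f q}"
  unfolding rank_def by (rule psubset_card_mono) auto

lemma card_rank_mod_le:
  assumes "0 < R"
  shows "R * card {q. q < n \<and> f q = v \<and> rank f q mod R = w} \<le> card {q. q < n \<and> f q = v} + R"
proof -
  let ?S = "{q. q < n \<and> f q = v \<and> rank f q mod R = w}" and ?a = "card {q. q < n \<and> f q = v}"
  have "rank f ` ?S \<subseteq> {i. i < ?a \<and> i mod R = w}" using rank_less_card[of _ n f] by auto
  moreover have "inj_on (rank f) ?S" using rank_inj[of f] by (auto simp: inj_on_def)
  ultimately have "card ?S \<le> card {i. i < ?a \<and> i mod R = w}"
    by (intro card_inj_on_le[of "rank f"]) auto
  then have "R * card ?S \<le> R * card {i. i < ?a \<and> i mod R = w}" by simp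
  also have "\<dots> \<le> ?a + R" by (rule card_mod_le[OF assms])
  finally show ?thesis .
qed

text \<open>Packets with the same terminals \<open>(s, d)\<close> take the intermediate rows in turn. Hence all
  pairs \<open>(s, w)\<close> and all pairs \<open>(w, d)\<close> carry about the same traffic, as with Valiant's random
  intermediate destinations.\<close>

lemma card_round_robin_le:
  fixes s d :: "nat \<Rightarrow> nat"
  assumes R: "0 < R" and d: "\<And>q. q < n \<Longrightarrow> d q < R"
    and m: "\<And>q. q < n \<Longrightarrow> m q = rank (\<lambda>q. (s q, d q)) q mod R"
  shows "R * card {q. q < n \<and> s q = x \<and> m q = w} \<le> card {q. q < n \<and> s q = x} + R * R"
proof -
  let ?f = "\<lambda>q. (s q, d q)"
  have "{q. q < n \<and> s q = x \<and> m q = w} =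
      (\<Union>y<R. {q. q < n \<and> ?f q = (x, y) \<and> rank ?f q mod R = w})"
    using d m by auto
  then have "card {q. q < n \<and> s q = x \<and> m q = w} \<le>
      (\<Sum>y<R. card {q. q < n \<and> ?f q = (x, y) \<and> rank ?f q mod R = w})"
    by (simp only:) (rule card_UN_le, simp)
  then have "R * card {q. q < n \<and> s q = x \<and> m q = w} \<le>
      (\<Sum>y<R. R * card {q. q < n \<and> ?f q = (x, y) \<and> rank ?f q mod R = w})"
    by (simp flip: sum_distrib_left)
  \<comment> \<open>Each of the \<open>R\<close> possible partners \<open>y\<close> contributes a
    rounding error \<open>R\<close>. This is the origin of the additive square in the load.\<close>
  also have "\<dots> \<le> (\<Sum>y<R. card {q. q < n \<and> ?f q = (x, y)} + R)"
    by (rule sum_mono) (rule card_rank_mod_le[OF R])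
  also have "\<dots> = (\<Sum>y<R. card {q. q < n \<and> ?f q = (x, y)}) + R * R"
    by (simp add: sum.distrib)
  also have "(\<Sum>y<R. card {q. q < n \<and> ?f q = (x, y)}) = card (\<Union>y<R. {q. q < n \<and> ?f q = (x, y)})"
    by (rule card_UN_disjoint[symmetric]) auto
  also have "(\<Union>y<R. {q. q < n \<and> ?f q = (x, y)}) = {q. q < n \<and> s q = x}" using d by auto
  finally show ?thesis .
qed

text \<open>At most \<open>2 ^ r\<close> pairs of terminals lead through a given row, and each pair
  carries at most the \<open>2 ^ r\<close>-th part of \<open>A + 2 ^ r * 2 ^ r\<close>. The factors
  cancel, so up to rounding no row inside the network is busier than a terminal may be.\<close>

lemma card_mix_load_le:
  fixes s d :: "nat \<Rightarrow> nat"
  assumes s: "\<And>q. q < n \<Longrightarrow> s q < 2 ^ r" and d: "\<And>q. q < n \<Longrightarrow> d q < 2 ^ r"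
    and c: "\<And>x w. 2 ^ r * card {q. q < n \<and> s q = x \<and> d q = w} \<le> A + 2 ^ r * 2 ^ r"
  shows "card {q. q < n \<and> mix l (s q) (d q) = x} \<le> A + 2 ^ r * 2 ^ r"
proof -
  let ?P = "{(s, w). s < 2 ^ r \<and> w < 2 ^ r \<and> mix l s w = x}"
  let ?C = "\<lambda>(y, w). {q. q < n \<and> s q = y \<and> d q = w}"
  have fin: "finite ?P" by (rule finite_subset[of _ "{..<2^r} \<times> {..<2^r}"]) auto
  have finC: "finite (?C p)" for p by (rule finite_subset[of _ "{..<n}"]) auto
  have "{q. q < n \<and> mix l (s q) (d q) = x} \<subseteq> (\<Union>p\<in>?P. ?C p)" using s d by auto
  then have "card {q. q < n \<and> mix l (s q) (d q) = x} \<le> card (\<Union>p\<in>?P. ?C p)"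
    using finC by (intro card_mono finite_UN_I[OF fin]) auto
  also have "\<dots> \<le> (\<Sum>p\<in>?P. card (?C p))" by (rule card_UN_le[OF fin])
  finally have "2 ^ r * card {q. q < n \<and> mix l (s q) (d q) = x} \<le> 2 ^ r * (\<Sum>p\<in>?P. card (?C p))"
    by simp
  also have "\<dots> = (\<Sum>p\<in>?P. 2 ^ r * card (?C p))" by (rule sum_distrib_left)
  also have "\<dots> \<le> (\<Sum>p\<in>?P. A + 2 ^ r * 2 ^ r)" by (rule sum_mono) (use c in auto)
  also have "\<dots> = card ?P * (A + 2 ^ r * 2 ^ r)" by simp
  also have "\<dots> \<le> 2 ^ r * (A + 2 ^ r * 2 ^ r)"
    by (rule mult_right_mono[OF card_mix_fibre]) simp
  finally show ?thesis by simp
qed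

section \<open>The constraint satisfaction instance\<close>

lemma rank_cong: "(\<And>q q'. f q = f q' \<longleftrightarrow> g q = g q') \<Longrightarrow> rank f = rank g"
  by (auto simp: rank_def fun_eq_iff)

text \<open>Clause \<open>c\<close> has the literal occurrences \<open>3 * c + j\<close> for \<open>j < 3\<close>; \<open>F v\<close> is a representative
  occurrence of the variable \<open>v\<close>. A packet for every occurrence \<open>q\<close> carries the value of its
  variable from the home of the representative to the home of \<open>q\<close>.\<close>

locale routing =
  fixes r M :: nat and var F :: "nat \<Rightarrow> nat" and sgn :: "nat \<Rightarrow> bool"
  assumes r: "0 < r"
    and F_less: "q < 3 * M \<Longrightarrow> F (var q) < 3 * M"
    and var_F: "q < 3 * M \<Longrightarrow> var (F (var q)) = var q"
begin

text \<open>Depends only on the clause \<open>q div 3\<close>: its three packets meet at one vertex,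
  where the clause can be tested. Clauses are dealt cyclically to the rows.\<close>

definition home :: "nat \<Rightarrow> nat" where
  "home q = (q div 3) mod 2 ^ r"

definition src :: "nat \<Rightarrow> nat" where
  "src q = home (F (var q))"

definition mid :: "nat \<Rightarrow> nat" where
  "mid q = rank (\<lambda>q. (src q, home q)) q mod 2 ^ r"

definition row :: "nat \<Rightarrow> nat \<Rightarrow> nat" where
  "row \<tau> q = (if \<tau> div 2 < r then mix (\<tau> div 2) (src q) (mid q)
    else mix (\<tau> div 2 - r) (mid q) (home q))"

definition pos :: "nat \<Rightarrow> nat \<Rightarrow> nat" where
  "pos \<tau> q = vertex r (\<tau> mod (4 * r)) (row \<tau> q)"

text \<open>Stages 0 and \<open>4 * r\<close> are the same vertices. At stage 0 a packet has no slot
  of its own but shares the one in which the packet of its representative arrives, so all packets of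
  a variable start from a single bit.\<close>

definition slot :: "nat \<Rightarrow> nat \<Rightarrow> nat" where
  "slot \<tau> q = (if \<tau> = 0 then rank (pos (4 * r)) (F (var q)) else rank (pos \<tau>) q)"

text \<open>\<open>a\<close> labels \<open>u\<close> and \<open>b\<close> labels \<open>v\<close>; a
  packet may cross the edge along or against its orientation.\<close>

definition link_ok :: "nat \<Rightarrow> nat \<Rightarrow> nat \<Rightarrow> nat \<Rightarrow> nat \<Rightarrow> nat \<Rightarrow> bool" where
  "link_ok u v a b \<tau> q \<longleftrightarrow>
    (pos \<tau> q = u \<and> pos (Suc \<tau>) q = v \<longrightarrow> bit a (slot \<tau> q) = bit b (slot (Suc \<tau>) q)) \<and>
    (pos \<tau> q = v \<and> pos (Suc \<tau>) q = u \<longrightarrow> bit b (slot \<tau> q) = bit a (slot (Suc \<tau>) q))"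

text \<open>Used for the smaller end of an edge only, which suffices because the larger end is never
  a home.\<close>

definition clause_ok :: "nat \<Rightarrow> nat \<Rightarrow> nat \<Rightarrow> bool" where
  "clause_ok u a c \<longleftrightarrow>
    (home (3 * c) = u \<longrightarrow> (\<exists>j<3. bit a (slot (4 * r) (3 * c + j)) = sgn (3 * c + j)))"

definition ok :: "nat \<Rightarrow> nat \<Rightarrow> nat \<Rightarrow> nat \<Rightarrow> bool" where
  "ok u v a b \<longleftrightarrow>
    (\<forall>q<3 * M. \<forall>\<tau><4 * r. link_ok u v a b \<tau> q) \<and> (\<forall>c<M. clause_ok u a c)"

definition csp :: "nat \<Rightarrow> csp2" where
  "csp B = \<lparr>verts = {..<4 * r * 2 ^ r}, edges = network_edges r, alphabet = {..<2 ^ B},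
    constr = (\<lambda>(u, v). {(a, b). a < 2 ^ B \<and> b < 2 ^ B \<and> ok u v a b})\<rparr>"

definition satisfies :: "(nat \<Rightarrow> bool) \<Rightarrow> nat \<Rightarrow> bool" where
  "satisfies \<alpha> c \<longleftrightarrow> (\<exists>j<3. \<alpha> (var (3 * c + j)) = sgn (3 * c + j))"

section \<open>Routes are walks in the network\<close>

lemma home_less: "home q < 2 ^ r" and src_less: "src q < 2 ^ r" and mid_less: "mid q < 2 ^ r"
  by (simp_all add: home_def src_def mid_def)

lemma row_less: "row \<tau> q < 2 ^ r"
  by (simp add: row_def mix_less home_less src_less mid_less)

lemma home_clause: "j < 3 \<Longrightarrow> home (3 * c + j) = home (3 * c)"
  by (simp add: home_def)

lemma row_full: "row (4 * r) q = home q"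
proof -
  have "4 * r div 2 - r = r" "\<not> 4 * r div 2 < r" by auto
  then show ?thesis unfolding row_def by (simp only: if_False mix_full[OF mid_less home_less])
qed

lemma pos_0: "pos 0 q = src q" and pos_full: "pos (4 * r) q = home q"
  using r row_full by (simp_all add: pos_def vertex_def row_def)

lemma row_Suc: "\<tau> < 4 * r \<Longrightarrow> row (Suc \<tau>) q \<in> next_rows r \<tau> (row \<tau> q)"
proof (cases "even \<tau>")
  case True
  then have "Suc \<tau> div 2 = \<tau> div 2" by simp
  then show ?thesis using True unfolding row_def next_rows_def by simp
next
  case False
  assume \<tau>: "\<tau> < 4 * r"
  define l where "l = \<tau> div 2"
  have l: "Suc \<tau> div 2 = Suc l" "l < 2 * r" using False \<tau> by (auto simp: l_def)
  have n: "next_rows r \<tau> x = {x, flip_bit (l mod r) x}" for x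
    using False by (simp add: next_rows_def l_def)
  consider "Suc l < r" | "Suc l = r" | "r \<le> l" by linarith
  then show ?thesis
  proof cases
    case 1
    then show ?thesis using mix_Suc[of l "src q" "mid q"] unfolding n row_def l(1) l_def[symmetric]
      by (simp del: mix.simps)
  next
    case 2
    \<comment> \<open>At the turn, the start of the second half coincides with the end of the first,
      so the step is still the correction of one bit.\<close>
    have "row (Suc \<tau>) q = mid q" using 2 l by (simp add: row_def)
    also have "\<dots> = mix (Suc l) (src q) (mid q)"
      using mix_full[OF src_less mid_less, of q q] 2 by (simp del: mix.simps)
    finally have "row (Suc \<tau>) q = mix (Suc l) (src q) (mid q)" .
    moreover have "row \<tau> q = mix l (src q) (mid q)" "l mod r = l"
      using 2 unfolding row_def l_def[symmetric] by auto
    ultimately show ?thesis using mix_Suc[of l "src q" "mid q"] unfolding n by simp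
  next
    case 3
    then have "l mod r = l - r" using l(2) by (simp add: mod_if)
    moreover have "row (Suc \<tau>) q = mix (Suc (l - r)) (mid q) (home q)"
      "row \<tau> q = mix (l - r) (mid q) (home q)"
      using 3 unfolding row_def l(1) l_def[symmetric] by (auto simp: Suc_diff_le simp del: mix.simps)
    ultimately show ?thesis using mix_Suc[of "l - r" "mid q" "home q"] unfolding n by simp
  qed
qed

lemma pos_arc: "\<tau> < 4 * r \<Longrightarrow> (pos \<tau> q, pos (Suc \<tau>) q) \<in> arcs r"
  using row_Suc[of \<tau> q] row_less[of \<tau> q] unfolding arcs_def pos_def by auto

lemma pos_edge:
  assumes "\<tau> < 4 * r"
  shows "(pos \<tau> q, pos (Suc \<tau>) q) \<in> network_edges r \<or> (pos (Suc \<tau>) q, pos \<tau> q) \<in> network_edges r"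
proof -
  have a: "(pos \<tau> q, pos (Suc \<tau>) q) \<in> arcs r" by (rule pos_arc[OF assms])
  then have "pos (Suc \<tau>) q \<in> neighbours r (pos \<tau> q)" by (simp add: neighbours_def)
  then have "pos (Suc \<tau>) q \<noteq> pos \<tau> q"
    using card_neighbours(3)[OF r] arcs_verts[OF r a] by metis
  then show ?thesis using a unfolding network_edges_def by (auto simp: neq_iff)
qed

text \<open>Without stage 0, which repeats stage \<open>4 * r\<close>, the stage can be read off the
  vertex. Hence packets of different stages never compete for the bits of one label.\<close>

lemma pos_stage:
  assumes "pos \<tau> q = pos \<tau>' q'" "\<tau> \<in> {1..4 * r}" "\<tau>' \<in> {1..4 * r}"
  shows "\<tau> = \<tau>'"
proof -
  have "\<tau> mod (4 * r) = \<tau>' mod (4 * r)"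
    using assms(1) vertex_inj[OF row_less row_less] unfolding pos_def by blast
  then show ?thesis using assms(2,3) by (auto simp: mod_if split: if_splits)
qed

lemma pos_home: "\<tau> \<le> 4 * r \<Longrightarrow> pos \<tau> q < 2 ^ r \<Longrightarrow> \<tau> = 0 \<or> \<tau> = 4 * r"
proof (rule ccontr)
  assume a: "\<tau> \<le> 4 * r" "pos \<tau> q < 2 ^ r" "\<not> (\<tau> = 0 \<or> \<tau> = 4 * r)"
  then have "1 * 2 ^ r \<le> \<tau> * 2 ^ r" by (intro mult_right_mono) auto
  moreover have "pos \<tau> q = \<tau> * 2 ^ r + row \<tau> q" using a(1,3) by (simp add: pos_def vertex_def)
  ultimately show False using a(2) by linarith
qed

section \<open>The load of a vertex\<close>

context
  fixes \<Delta> :: nat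
  assumes \<Delta>: "0 < \<Delta>" "\<And>v. card {q. q < 3 * M \<and> var q = v} \<le> \<Delta>"
begin

text \<open>A row is home to at most \<open>3 * (M div 2 ^ r + 1)\<close> occurrences, each of which
  may represent a variable with \<open>\<Delta>\<close> packets; the square is the rounding error of
  balanced routing.\<close>

definition load_bound :: nat where
  "load_bound = \<Delta> * (3 * (M div 2 ^ r + 1)) + 2 ^ r * 2 ^ r"

lemma card_home_le: "card {q. q < 3 * M \<and> home q = x} \<le> 3 * (M div 2 ^ r + 1)"
proof -
  let ?C = "{c. c < M \<and> c mod 2 ^ r = x}"
  have "{q. q < 3 * M \<and> home q = x} \<subseteq> (\<lambda>(c, j). 3 * c + j) ` (?C \<times> {..<3})"
  proof
    fix q assume "q \<in> {q. q < 3 * M \<and> home q = x}"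
    then have "q = (\<lambda>(c, j). 3 * c + j) (q div 3, q mod 3)" "(q div 3, q mod 3) \<in> ?C \<times> {..<3}"
      by (auto simp: home_def)
    then show "q \<in> (\<lambda>(c, j). 3 * c + j) ` (?C \<times> {..<3})" by (rule image_eqI)
  qed
  then have "card {q. q < 3 * M \<and> home q = x} \<le> card ((\<lambda>(c, j). 3 * c + j) ` (?C \<times> {..<3}))"
    by (intro card_mono) auto
  also have "\<dots> \<le> card (?C \<times> {..<3::nat})" by (rule card_image_le) auto
  finally have 1: "card {q. q < 3 * M \<and> home q = x} \<le> card ?C * 3" by simp
  have "2 ^ r * card ?C \<le> M + 2 ^ r" by (rule card_mod_le) simp
  then have "2 ^ r * card ?C div 2 ^ r \<le> (M + 2 ^ r) div 2 ^ r" by (rule div_le_mono)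
  then have "card ?C \<le> M div 2 ^ r + 1" by simp
  then show ?thesis using 1 by simp
qed

lemma card_src_le: "card {q. q < 3 * M \<and> src q = x} \<le> \<Delta> * (3 * (M div 2 ^ r + 1))"
proof -
  let ?H = "{q. q < 3 * M \<and> home q = x}"
  have "{q. q < 3 * M \<and> src q = x} \<subseteq> (\<Union>q'\<in>?H. {q. q < 3 * M \<and> var q = var q'})"
    using F_less var_F by (fastforce simp: src_def)
  then have "card {q. q < 3 * M \<and> src q = x} \<le> card (\<Union>q'\<in>?H. {q. q < 3 * M \<and> var q = var q'})"
    by (intro card_mono) auto
  also have "\<dots> \<le> (\<Sum>q'\<in>?H. card {q. q < 3 * M \<and> var q = var q'})" by (rule card_UN_le) auto
  also have "\<dots> \<le> (\<Sum>q'\<in>?H. \<Delta>)" by (rule sum_mono) (rule \<Delta>)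
  also have "\<dots> = \<Delta> * card ?H" by simp
  also have "\<dots> \<le> \<Delta> * (3 * (M div 2 ^ r + 1))" using card_home_le by (rule mult_left_mono) simp
  finally show ?thesis .
qed

lemma card_row_le: "card {q. q < 3 * M \<and> row \<tau> q = x} \<le> load_bound"
proof -
  let ?n = "3 * M" and ?A = "\<Delta> * (3 * (M div 2 ^ r + 1))"
  have 1: "2 ^ r * card {q. q < ?n \<and> src q = x \<and> mid q = w} \<le> ?A + 2 ^ r * 2 ^ r" for x w
  proof -
    have "2 ^ r * card {q. q < ?n \<and> src q = x \<and> mid q = w} \<le>
        card {q. q < ?n \<and> src q = x} + 2 ^ r * 2 ^ r"
      by (rule card_round_robin_le[where d = home]) (auto simp: home_less mid_def)
    then show ?thesis using card_src_le[of x] by linarith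
  qed
  have 2: "2 ^ r * card {q. q < ?n \<and> mid q = w \<and> home q = x} \<le> ?A + 2 ^ r * 2 ^ r" for x w
  proof -
    \<comment> \<open>Taking turns is symmetric in the two terminals, so the same intermediate rows
      also look balanced from the destinations; this handles the second half of the routes.\<close>
    have "rank (\<lambda>q. (src q, home q)) = rank (\<lambda>q. (home q, src q))" by (rule rank_cong) auto
    then have "2 ^ r * card {q. q < ?n \<and> home q = x \<and> mid q = w} \<le>
        card {q. q < ?n \<and> home q = x} + 2 ^ r * 2 ^ r"
      by (intro card_round_robin_le[where d = src]) (auto simp: src_less mid_def)
    moreover have "card {q. q < ?n \<and> home q = x} \<le> ?A"
      using card_home_le[of x] mult_le_mono1[of 1 \<Delta> "3 * (M div 2 ^ r + 1)"] \<Delta>(1) by linarith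
    moreover have "{q. q < ?n \<and> home q = x \<and> mid q = w} = {q. q < ?n \<and> mid q = w \<and> home q = x}"
      by auto
    ultimately show ?thesis by simp
  qed
  show ?thesis
  proof (cases "\<tau> div 2 < r")
    case True
    then show ?thesis unfolding row_def load_bound_def
      using card_mix_load_le[OF src_less mid_less 1] by simp
  next
    case False
    then show ?thesis unfolding row_def load_bound_def
      using card_mix_load_le[OF mid_less home_less 2] by simp
  qed
qed

lemma card_pos_le: "card {q. q < 3 * M \<and> pos \<tau> q = u} \<le> load_bound"
proof (cases "\<exists>q. pos \<tau> q = u")
  case True
  then obtain q0 where "u = vertex r (\<tau> mod (4 * r)) (row \<tau> q0)" by (auto simp: pos_def)
  then have "{q. q < 3 * M \<and> pos \<tau> q = u} = {q. q < 3 * M \<and> row \<tau> q = row \<tau> q0}"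
    by (auto simp: pos_def vertex_inj row_less)
  then show ?thesis using card_row_le by simp
qed simp

lemma rank_pos_less: "q < 3 * M \<Longrightarrow> rank (pos \<tau>) q < load_bound"
  using rank_less_card[of q "3 * M" "pos \<tau>"] card_pos_le[of \<tau> "pos \<tau> q"] by linarith

text \<open>A vertex belongs to a single stage among \<open>1, ..., 4 * r\<close>, so counting
  visits at any time costs no factor of the route length.\<close>

lemma card_visits_le:
  "card {q. q < 3 * M \<and> (\<exists>\<tau>\<in>{1..4 * r}. pos \<tau> q = u)} \<le> load_bound"
proof (cases "\<exists>\<tau>\<in>{1..4 * r}. \<exists>q. pos \<tau> q = u")
  case True
  then obtain t q0 where t: "t \<in> {1..4 * r}" "pos t q0 = u" by blast
  then have "{q. q < 3 * M \<and> (\<exists>\<tau>\<in>{1..4 * r}. pos \<tau> q = u)} = {q. q < 3 * M \<and> pos t q = u}"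
    using pos_stage by blast
  then show ?thesis using card_pos_le by simp
next
  case False
  then have "{q. q < 3 * M \<and> (\<exists>\<tau>\<in>{1..4 * r}. pos \<tau> q = u)} = {}" by blast
  then show ?thesis by (simp only: card.empty)
qed

subsection \<open>Soundness\<close>

text \<open>Packets are charged for visiting an end of the edge rather than for crossing it, which
  reduces counting to the loads of two vertices. Leaving out stage 0 loses nothing: every arc of a
  route has its later end in \<open>{1..4 * r}\<close>.\<close>

definition blame :: "nat \<times> nat \<Rightarrow> nat set" where
  "blame e = {c. c < M \<and> (\<exists>j<3. \<exists>\<tau>\<in>{1..4 * r}. pos \<tau> (3 * c + j) \<in> {fst e, snd e})}"

lemma card_blame_le: "card (blame e) \<le> 2 * load_bound"
proof -
  let ?V = "\<lambda>u. {q. q < 3 * M \<and> (\<exists>\<tau>\<in>{1..4 * r}. pos \<tau> q = u)}"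
  have "blame e \<subseteq> (\<lambda>q. q div 3) ` (?V (fst e) \<union> ?V (snd e))"
  proof
    fix c assume "c \<in> blame e"
    then obtain j \<tau> where *: "c < M" "j < 3" "\<tau> \<in> {1..4 * r}" "pos \<tau> (3 * c + j) \<in> {fst e, snd e}"
      unfolding blame_def by blast
    then have "3 * c + j < 3 * M" "(3 * c + j) div 3 = c" by auto
    then show "c \<in> (\<lambda>q. q div 3) ` (?V (fst e) \<union> ?V (snd e))"
      using * by (intro image_eqI[of _ _ "3 * c + j"]) auto
  qed
  then have "card (blame e) \<le> card ((\<lambda>q. q div 3) ` (?V (fst e) \<union> ?V (snd e)))"
    by (intro card_mono) auto
  also have "\<dots> \<le> card (?V (fst e) \<union> ?V (snd e))" by (rule card_image_le) auto
  also have "\<dots> \<le> card (?V (fst e)) + card (?V (snd e))" by (rule card_Un_le)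
  finally show ?thesis using card_visits_le[of "fst e"] card_visits_le[of "snd e"] by linarith
qed

text \<open>The bit is the one in which the packet of the representative arrives, so every packet of
  the variable carries the decoded value at stage 0 by definition.\<close>

definition decode :: "(nat \<Rightarrow> nat) \<Rightarrow> nat \<Rightarrow> bool" where
  "decode \<sigma> v = bit (\<sigma> (home (F v))) (rank (pos (4 * r)) (F v))"

text \<open>If no violated edge blames a clause, its three packets travel unchanged from the decoded
  values to its home, where the clause test succeeds; so the clause is satisfied. Every unsatisfied
  clause is therefore blamed.\<close>

lemma unsatisfied_le:
  fixes \<sigma> :: "nat \<Rightarrow> nat"
  defines "bad \<equiv> {(u, v). (u, v) \<in> network_edges r \<and> \<not> ok u v (\<sigma> u) (\<sigma> v)}"
  shows "card {c. c < M \<and> \<not> satisfies (decode \<sigma>) c} \<le> card bad * (2 * load_bound)"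
proof -
  have fin: "finite bad"
    by (rule finite_subset[OF _ finite_network_edges[OF r]]) (auto simp: bad_def)
  have "{c. c < M \<and> \<not> satisfies (decode \<sigma>) c} \<subseteq> (\<Union>e\<in>bad. blame e)"
  proof
    fix c assume "c \<in> {c. c < M \<and> \<not> satisfies (decode \<sigma>) c}"
    then have c: "c < M" "\<not> satisfies (decode \<sigma>) c" by auto
    show "c \<in> (\<Union>e\<in>bad. blame e)"
    proof (rule ccontr)
      assume n: "c \<notin> (\<Union>e\<in>bad. blame e)"
      have good: "ok u v (\<sigma> u) (\<sigma> v)"
        if "(u, v) \<in> network_edges r" "j < 3" "\<tau> < 4 * r" "pos (Suc \<tau>) (3 * c + j) \<in> {u, v}"
        for u v \<tau> j
      proof (rule ccontr)
        assume "\<not> ok u v (\<sigma> u) (\<sigma> v)"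
        then have "(u, v) \<in> bad" using that by (simp add: bad_def)
        moreover have "c \<in> blame (u, v)"
          using that c unfolding blame_def by (auto intro!: bexI[of _ "Suc \<tau>"] exI[of _ j])
        ultimately show False using n by blast
      qed
      have walk: "bit (\<sigma> (pos \<tau> (3 * c + j))) (slot \<tau> (3 * c + j)) = decode \<sigma> (var (3 * c + j))"
        if "j < 3" "\<tau> \<le> 4 * r" for j \<tau>
        using that(2)
      proof (induction \<tau>)
        case 0
        show ?case by (simp add: pos_0 slot_def decode_def src_def)
      next
        case (Suc \<tau>)
        let ?q = "3 * c + j"
        have q: "?q < 3 * M" "\<tau> < 4 * r" using c that Suc.prems by auto
        from pos_edge[OF q(2), of ?q]
        have "bit (\<sigma> (pos \<tau> ?q)) (slot \<tau> ?q) = bit (\<sigma> (pos (Suc \<tau>) ?q)) (slot (Suc \<tau>) ?q)"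
        proof
          assume e: "(pos \<tau> ?q, pos (Suc \<tau>) ?q) \<in> network_edges r"
          have "ok (pos \<tau> ?q) (pos (Suc \<tau>) ?q) (\<sigma> (pos \<tau> ?q)) (\<sigma> (pos (Suc \<tau>) ?q))"
            by (rule good[OF e that(1) q(2)]) simp
          then show ?thesis using q unfolding ok_def link_ok_def by blast
        next
          assume e: "(pos (Suc \<tau>) ?q, pos \<tau> ?q) \<in> network_edges r"
          have "ok (pos (Suc \<tau>) ?q) (pos \<tau> ?q) (\<sigma> (pos (Suc \<tau>) ?q)) (\<sigma> (pos \<tau> ?q))"
            by (rule good[OF e that(1) q(2)]) simp
          then show ?thesis using q unfolding ok_def link_ok_def by blast
        qed
        then show ?case using Suc by simp
      qed
      let ?t = "4 * r - 1" and ?q = "3 * c"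
      have t: "?t < 4 * r" "Suc ?t = 4 * r" using r by auto
      have h: "pos (Suc ?t) ?q = home ?q" using t pos_full by simp
      \<comment> \<open>Clauses are tested at the smaller end only. The vertex before the home is
        not of stage 0, hence larger, so the last edge of the route tests the clause.\<close>
      have "(pos (Suc ?t) ?q, pos ?t ?q) \<in> network_edges r"
      proof -
        have "\<not> pos ?t ?q < 2 ^ r" using pos_home[of ?t ?q] t r by auto
        then have "\<not> pos ?t ?q < pos (Suc ?t) ?q" using home_less[of ?q] h by linarith
        then show ?thesis using pos_edge[OF t(1), of ?q] network_edges_verts[OF r] by blast
      qed
      moreover have "pos (Suc ?t) (3 * c + 0) \<in> {pos (Suc ?t) ?q, pos ?t ?q}" by simp
      ultimately have "ok (pos (Suc ?t) ?q) (pos ?t ?q) (\<sigma> (pos (Suc ?t) ?q)) (\<sigma> (pos ?t ?q))"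
        using good[of "pos (Suc ?t) ?q" "pos ?t ?q" 0 ?t] t(1) by simp
      then have "clause_ok (home ?q) (\<sigma> (home ?q)) c" using c h unfolding ok_def by simp
      then obtain j where j: "j < 3"
        "bit (\<sigma> (home ?q)) (slot (4 * r) (3 * c + j)) = sgn (3 * c + j)"
        unfolding clause_ok_def by blast
      have "decode \<sigma> (var (3 * c + j)) = sgn (3 * c + j)"
        using walk[OF j(1), of "4 * r"] j home_clause[OF j(1)] by (simp add: pos_full)
      then show False using c(2) j(1) unfolding satisfies_def by blast
    qed
  qed
  then have "card {c. c < M \<and> \<not> satisfies (decode \<sigma>) c} \<le> card (\<Union>e\<in>bad. blame e)"
    using fin by (intro card_mono) (auto simp: blame_def)
  also have "\<dots> \<le> (\<Sum>e\<in>bad. card (blame e))" by (rule card_UN_le[OF fin])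
  also have "\<dots> \<le> (\<Sum>e\<in>bad. 2 * load_bound)" by (rule sum_mono) (rule card_blame_le)
  also have "\<dots> = card bad * (2 * load_bound)" by simp
  finally show ?thesis .
qed

lemma CSP_sound:
  assumes "\<And>\<alpha>. t < card {c. c < M \<and> \<not> satisfies \<alpha> c}"
  shows "t < (card (edges (csp B)) - CSP (csp B)) * (2 * load_bound) \<and>
    CSP (csp B) \<le> card (edges (csp B))"
proof -
  let ?f = "\<lambda>\<sigma>. card {(u, v) \<in> edges (csp B). (\<sigma> u, \<sigma> v) \<in> constr (csp B) (u, v)}"
  let ?S = "verts (csp B) \<rightarrow>\<^sub>E alphabet (csp B)"
  have "finite ?S" by (rule finite_PiE) (auto simp: csp_def)
  moreover have "restrict (\<lambda>_. 0) (verts (csp B)) \<in> ?S" by (auto simp: csp_def)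
  ultimately have "CSP (csp B) \<in> ?f ` ?S" unfolding CSP_def by (intro Max_in) blast+
  then obtain \<sigma> where \<sigma>: "\<sigma> \<in> ?S" "CSP (csp B) = ?f \<sigma>" by blast
  have fin: "finite (edges (csp B))" using finite_network_edges[OF r] by (simp add: csp_def)
  let ?good = "{(u, v) \<in> edges (csp B). (\<sigma> u, \<sigma> v) \<in> constr (csp B) (u, v)}"
  let ?bad = "{(u, v). (u, v) \<in> network_edges r \<and> \<not> ok u v (\<sigma> u) (\<sigma> v)}"
  \<comment> \<open>Labels come from the alphabet, so a constraint can fail only in
    \<open>ok\<close>.\<close>
  have "edges (csp B) - ?good = ?bad"
    using \<sigma>(1) network_edges_verts[OF r] by (fastforce simp: csp_def PiE_iff)
  then have "card ?bad = card (edges (csp B)) - card ?good"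
    using card_Diff_subset[of ?good "edges (csp B)"] finite_subset[OF _ fin, of ?good] by auto
  moreover have "card ?good \<le> card (edges (csp B))" by (rule card_mono[OF fin]) auto
  moreover have "t < card ?bad * (2 * load_bound)"
    using unsatisfied_le[of \<sigma>] assms[of "decode \<sigma>"] by linarith
  ultimately show ?thesis using \<sigma>(2) by simp
qed

end

subsection \<open>Completeness\<close>

lemma ex_nat_bits: "\<exists>a<2 ^ B. \<forall>i<B. bit (a :: nat) i = P i"
proof -
  let ?a = "horner_sum of_bool 2 (map P [0..<B]) :: nat"
  have "?a < 2 ^ B" using horner_sum_of_bool_2_less[of "map P [0..<B]"] by simp
  moreover have "\<forall>i<B. bit ?a i = P i" by (simp add: bit_horner_sum_bit_iff)
  ultimately show ?thesis by blast
qed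

text \<open>Writes the values \<open>val\<close> of all packets visiting \<open>u\<close> into their
  slots. Stage 0 contributes nothing, since its slots belong to packets of stage
  \<open>4 * r\<close>.\<close>

definition label :: "(nat \<Rightarrow> nat \<Rightarrow> bool) \<Rightarrow> nat \<Rightarrow> nat \<Rightarrow> nat" where
  "label val B u = (SOME a. a < 2 ^ B \<and> (\<forall>i<B. bit a i =
    (\<exists>\<tau>\<in>{1..4 * r}. \<exists>q<3 * M. pos \<tau> q = u \<and> rank (pos \<tau>) q = i \<and> val \<tau> q)))"

lemma label: "label val B u < 2 ^ B"
  "i < B \<Longrightarrow> bit (label val B u) i =
    (\<exists>\<tau>\<in>{1..4 * r}. \<exists>q<3 * M. pos \<tau> q = u \<and> rank (pos \<tau>) q = i \<and> val \<tau> q)"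
  using someI_ex[OF ex_nat_bits[of B "\<lambda>i. \<exists>\<tau>\<in>{1..4 * r}. \<exists>q<3 * M. pos \<tau> q = u \<and>
    rank (pos \<tau>) q = i \<and> val \<tau> q"]] unfolding label_def by blast+

context
  fixes B :: nat
  assumes B: "\<And>\<tau> q. \<tau> \<in> {1..4 * r} \<Longrightarrow> q < 3 * M \<Longrightarrow> rank (pos \<tau>) q < B"
begin

lemma bit_label:
  fixes val :: "nat \<Rightarrow> nat \<Rightarrow> bool"
  assumes "\<tau> \<in> {1..4 * r}" "q < 3 * M"
  shows "bit (label val B (pos \<tau> q)) (slot \<tau> q) = val \<tau> q"
proof -
  have "slot \<tau> q = rank (pos \<tau>) q" using assms by (auto simp: slot_def)
  moreover have "\<tau>' = \<tau> \<and> q' = q"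
    if "\<tau>' \<in> {1..4 * r}" "pos \<tau>' q' = pos \<tau> q" "rank (pos \<tau>') q' = rank (pos \<tau>) q" for \<tau>' q'
  proof -
    have "\<tau>' = \<tau>" using pos_stage that assms by blast
    then show ?thesis using that rank_inj[of "pos \<tau>" q' q] by simp
  qed
  ultimately show ?thesis using label(2)[OF B[OF assms]] assms by metis
qed

lemma bit_label_0:
  fixes val :: "nat \<Rightarrow> nat \<Rightarrow> bool"
  assumes "q < 3 * M"
  shows "bit (label val B (pos 0 q)) (slot 0 q) = val (4 * r) (F (var q))"
proof -
  have "pos 0 q = pos (4 * r) (F (var q))" by (simp add: pos_0 pos_full src_def)
  moreover have "slot 0 q = slot (4 * r) (F (var q))" using r by (simp add: slot_def)
  ultimately show ?thesis using bit_label[of "4 * r" "F (var q)"] F_less[OF assms] r by simp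
qed

text \<open>Every packet carries the value of its variable under \<open>\<alpha>\<close> at all
  stages, so \<open>val\<close> ignores the stage and all links agree.\<close>

lemma CSP_complete:
  assumes "\<And>c. c < M \<Longrightarrow> satisfies \<alpha> c"
  shows "CSP (csp B) = card (edges (csp B))"
proof (rule antisym)
  let ?f = "\<lambda>\<sigma>. card {(u, v) \<in> edges (csp B). (\<sigma> u, \<sigma> v) \<in> constr (csp B) (u, v)}"
  let ?S = "verts (csp B) \<rightarrow>\<^sub>E alphabet (csp B)"
  have fin: "finite (edges (csp B))" using finite_network_edges[OF r] by (simp add: csp_def)
  have finS: "finite (?f ` ?S)" by (intro finite_imageI finite_PiE) (auto simp: csp_def)
  have "restrict (\<lambda>_. 0) (verts (csp B)) \<in> ?S" by (auto simp: csp_def)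
  then have "?f ` ?S \<noteq> {}" by blast
  then show "CSP (csp B) \<le> card (edges (csp B))"
    unfolding CSP_def using finS by (subst Max_le_iff) (auto intro!: card_mono[OF fin])
  define val where "val = (\<lambda>\<tau>::nat. \<lambda>q. \<alpha> (var q))"
  let ?\<sigma> = "restrict (label val B) (verts (csp B))"
  have S: "?\<sigma> \<in> ?S" using label(1) by (auto simp: csp_def)
  have bl: "bit (label val B (pos \<tau> q)) (slot \<tau> q) = \<alpha> (var q)"
    if "\<tau> \<le> 4 * r" "q < 3 * M" for \<tau> q
    using bit_label[of \<tau> q val] bit_label_0[of q val] that var_F
    by (cases "\<tau> = 0") (auto simp: val_def)
  have "ok u v (label val B u) (label val B v)" for u v
    unfolding ok_def
  proof (intro conjI allI impI)
    fix q \<tau> assume "q < 3 * M" "\<tau> < 4 * r"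
    then show "link_ok u v (label val B u) (label val B v) \<tau> q"
      using bl[of \<tau> q] bl[of "Suc \<tau>" q] unfolding link_ok_def by auto
  next
    fix c assume c: "c < M"
    show "clause_ok u (label val B u) c" unfolding clause_ok_def
    proof
      assume u: "home (3 * c) = u"
      obtain j where j: "j < 3" "\<alpha> (var (3 * c + j)) = sgn (3 * c + j)"
        using assms[OF c] unfolding satisfies_def by blast
      then have "bit (label val B (pos (4 * r) (3 * c + j))) (slot (4 * r) (3 * c + j)) = sgn (3 * c + j)"
        using bl[of "4 * r" "3 * c + j"] c by simp
      then show "\<exists>j<3. bit (label val B u) (slot (4 * r) (3 * c + j)) = sgn (3 * c + j)"
        using j(1) u home_clause[OF j(1)] pos_full by (intro exI[of _ j]) simp
    qed
  qed
  then have "{(u, v) \<in> edges (csp B). (?\<sigma> u, ?\<sigma> v) \<in> constr (csp B) (u, v)} = edges (csp B)"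
    using label(1) network_edges_verts[OF r] by (auto simp: csp_def)
  then have "card (edges (csp B)) = ?f ?\<sigma>" by simp
  also have "\<dots> \<le> CSP (csp B)" unfolding CSP_def by (rule Max_ge[OF finS imageI[OF S]])
  finally show "card (edges (csp B)) \<le> CSP (csp B)" .
qed

text \<open>This must hold even for unsatisfiable formulas. An edge away from the homes tests no
  clause and accepts zero labels. At a home every packet arrives with the sign of its own literal,
  which satisfies all clauses; the resulting inconsistency is hidden on arcs that avoid the
  homes.\<close>

lemma constr_nonempty:
  assumes "(u, v) \<in> network_edges r"
  shows "\<exists>a b. a < 2 ^ B \<and> b < 2 ^ B \<and> ok u v a b"
proof (cases "u < 2 ^ r")
  case False
  have "clause_ok u 0 c" for c using False home_less[of "3 * c"] by (auto simp: clause_ok_def)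
  then have "ok u v 0 0" by (simp add: ok_def link_ok_def)
  then show ?thesis by (intro exI[of _ 0]) simp
next
  case True
  \<comment> \<open>A home emits the bit that the representative delivers there, so stage 1 has to
    repeat the sign of \<open>F (var q)\<close>. The change to \<open>sgn q\<close> happens between
    stages 1 and 2, on an arc that does not meet \<open>u\<close>.\<close>
  define val where "val = (\<lambda>(\<tau>::nat) q. if \<tau> = 1 then sgn (F (var q)) else sgn q)"
  have "ok u v (label val B u) (label val B v)"
    unfolding ok_def
  proof (intro conjI allI impI)
    fix q \<tau> assume q: "q < 3 * M" and t: "\<tau> < 4 * r"
    have "bit (label val B (pos \<tau> q)) (slot \<tau> q) = bit (label val B (pos (Suc \<tau>) q)) (slot (Suc \<tau>) q)"
      if "pos \<tau> q = u \<or> pos (Suc \<tau>) q = u"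
    proof -
      have "\<tau> = 0 \<or> Suc \<tau> = 4 * r"
        using that True pos_home[of \<tau> q] pos_home[of "Suc \<tau>" q] t by auto
      then show ?thesis
      proof
        assume "\<tau> = 0"
        then show ?thesis using bit_label_0[OF q, of val] bit_label[of 1 q val] q r
          by (simp add: val_def)
      next
        assume "Suc \<tau> = 4 * r"
        then have "4 \<le> Suc \<tau>" "Suc \<tau> \<le> 4 * r" using r by linarith+
        then have "\<tau> \<in> {1..4 * r}" "Suc \<tau> \<in> {1..4 * r}" "\<tau> \<noteq> 1" "Suc \<tau> \<noteq> 1" by auto
        then show ?thesis using bit_label[of \<tau> q val] bit_label[of "Suc \<tau>" q val] q
          by (simp add: val_def)
      qed
    qed
    then show "link_ok u v (label val B u) (label val B v) \<tau> q" unfolding link_ok_def by auto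
  next
    fix c assume c: "c < M"
    have "bit (label val B (pos (4 * r) (3 * c))) (slot (4 * r) (3 * c)) = sgn (3 * c)"
      using bit_label[of "4 * r" "3 * c" val] c r by (simp add: val_def)
    then show "clause_ok u (label val B u) c" unfolding clause_ok_def pos_full
      by (auto intro!: exI[of _ 0])
  qed
  then show ?thesis using label(1) by blast
qed

lemma is_csp2_csp: "is_csp2 (csp B)"
proof -
  have "u \<in> verts (csp B) \<and> v \<in> verts (csp B) \<and> u < v \<and>
      constr (csp B) (u, v) \<noteq> {} \<and> constr (csp B) (u, v) \<subseteq> alphabet (csp B) \<times> alphabet (csp B)"
    if "(u, v) \<in> edges (csp B)" for u v
  proof -
    have e: "(u, v) \<in> network_edges r" using that by (simp add: csp_def)
    obtain a b where "a < 2 ^ B" "b < 2 ^ B" "ok u v a b" using constr_nonempty[OF e] by blast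
    then have "(a, b) \<in> constr (csp B) (u, v)" by (simp add: csp_def)
    then show ?thesis using network_edges_verts[OF r e] by (auto simp: csp_def)
  qed
  moreover have "finite (verts (csp B))" "finite (alphabet (csp B))" by (simp_all add: csp_def)
  ultimately show ?thesis
    unfolding is_csp2_def Ball_def split_paired_All prod.case by blast
qed

end

lemma three_regular_csp: "three_regular (csp B)"
  using network_regular[OF r] by (simp add: three_regular_def csp_def)

lemma card_verts_csp: "card (verts (csp B)) = 4 * r * 2 ^ r"
  by (simp add: csp_def)

lemma card_edges_csp: "card (edges (csp B)) \<le> 12 * r * 2 ^ r"
  using card_network_edges_le[OF r] by (simp add: csp_def)

end

section \<open>The reduction as a program\<close>

lemma runs_to_Cons:
  assumes "runs_to p s U P"
    "\<And>s'. P s' \<Longrightarrow> framed (wregs p) (warrs p) s s' \<Longrightarrow> runs_to (seqs ps) s' V Q" "U + V \<le> T"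
  shows "runs_to (seqs (p # ps)) s T Q"
  using runs_to_Seq[OF assms] by simp

lemma runs_to_single: "runs_to p s T Q \<Longrightarrow> T + 1 \<le> T' \<Longrightarrow> runs_to (seqs [p]) s T' Q"
  by (erule runs_to_Cons) (auto intro: runs_to_Skip)

subsection \<open>Reading the formula\<close>

fun clause_literals :: "clause \<Rightarrow> literal list" where
  "clause_literals (l1, l2, l3) = [l1, l2, l3]"

fun is_Pos :: "literal \<Rightarrow> bool" where
  "is_Pos (Pos v) = True"
| "is_Pos (Neg v) = False"

abbreviation occurrences :: "clause list \<Rightarrow> literal list" where
  "occurrences cs \<equiv> concat (map clause_literals cs)"

lemma length_occurrences: "length (occurrences cs) = 3 * length cs"
  by (induction cs) auto

lemma occurrences_nth: "c < length cs \<Longrightarrow> j < 3 \<Longrightarrow>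
    occurrences cs ! (3 * c + j) = clause_literals (cs ! c) ! j"
proof (induction cs arbitrary: c)
  case (Cons x xs)
  obtain l1 l2 l3 where x: "x = (l1, l2, l3)" by (cases x)
  show ?case
  proof (cases c)
    case 0
    moreover have "j = 0 \<or> j = 1 \<or> j = 2" using Cons.prems(2) by auto
    ultimately show ?thesis by (auto simp: x)
  next
    case (Suc c')
    have "3 * c + j = Suc (Suc (Suc (3 * c' + j)))" using Suc by simp
    then show ?thesis using Cons Suc by (simp add: x)
  qed
qed simp

lemma lit_words_nth:
  "q < length ls \<Longrightarrow> concat (map lit_word ls) ! (2 * q) = of_bool (is_Pos (ls ! q)) \<and>
    concat (map lit_word ls) ! Suc (2 * q) = lit_var (ls ! q)"
proof (induction ls arbitrary: q)
  case (Cons l ls)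
  then show ?case by (cases q; cases l) auto
qed simp

lemma length_lit_words: "length (concat (map lit_word ls)) = 2 * length ls"
proof (induction ls)
  case (Cons l ls)
  then show ?case by (cases l) auto
qed simp

lemma clause_words: "concat (map clause_word cs) = concat (map lit_word (occurrences cs))"
proof (induction cs)
  case (Cons c cs)
  then show ?case by (cases c) auto
qed simp

text \<open>A formula with fewer than \<open>m0\<close> clauses is replaced by \<open>m0\<close> copies of itself with disjoint
  variables: occurrence \<open>q\<close> belongs to copy \<open>q div (3 * length cs)\<close>.\<close>

definition copy_var :: "nat \<Rightarrow> clause list \<Rightarrow> nat \<Rightarrow> nat" where
  "copy_var n cs q = lit_var (occurrences cs ! (q mod (3 * length cs))) + q div (3 * length cs) * n"

definition copy_sgn :: "clause list \<Rightarrow> nat \<Rightarrow> bool" where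
  "copy_sgn cs q = is_Pos (occurrences cs ! (q mod (3 * length cs)))"

text \<open>
  Arrays: 0 input, 1 variables, 2 signs, 3 representative occurrences, 4 homes, 5 sources,
  6 intermediate rows, 7 round robin counters, 8 slots used at each vertex, 9 halves, 10 and 11
  bits of the two labels of an edge, \<open>20 + \<tau>\<close> slots at stage \<open>\<tau>\<close>. Registers: 4 number of clauses,
  5 number of occurrences, 11 bits per label, 12 size of the alphabet, 15 number of violations,
  18 number of pairs written; the other ones below 21 are counters and temporaries. The output
  starts at register and array \<open>21 + 4 * r\<close>, which becomes number 0 of the relocated program.
\<close>

definition read_body :: prog where
  "read_body = seqs [
    SetArr 2 (Reg 5) (Read 0 (Reg 7)),
    SetArr 1 (Reg 5) (Plus (Read 0 (Plus (Reg 7) (Const 1))) (Reg 6)),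
    SetReg 7 (Plus (Reg 7) (Const 2)),
    SetReg 5 (Plus (Reg 5) (Const 1))]"

definition read_copy :: prog where
  "read_copy = seqs [
    SetReg 7 (Const 2),
    SetReg 4 (Plus (Reg 4) (Reg 2)),
    For 9 (times_exp 3 (Reg 2)) read_body,
    SetReg 6 (Plus (Reg 6) (Reg 1))]"

definition read_prog :: "nat \<Rightarrow> prog" where
  "read_prog m0 = seqs [
    SetReg 1 (Read 0 (Const 0)),
    SetReg 2 (Read 0 (Const 1)),
    prog.If (Less (Reg 2) (Const m0)) (SetReg 3 (Const m0)) (SetReg 3 (Const 1)),
    For 8 (Reg 3) read_copy]"

lemma runs_to_read_copy:
  fixes n :: nat and cs :: "clause list"
  defines "m \<equiv> length cs"
  assumes w: "w = [n, m] @ concat (map clause_word cs)"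
    and s: "\<And>i. i < length w \<Longrightarrow> snd s 0 i = w ! i" "fst s 1 = n" "fst s 2 = m"
      "fst s 4 = i * m" "fst s 5 = i * (3 * m)" "fst s 6 = i * n"
      "\<And>q. q < i * (3 * m) \<Longrightarrow> snd s 1 q = copy_var n cs q \<and> snd s 2 q = of_bool (copy_sgn cs q)"
  shows "runs_to read_copy s (3 * m * 7 + 10) (\<lambda>s'.
    fst s' 4 = Suc i * m \<and> fst s' 5 = Suc i * (3 * m) \<and> fst s' 6 = Suc i * n \<and>
    (\<forall>q < Suc i * (3 * m). snd s' 1 q = copy_var n cs q \<and> snd s' 2 q = of_bool (copy_sgn cs q)))"
proof -
  define I where "I j s' \<longleftrightarrow> fst s' 7 = 2 + 2 * j \<and> fst s' 5 = i * (3 * m) + j \<and>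
    (\<forall>q < i * (3 * m) + j. snd s' 1 q = copy_var n cs q \<and> snd s' 2 q = of_bool (copy_sgn cs q))"
    for j and s' :: store
  let ?s = "((fst s)(7 := 2, 4 := i * m + m), snd s)"
  have word: "w ! (2 + 2 * j) = of_bool (is_Pos (occurrences cs ! j))"
    "w ! Suc (2 + 2 * j) = lit_var (occurrences cs ! j)" "Suc (2 + 2 * j) < length w"
    if "j < 3 * m" for j
    using that lit_words_nth[of j "occurrences cs"] length_lit_words[of "occurrences cs"]
      length_occurrences[of cs] unfolding w clause_words m_def by (auto simp: nth_append)
  have loop: "runs_to (For 9 (times_exp 3 (Reg 2)) read_body) ?s (3 * m * (5 + 2) + 2) (I (3 * m))"
  proof (rule runs_to_For)
    show "I 0 ((fst ?s)(9 := 0), snd ?s)" using s by (simp add: I_def)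
    show "exp_val (times_exp 3 (Reg 2)) s' = 3 * m"
      if "framed (insert 9 (wregs read_body)) (warrs read_body) ?s s'" for s'
      using framed_reg[OF that, of 2] s(3) by (simp add: read_body_def)
    show "9 \<notin> wregs read_body" by (simp add: read_body_def)
    fix j s' assume j: "j < 3 * m" and I: "I j s'"
      and f: "framed (insert 9 (wregs read_body)) (warrs read_body) ?s s'"
    have fr: "fst s' 6 = i * n" "snd s' 0 = snd s 0"
      using framed_reg[OF f, of 6] framed_arr[OF f, of 0] s by (simp_all add: read_body_def)
    have r: "snd s' 0 (2 + 2 * j) = of_bool (is_Pos (occurrences cs ! j))"
      "snd s' 0 (Suc (2 + 2 * j)) = lit_var (occurrences cs ! j)"
      using word[OF j] s(1) fr by auto
    have d: "(i * (3 * m) + j) div (3 * m) = i"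
      using j by (metis add.right_neutral div_less div_mult_self3 gr_implies_not0)
    have c: "copy_var n cs (i * (3 * m) + j) = lit_var (occurrences cs ! j) + i * n"
      "copy_sgn cs (i * (3 * m) + j) = is_Pos (occurrences cs ! j)"
      using j d unfolding copy_var_def copy_sgn_def m_def by simp_all
    show "runs_to read_body s' 5 (\<lambda>s''. I (Suc j) ((fst s'')(9 := Suc j), snd s''))"
      unfolding read_body_def seqs.simps
      by (intro runs_to_intros) (use I r c fr in \<open>auto simp: I_def less_Suc_eq\<close>)
  qed
  show ?thesis
    unfolding read_copy_def seqs.simps
  proof (intro runs_to_SetReg_Seq, goal_cases)
    case 3
    show ?case
    proof (rule runs_to_Seq[where U = "3 * m * (5 + 2) + 2" and P = "I (3 * m)" and V = 3],
        goal_cases)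
      case 1
      show ?case using loop s by simp
    next
      case (2 s')
      then show ?case
        using framed_reg[OF 2(2), of 4] framed_reg[OF 2(2), of 6] framed_reg[OF 2(2), of 1] s
        by (intro runs_to_intros) (auto simp: I_def read_body_def algebra_simps)
    qed simp
  qed auto
qed

lemma runs_to_read_prog:
  fixes n m0 :: nat and cs :: "clause list"
  defines "m \<equiv> length cs"
  defines "M \<equiv> (if m < m0 then m0 * m else m)"
  assumes w: "w = [n, m] @ concat (map clause_word cs)"
  shows "runs_to (read_prog m0) (init_store w) ((m0 + 1) * (21 * m + 12) + 8) (\<lambda>s.
    fst s 4 = M \<and> fst s 5 = 3 * M \<and>
    (\<forall>q < 3 * M. snd s 1 q = copy_var n cs q \<and> snd s 2 q = of_bool (copy_sgn cs q)))"
proof -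
  define t where "t = (if m < m0 then m0 else 1)"
  define I where "I i s \<longleftrightarrow> fst s 4 = i * m \<and> fst s 5 = i * (3 * m) \<and> fst s 6 = i * n \<and>
    (\<forall>q < i * (3 * m). snd s 1 q = copy_var n cs q \<and> snd s 2 q = of_bool (copy_sgn cs q))"
    for i and s :: store
  define s0 where "s0 = ((fst (init_store w))(1 := n, 2 := m, 3 := t), snd (init_store w))"
  have "runs_to (For 8 (Reg 3) read_copy) s0 (t * (3 * m * 7 + 10 + 2) + 2) (I t)"
  proof (rule runs_to_For)
    show "I 0 ((fst s0)(8 := 0), snd s0)" by (simp add: I_def s0_def init_store_def)
    show "8 \<notin> wregs read_copy" by (simp add: read_copy_def read_body_def)
    fix s' assume f: "framed (insert 8 (wregs read_copy)) (warrs read_copy) s0 s'"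
    show "exp_val (Reg 3) s' = t"
      using framed_reg[OF f, of 3] by (simp add: read_copy_def read_body_def s0_def)
    fix i assume I: "I i s'"
    have "snd s' 0 = snd s0 0" "fst s' 1 = fst s0 1" "fst s' 2 = fst s0 2"
      using framed_arr[OF f, of 0] framed_reg[OF f, of 1] framed_reg[OF f, of 2]
      by (simp_all add: read_copy_def read_body_def)
    then have s': "\<And>i. i < length w \<Longrightarrow> snd s' 0 i = w ! i" "fst s' 1 = n" "fst s' 2 = m"
      by (simp_all add: s0_def init_store_def)
    have "runs_to read_copy s' (3 * length cs * 7 + 10) (\<lambda>s'.
      fst s' 4 = Suc i * length cs \<and> fst s' 5 = Suc i * (3 * length cs) \<and> fst s' 6 = Suc i * n \<and>
      (\<forall>q < Suc i * (3 * length cs).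
        snd s' 1 q = copy_var n cs q \<and> snd s' 2 q = of_bool (copy_sgn cs q)))"
      by (rule runs_to_read_copy) (use w s' I in \<open>auto simp: I_def m_def\<close>)
    then show "runs_to read_copy s' (3 * m * 7 + 10)
        (\<lambda>s''. I (Suc i) ((fst s'')(8 := Suc i), snd s''))"
      unfolding m_def by (rule runs_to_weaken) (auto simp: I_def m_def)
  qed
  then have "runs_to (For 8 (Reg 3) read_copy) s0 ((m0 + 1) * (21 * m + 12) + 2) (I t)"
  proof (rule runs_to_weaken)
    have "t * (21 * m + 12) \<le> (m0 + 1) * (21 * m + 12)"
      by (rule mult_right_mono) (auto simp: t_def)
    moreover have "3 * m * 7 + 10 + 2 = 21 * m + 12" by simp
    ultimately show "t * (3 * m * 7 + 10 + 2) + 2 \<le> (m0 + 1) * (21 * m + 12) + 2"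
      by (simp only: add_le_cancel_right)
  qed
  then have main: "runs_to (seqs [For 8 (Reg 3) read_copy]) s0 ((m0 + 1) * (21 * m + 12) + 3) (I t)"
    by (rule runs_to_single) simp
  have "t * m = M" by (simp add: t_def M_def)
  then have *: "t * (3 * m) = 3 * M" by (simp add: ac_simps)
  have w2: "length w \<ge> 2" "w ! 0 = n" "w ! 1 = m" using w by auto
  have "runs_to (read_prog m0) (init_store w) ((m0 + 1) * (21 * m + 12) + 8) (I t)"
    unfolding read_prog_def seqs.simps(2)[of "SetReg 1 _"] seqs.simps(2)[of "SetReg 2 _"]
      seqs.simps(2)[of "prog.If _ _ _"]
  proof (intro runs_to_SetReg_Seq, goal_cases)
    case 3
    show ?case
    proof (rule runs_to_Seq[where U = 2 and V = "(m0 + 1) * (21 * m + 12) + 3"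
          and P = "\<lambda>s. s = s0"], goal_cases)
      case 1
      have "s0 = ((fst (init_store w))(Suc 0 := n, 2 := m, 3 := t), snd (init_store w))"
        by (simp add: s0_def)
      then show ?case using w2
        by (intro runs_to_intros) (auto simp: init_store_def t_def)
    next
      case (2 s')
      then show ?case using main by simp
    qed simp
  qed auto
  then show ?thesis
    by (rule runs_to_weaken) (use \<open>t * m = M\<close> * in \<open>simp_all add: I_def\<close>)
qed

subsection \<open>Routing\<close>

text \<open>Division and remainder are replaced by counting: three occurrences receive the value of
  a cyclic counter, which a table then advances.\<close>

definition home_body :: "nat \<Rightarrow> prog" where
  "home_body r = seqs [
      SetArr 4 (Reg 9) (Reg 10),
      SetArr 4 (Plus (Reg 9) (Const 1)) (Reg 10),
      SetArr 4 (Plus (Reg 9) (Const 2)) (Reg 10),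
      SetReg 9 (Plus (Reg 9) (Const 3)),
      SetReg 10 (table_exp (\<lambda>x. Suc x mod 2 ^ r) (2 ^ r) (Reg 10))]"

definition home_prog :: "nat \<Rightarrow> prog" where
  "home_prog r = seqs [SetReg 9 (Const 0), SetReg 10 (Const 0), For 8 (Reg 4) (home_body r)]"

definition rep_prog :: prog where
  "rep_prog = For 8 (Reg 5) (SetArr 3 (Read 1 (Reg 8)) (Reg 8))"

text \<open>Array 7 has one counter per pair of terminals. The counters are kept modulo
  \<open>2 ^ r\<close>, so a table of constant size can advance them.\<close>

definition mid_body :: "nat \<Rightarrow> prog" where
  "mid_body r = seqs [
      SetArr 5 (Reg 8) (Read 4 (Read 3 (Read 1 (Reg 8)))),
      SetReg 9 (Plus (times_exp (2 ^ r) (Read 5 (Reg 8))) (Read 4 (Reg 8))),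
      SetArr 6 (Reg 8) (Read 7 (Reg 9)),
      SetArr 7 (Reg 9) (table_exp (\<lambda>x. Suc x mod 2 ^ r) (2 ^ r) (Read 7 (Reg 9)))]"

definition mid_prog :: "nat \<Rightarrow> prog" where
  "mid_prog r = For 8 (Reg 5) (mid_body r)"

text \<open>At a fixed stage a position depends on two rows only. Coded as one number below
  \<open>2 ^ r * 2 ^ r\<close>, they index a table of constant size.\<close>

definition pos_exp :: "nat \<Rightarrow> nat \<Rightarrow> exp \<Rightarrow> exp" where
  "pos_exp r \<tau> e = (let
      f = (\<lambda>l x. vertex r (\<tau> mod (4 * r)) (mix l (x div 2 ^ r) (x mod 2 ^ r)));
      pair = (\<lambda>a b. Plus (times_exp (2 ^ r) (Read a e)) (Read b e))
    in if \<tau> div 2 < r then table_exp (f (\<tau> div 2)) (2 ^ r * 2 ^ r) (pair 5 6)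
      else table_exp (f (\<tau> div 2 - r)) (2 ^ r * 2 ^ r) (pair 6 4))"

text \<open>With truncated subtraction \<open>x + (y - x)\<close> is a maximum; register 11 thus
  collects the largest number of packets at any vertex.\<close>

definition slot_body :: "nat \<Rightarrow> nat \<Rightarrow> prog" where
  "slot_body r \<tau> = For 8 (Reg 5) (seqs [
      SetReg 9 (pos_exp r \<tau> (Reg 8)),
      SetArr (20 + \<tau>) (Reg 8) (Read 8 (Reg 9)),
      SetArr 8 (Reg 9) (Plus (Read 8 (Reg 9)) (Const 1)),
      SetReg 11 (Plus (Reg 11) (Minus (Read 8 (Reg 9)) (Reg 11)))])"

text \<open>Stage 0 comes last because its slots are copied from stage \<open>4 * r\<close>.\<close>

definition slot_prog :: "nat \<Rightarrow> prog" where
  "slot_prog r = seqs [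
    seqs (map (\<lambda>t. slot_body r (Suc t)) [0..<4 * r]),
    For 8 (Reg 5) (SetArr 20 (Reg 8) (Read (20 + 4 * r) (Read 3 (Read 1 (Reg 8)))))]"

lemma runs_to_home_prog:
  assumes s: "fst s 4 = M"
  shows "runs_to (home_prog r) s (M * 8 + 5) (\<lambda>s'. \<forall>q<3 * M. snd s' 4 q = (q div 3) mod 2 ^ r)"
proof -
  define I where "I c s' \<longleftrightarrow> fst s' 9 = 3 * c \<and> fst s' 10 = c mod 2 ^ r \<and>
    (\<forall>q<3 * c. snd s' 4 q = (q div 3) mod 2 ^ r)" for c and s' :: store
  let ?s = "((fst s)(9 := 0, 10 := 0), snd s)"
  have "runs_to (For 8 (Reg 4) (home_body r)) ?s (M * (6 + 2) + 2) (I M)"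
  proof (rule runs_to_For)
    show "I 0 ((fst ?s)(8 := 0), snd ?s)" by (simp add: I_def)
    show "8 \<notin> wregs (home_body r)" by (simp add: home_body_def)
    fix s' assume f: "framed (insert 8 (wregs (home_body r))) (warrs (home_body r)) ?s s'"
    show "exp_val (Reg 4) s' = M" using framed_reg[OF f, of 4] s by (simp add: home_body_def)
    fix c assume I: "I c s'"
    have "q = 3 * c \<or> q = Suc (3 * c) \<or> q = Suc (Suc (3 * c))" if "q < 3 * Suc c" "\<not> q < 3 * c" for q
      using that by auto
    then have *: "snd s' 4 q = (q div 3) mod 2 ^ r"
      if "q < 3 * Suc c" "q \<noteq> 3 * c" "q \<noteq> Suc (3 * c)" "q \<noteq> Suc (Suc (3 * c))" for q
      using that I unfolding I_def by blast
    have d: "Suc (3 * c) div 3 = c" "Suc (Suc (3 * c)) div 3 = c" by simp_all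
    show "runs_to (home_body r) s' 6 (\<lambda>s''. I (Suc c) ((fst s'')(8 := Suc c), snd s''))"
      unfolding home_body_def seqs.simps by (intro runs_to_intros) (use I * d in \<open>auto simp: I_def mod_Suc_eq\<close>)
  qed
  then have "runs_to (seqs [For 8 (Reg 4) (home_body r)]) ?s (M * 8 + 3) (I M)"
    by (rule runs_to_single) simp
  then have "runs_to (home_prog r) s (M * 8 + 5) (I M)"
    unfolding home_prog_def seqs.simps(2)[of "SetReg 9 _"] seqs.simps(2)[of "SetReg 10 _"]
    by (intro runs_to_SetReg_Seq) (simp_all add: add.commute)
  then show ?thesis by (rule runs_to_weaken) (auto simp: I_def)
qed

text \<open>Each occurrence overwrites the entry of its variable, so the last one wins; only what
  \<open>routing\<close> demands of \<open>F\<close> is recorded.\<close>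

lemma runs_to_rep_prog:
  assumes s: "fst s 5 = n" "\<And>q. q < n \<Longrightarrow> snd s 1 q = var q"
  shows "runs_to rep_prog s (n * 3 + 2)
    (\<lambda>s'. \<forall>q<n. snd s' 3 (var q) < n \<and> var (snd s' 3 (var q)) = var q)"
proof -
  define I where "I i s' \<longleftrightarrow> (\<forall>q<i. snd s' 3 (var q) < i \<and> var (snd s' 3 (var q)) = var q)"
    for i and s' :: store
  have "runs_to rep_prog s (n * (1 + 2) + 2) (I n)"
    unfolding rep_prog_def
  proof (rule runs_to_For)
    let ?body = "SetArr 3 (Read 1 (Reg 8)) (Reg 8)"
    show "I 0 ((fst s)(8 := 0), snd s)" by (simp add: I_def)
    show "8 \<notin> wregs ?body" by simp
    fix s' assume f: "framed (insert 8 (wregs ?body)) (warrs ?body) s s'"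
    show "exp_val (Reg 5) s' = n" using framed_reg[OF f, of 5] s by simp
    fix i assume i: "i < n" and I: "I i s'" "fst s' 8 = i"
    have "snd s' 1 i = var i" using framed_arr[OF f, of 1] s(2)[OF i] by simp
    then show "runs_to ?body s' 1 (\<lambda>s''. I (Suc i) ((fst s'')(8 := Suc i), snd s''))"
      by (intro runs_to_intros) (use I in \<open>auto simp: I_def less_Suc_eq\<close>)
  qed
  then show ?thesis by (rule runs_to_weaken) (auto simp: I_def)
qed

context routing
begin

lemma exp_val_pos_exp:
  assumes "snd s 4 (exp_val e s) = home q" "snd s 5 (exp_val e s) = src q"
    "snd s 6 (exp_val e s) = mid q"
  shows "exp_val (pos_exp r \<tau> e) s = pos \<tau> q"
proof -
  have "2 ^ r * x + y < 2 ^ r * 2 ^ r" if "x < 2 ^ r" "y < 2 ^ r" for x y :: nat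
    using vertex_less[OF that(2,1)] by (simp add: vertex_def ac_simps)
  then show ?thesis using assms src_less[of q] mid_less[of q] home_less[of q]
    by (simp add: pos_exp_def pos_def row_def)
qed

lemma runs_to_mid_prog:
  assumes s: "fst s 5 = 3 * M" "\<And>q. q < 3 * M \<Longrightarrow> snd s 1 q = var q"
    "\<And>q. q < 3 * M \<Longrightarrow> snd s 3 (var q) = F (var q)"
    "\<And>q. q < 3 * M \<Longrightarrow> snd s 4 q = home q"
    "\<And>i. snd s 7 i = 0"
  shows "runs_to (mid_prog r) s (3 * M * 7 + 2)
    (\<lambda>s'. \<forall>q<3 * M. snd s' 5 q = src q \<and> snd s' 6 q = mid q)"
proof -
  let ?f = "\<lambda>q. (src q, home q)"
  define I where "I i s' \<longleftrightarrow> (\<forall>q<i. snd s' 5 q = src q \<and> snd s' 6 q = mid q) \<and>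
    (\<forall>x<2 ^ r. \<forall>y<2 ^ r. snd s' 7 (2 ^ r * x + y) = card {q. q < i \<and> ?f q = (x, y)} mod 2 ^ r)"
    for i and s' :: store
  have "runs_to (mid_prog r) s (3 * M * (5 + 2) + 2) (I (3 * M))"
    unfolding mid_prog_def
  proof (rule runs_to_For)
    show "I 0 ((fst s)(8 := 0), snd s)" using s(5) by (simp add: I_def)
    show "8 \<notin> wregs (mid_body r)" by (simp add: mid_body_def)
    fix s' assume f: "framed (insert 8 (wregs (mid_body r))) (warrs (mid_body r)) s s'"
    show "exp_val (Reg 5) s' = 3 * M" using framed_reg[OF f, of 5] s by (simp add: mid_body_def)
    fix i assume i: "i < 3 * M" and I: "I i s'" "fst s' 8 = i"
    have a: "snd s' 1 i = var i" "snd s' 3 (var i) = F (var i)" "snd s' 4 i = home i"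
      "snd s' 4 (F (var i)) = src i"
      using framed_arr[OF f, of 1] framed_arr[OF f, of 3] framed_arr[OF f, of 4]
        s(2)[OF i] s(3)[OF i] s(4)[OF i] s(4)[OF F_less[OF i]] by (simp_all add: mid_body_def src_def)
    have m: "snd s' 7 (2 ^ r * src i + home i) = mid i"
      using I(1) src_less home_less unfolding I_def mid_def rank_def by simp
    have inj: "2 ^ r * x + y = 2 ^ r * src i + home i \<longleftrightarrow> x = src i \<and> y = home i"
      if "y < 2 ^ r" for x y
      using vertex_inj[OF that home_less[of i], of x "src i"] by (simp add: vertex_def ac_simps)
    have c: "card {q. q < Suc i \<and> src q = x \<and> home q = y} =
        card {q. q < i \<and> src q = x \<and> home q = y} + of_bool (x = src i \<and> y = home i)" for x y
    proof (cases "x = src i \<and> y = home i")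
      case True
      then have "{q. q < Suc i \<and> src q = x \<and> home q = y} =
          insert i {q. q < i \<and> src q = x \<and> home q = y}" by (auto simp: less_Suc_eq)
      then show ?thesis using True by simp
    next
      case False
      then have "{q. q < Suc i \<and> src q = x \<and> home q = y} = {q. q < i \<and> src q = x \<and> home q = y}"
        by (auto simp: less_Suc_eq)
      then show ?thesis using False by simp
    qed
    have mc: "mid i = card {q. q < i \<and> src q = src i \<and> home q = home i} mod 2 ^ r"
      by (simp add: mid_def rank_def)
    have "I (Suc i) ((fst s')(9 := v, 8 := Suc i), (snd s')(5 := (snd s' 5)(i := src i),
        6 := (snd s' 6)(i := mid i),
        7 := (snd s' 7)(2 ^ r * src i + home i := Suc (mid i) mod 2 ^ r)))" for v
      using I(1) unfolding I_def
      by (auto simp: less_Suc_eq inj c[unfolded less_Suc_eq] mc mod_Suc_eq)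
    then show "runs_to (mid_body r) s' 5 (\<lambda>s''. I (Suc i) ((fst s'')(8 := Suc i), snd s''))"
      unfolding mid_body_def seqs.simps
      by (intro runs_to_intros) (use I(2) a m mid_less[of i] in simp_all)
  qed
  then show ?thesis by (rule runs_to_weaken) (auto simp: I_def)
qed

text \<open>The last conjunct lets all stages share array 8 without clearing it, since different
  stages count at different vertices. \<open>\<Lambda>\<close> is a bound known only to the
  analysis, not to the program.\<close>

lemma runs_to_slot_body:
  assumes s: "fst s 5 = 3 * M" "\<And>q. q < 3 * M \<Longrightarrow> snd s 4 q = home q"
    "\<And>q. q < 3 * M \<Longrightarrow> snd s 5 q = src q" "\<And>q. q < 3 * M \<Longrightarrow> snd s 6 q = mid q"
    "\<And>q. q < 3 * M \<Longrightarrow> snd s 8 (pos \<tau> q) = 0" "fst s 11 \<le> \<Lambda>"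
    and \<Lambda>: "\<And>q. q < 3 * M \<Longrightarrow> rank (pos \<tau>) q < \<Lambda>"
  shows "runs_to (slot_body r \<tau>) s (3 * M * 7 + 2) (\<lambda>s'.
    (\<forall>q<3 * M. snd s' (20 + \<tau>) q = rank (pos \<tau>) q \<and> rank (pos \<tau>) q < fst s' 11) \<and>
    fst s 11 \<le> fst s' 11 \<and> fst s' 11 \<le> \<Lambda> \<and>
    (\<forall>u. (\<forall>q. pos \<tau> q \<noteq> u) \<longrightarrow> snd s' 8 u = snd s 8 u))"
proof -
  define I where "I i s' \<longleftrightarrow>
    (\<forall>q<i. snd s' (20 + \<tau>) q = rank (pos \<tau>) q \<and> rank (pos \<tau>) q < fst s' 11) \<and>
    (\<forall>q<3 * M. snd s' 8 (pos \<tau> q) = card {q'. q' < i \<and> pos \<tau> q' = pos \<tau> q}) \<and>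
    fst s 11 \<le> fst s' 11 \<and> fst s' 11 \<le> \<Lambda> \<and>
    (\<forall>u. (\<forall>q. pos \<tau> q \<noteq> u) \<longrightarrow> snd s' 8 u = snd s 8 u)" for i and s' :: store
  have "runs_to (slot_body r \<tau>) s (3 * M * (5 + 2) + 2) (I (3 * M))"
    unfolding slot_body_def
  proof (rule runs_to_For)
    let ?body = "seqs [
      SetReg 9 (pos_exp r \<tau> (Reg 8)),
      SetArr (20 + \<tau>) (Reg 8) (Read 8 (Reg 9)),
      SetArr 8 (Reg 9) (Plus (Read 8 (Reg 9)) (Const 1)),
      SetReg 11 (Plus (Reg 11) (Minus (Read 8 (Reg 9)) (Reg 11)))]"
    show "I 0 ((fst s)(8 := 0), snd s)" using s by (simp add: I_def)
    show "8 \<notin> wregs ?body" by simp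
    fix s' assume f: "framed (insert 8 (wregs ?body)) (warrs ?body) s s'"
    show "exp_val (Reg 5) s' = 3 * M" using framed_reg[OF f, of 5] s by simp
    fix i assume i: "i < 3 * M" and I: "I i s'" "fst s' 8 = i"
    have "exp_val (pos_exp r \<tau> (Reg 8)) s' = pos \<tau> i"
      by (rule exp_val_pos_exp) (use framed_arr[OF f, of 4] framed_arr[OF f, of 5]
        framed_arr[OF f, of 6] I(2) s(2,3,4)[OF i] in simp_all)
    moreover have rk: "snd s' 8 (pos \<tau> i) = rank (pos \<tau>) i"
      using I(1) i unfolding I_def rank_def by simp
    moreover have c: "card {q'. q' < Suc i \<and> pos \<tau> q' = u} =
        card {q'. q' < i \<and> pos \<tau> q' = u} + of_bool (pos \<tau> i = u)" for u
    proof (cases "pos \<tau> i = u")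
      case True
      then have "{q'. q' < Suc i \<and> pos \<tau> q' = u} = insert i {q'. q' < i \<and> pos \<tau> q' = u}"
        by (auto simp: less_Suc_eq)
      then show ?thesis using True by simp
    next
      case False
      then have "{q'. q' < Suc i \<and> pos \<tau> q' = u} = {q'. q' < i \<and> pos \<tau> q' = u}"
        by (auto simp: less_Suc_eq)
      then show ?thesis using False by simp
    qed
    moreover have "I (Suc i) ((fst s')(9 := v,
        11 := fst s' 11 + (Suc (rank (pos \<tau>) i) - fst s' 11), 8 := Suc i),
        (snd s')(20 + \<tau> := (snd s' (20 + \<tau>))(i := rank (pos \<tau>) i),
          8 := (snd s' 8)(pos \<tau> i := Suc (rank (pos \<tau>) i))))" for v
    proof -
      have "fst s' 11 + (Suc (rank (pos \<tau>) i) - fst s' 11) \<le> \<Lambda>"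
        "fst s 11 \<le> fst s' 11 + (Suc (rank (pos \<tau>) i) - fst s' 11)"
        using I(1) \<Lambda>[OF i] unfolding I_def by auto
      moreover have "rank (pos \<tau>) q < fst s' 11 + (Suc (rank (pos \<tau>) i) - fst s' 11)"
        if "q < Suc i" for q
        using I(1) that unfolding I_def by (cases "q = i") (auto simp: less_Suc_eq)
      moreover have "Suc (rank (pos \<tau>) i) = card {q'. q' < Suc i \<and> pos \<tau> q' = pos \<tau> i}"
        unfolding c by (simp add: rank_def)
      ultimately show ?thesis using I(1) i unfolding I_def
        by (auto simp: c)
    qed
    ultimately show "runs_to ?body s' 5 (\<lambda>s''. I (Suc i) ((fst s'')(8 := Suc i), snd s''))"
      unfolding seqs.simps
      by (intro runs_to_intros) (use I(2) in simp_all)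
  qed
  then show ?thesis by (rule runs_to_weaken) (auto simp: I_def)
qed

lemma runs_to_slot_prog:
  assumes s: "fst s 5 = 3 * M" "\<And>q. q < 3 * M \<Longrightarrow> snd s 1 q = var q"
    "\<And>q. q < 3 * M \<Longrightarrow> snd s 3 (var q) = F (var q)"
    "\<And>q. q < 3 * M \<Longrightarrow> snd s 4 q = home q"
    "\<And>q. q < 3 * M \<Longrightarrow> snd s 5 q = src q" "\<And>q. q < 3 * M \<Longrightarrow> snd s 6 q = mid q"
    "\<And>u. snd s 8 u = 0" "fst s 11 = 0"
    and \<Lambda>: "\<And>\<tau> q. q < 3 * M \<Longrightarrow> rank (pos \<tau>) q < \<Lambda>"
  shows "runs_to (slot_prog r) s (4 * r * (3 * M * 7 + 2) + 3 * M * 3 + 4) (\<lambda>s'.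
    (\<forall>\<tau>\<le>4 * r. \<forall>q<3 * M. snd s' (20 + \<tau>) q = slot \<tau> q) \<and> fst s' 11 \<le> \<Lambda> \<and>
    (\<forall>\<tau>\<in>{1..4 * r}. \<forall>q<3 * M. rank (pos \<tau>) q < fst s' 11))"
    (is "runs_to _ _ _ ?Q")
proof -
  define I where "I t s' \<longleftrightarrow> (\<forall>\<tau>\<in>{1..t}. \<forall>q<3 * M.
      snd s' (20 + \<tau>) q = rank (pos \<tau>) q \<and> rank (pos \<tau>) q < fst s' 11) \<and> fst s' 11 \<le> \<Lambda> \<and>
    (\<forall>\<tau>\<in>{Suc t..4 * r}. \<forall>q. snd s' 8 (pos \<tau> q) = 0)" for t and s' :: store
  let ?f = "\<lambda>t. slot_body r (Suc t)"
  have 1: "runs_to (seqs (map ?f [0..<4 * r])) s (4 * r * (3 * M * 7 + 2) + 1) (I (4 * r))"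
  proof (rule runs_to_seqs)
    show "I 0 s" using s by (simp add: I_def)
    fix t s' assume t: "t < 4 * r" and I: "I t s'"
      and f: "framed (\<Union>j<4 * r. wregs (?f j)) (\<Union>j<4 * r. warrs (?f j)) s s'"
    have fr: "fst s' 5 = fst s 5" "snd s' 4 = snd s 4" "snd s' 5 = snd s 5" "snd s' 6 = snd s 6"
      using framed_reg[OF f, of 5] framed_arr[OF f, of 4] framed_arr[OF f, of 5]
        framed_arr[OF f, of 6] by (simp_all add: slot_body_def)
    have "runs_to (?f t) s' (3 * M * 7 + 2) (\<lambda>s''.
        (\<forall>q<3 * M. snd s'' (20 + Suc t) q = rank (pos (Suc t)) q \<and>
          rank (pos (Suc t)) q < fst s'' 11) \<and>
        fst s' 11 \<le> fst s'' 11 \<and> fst s'' 11 \<le> \<Lambda> \<and>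
        (\<forall>u. (\<forall>q. pos (Suc t) q \<noteq> u) \<longrightarrow> snd s'' 8 u = snd s' 8 u))"
      (is "runs_to _ _ _ ?P")
      by (rule runs_to_slot_body) (use I s fr \<Lambda> t in \<open>auto simp: I_def\<close>)
    then show "runs_to (?f t) s' (3 * M * 7 + 2) (I (Suc t))"
    proof (rule runs_to_weaken)
      fix s'' assume Q: "?P s''"
        and f': "framed (wregs (?f t)) (warrs (?f t)) s' s''"
      have *: "snd s'' (20 + \<tau>) = snd s' (20 + \<tau>)" if "\<tau> \<le> t" for \<tau>
        using framed_arr[OF f', of "20 + \<tau>"] that by (simp add: slot_body_def)
      have 1: "snd s'' (20 + \<tau>) q = rank (pos \<tau>) q \<and> rank (pos \<tau>) q < fst s'' 11"
        if "\<tau> \<in> {1..Suc t}" "q < 3 * M" for \<tau> q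
      proof (cases "\<tau> = Suc t")
        case False
        then have "snd s' (20 + \<tau>) q = rank (pos \<tau>) q" "rank (pos \<tau>) q < fst s' 11"
          using that I unfolding I_def by auto
        then show ?thesis using * [of \<tau>] that False Q by auto
      qed (use that Q in simp)
      have 2: "snd s'' 8 (pos \<tau> q) = 0" if "\<tau> \<in> {Suc (Suc t)..4 * r}" for \<tau> q
      proof -
        have "\<forall>q'. pos (Suc t) q' \<noteq> pos \<tau> q" using pos_stage[of "Suc t" _ \<tau> q] that t by auto
        then show ?thesis using Q I that unfolding I_def by simp
      qed
      show "I (Suc t) s''" unfolding I_def using 1 2 Q by blast
    qed simp
  qed
  have 2: "runs_to (For 8 (Reg 5) (SetArr 20 (Reg 8) (Read (20 + 4 * r) (Read 3 (Read 1 (Reg 8)))))) s'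
    (3 * M * (1 + 2) + 2) (\<lambda>s''. \<forall>q<3 * M. snd s'' 20 q = slot 0 q)"
    (is "runs_to (For 8 _ ?body) _ _ _")
    if I: "I (4 * r) s'" and f: "framed (wregs (seqs (map ?f [0..<4 * r])))
      (warrs (seqs (map ?f [0..<4 * r]))) s s'" for s'
  proof (rule runs_to_For)
    show "\<forall>q<0. snd ((fst s')(8 := 0), snd s') 20 q = slot 0 q" by simp
    show "8 \<notin> wregs ?body" by simp
    fix s'' assume f': "framed (insert 8 (wregs ?body)) (warrs ?body) s' s''"
    show "exp_val (Reg 5) s'' = 3 * M"
      using framed_reg[OF f', of 5] framed_reg[OF f, of 5] s by (simp add: slot_body_def)
    fix i assume i: "i < 3 * M" "\<forall>q<i. snd s'' 20 q = slot 0 q" "fst s'' 8 = i"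
    have "snd s'' 1 i = var i" "snd s'' 3 (var i) = F (var i)"
      using framed_arr[OF f', of 1] framed_arr[OF f, of 1] framed_arr[OF f', of 3]
        framed_arr[OF f, of 3] s i by (simp_all add: slot_body_def)
    moreover have "snd s'' (20 + 4 * r) (F (var i)) = rank (pos (4 * r)) (F (var i))"
      using framed_arr[OF f', of "20 + 4 * r"] I F_less[OF i(1)] r by (simp add: I_def)
    ultimately show "runs_to ?body s'' 1
        (\<lambda>s''. \<forall>q<Suc i. snd ((fst s'')(8 := Suc i), snd s'') 20 q = slot 0 q)"
      by (intro runs_to_intros) (use i in \<open>auto simp: less_Suc_eq slot_def\<close>)
  qed
  show ?thesis unfolding slot_prog_def
  proof (rule runs_to_Cons[OF 1])
    fix s' assume I: "I (4 * r) s'" and f: "framed (wregs (seqs (map ?f [0..<4 * r])))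
      (warrs (seqs (map ?f [0..<4 * r]))) s s'"
    let ?p = "For 8 (Reg 5) (SetArr 20 (Reg 8) (Read (20 + 4 * r) (Read 3 (Read 1 (Reg 8)))))"
    have "runs_to ?p s' (3 * M * 3 + 2) ?Q"
    proof (rule runs_to_weaken[OF 2[OF I f]])
      fix s'' assume 0: "\<forall>q<3 * M. snd s'' 20 q = slot 0 q"
        and f': "framed (wregs ?p) (warrs ?p) s' s''"
      have "snd s'' (20 + \<tau>) = snd s' (20 + \<tau>)" if "\<tau> \<noteq> 0" for \<tau>
        using framed_arr[OF f', of "20 + \<tau>"] that by simp
      then have "snd s'' (20 + \<tau>) q = slot \<tau> q" if "\<tau> \<le> 4 * r" "q < 3 * M" for \<tau> q
        using that I 0 unfolding I_def slot_def by (cases "\<tau> = 0") auto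
      moreover have "fst s'' 11 = fst s' 11" using framed_reg[OF f', of 11] by simp
      ultimately show "?Q s''"
        using I unfolding I_def by simp
    qed simp
    then show "runs_to (seqs [?p]) s' (3 * M * 3 + 3) ?Q"
      by (rule runs_to_single) simp
  qed simp
qed

end

subsection \<open>Writing the instance\<close>

definition power_prog :: prog where
  "power_prog = seqs [SetReg 12 (Const 1), For 8 (Reg 11) (SetReg 12 (Plus (Reg 12) (Reg 12)))]"

text \<open>Halving is tabulated, as the machine cannot divide; repeated halving then yields the
  bits of a label.\<close>

definition half_prog :: prog where
  "half_prog = For 8 (Reg 12) (seqs [
    SetArr 9 (Plus (Reg 8) (Reg 8)) (Reg 8),
    SetArr 9 (Plus (Plus (Reg 8) (Reg 8)) (Const 1)) (Reg 8)])"

lemma runs_to_power_prog: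
  assumes "fst s 11 = B"
  shows "runs_to power_prog s (B * 3 + 4) (\<lambda>s'. fst s' 12 = 2 ^ B)"
  unfolding power_prog_def seqs.simps(2)[of "SetReg _ _"]
proof (rule runs_to_SetReg_Seq, simp, rule runs_to_single)
  let ?s = "((fst s)(12 := exp_val (Const 1) s), snd s)"
  show "runs_to (For 8 (Reg 11) (SetReg 12 (Plus (Reg 12) (Reg 12)))) ?s (B * (1 + 2) + 2)
    (\<lambda>s'. fst s' 12 = 2 ^ B)" (is "runs_to (For 8 _ ?p) _ _ _")
  proof (rule runs_to_For)
    fix i s' assume f: "framed (insert 8 (wregs ?p)) (warrs ?p) ?s s'"
    show "exp_val (Reg 11) s' = B" using framed_reg[OF f, of 11] assms by simp
    assume "fst s' 12 = 2 ^ i"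
    then show "runs_to ?p s' 1 (\<lambda>s''. fst ((fst s'')(8 := Suc i), snd s'') 12 = 2 ^ Suc i)"
      by (intro runs_to_intros) simp_all
  qed simp_all
qed simp

lemma runs_to_half_prog:
  assumes "fst s 12 = n"
  shows "runs_to half_prog s (n * 5 + 2) (\<lambda>s'. \<forall>x<2 * n. snd s' 9 x = x div 2)"
proof -
  have "runs_to half_prog s (n * (3 + 2) + 2) (\<lambda>s'. \<forall>x<2 * n. snd s' 9 x = x div 2)"
    unfolding half_prog_def
  proof (rule runs_to_For)
    let ?p = "seqs [SetArr 9 (Plus (Reg 8) (Reg 8)) (Reg 8),
      SetArr 9 (Plus (Plus (Reg 8) (Reg 8)) (Const 1)) (Reg 8)]"
    fix i s' assume f: "framed (insert 8 (wregs ?p)) (warrs ?p) s s'"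
    show "exp_val (Reg 12) s' = n" using framed_reg[OF f, of 12] assms by simp
    assume I: "\<forall>x<2 * i. snd s' 9 x = x div 2" "fst s' 8 = i"
    have "x = i + i \<or> x = Suc (i + i)" if "x < 2 * Suc i" "\<not> x < 2 * i" for x using that by auto
    then have "snd s' 9 x = x div 2" if "x < 2 * Suc i" "x \<noteq> i + i" "x \<noteq> Suc (i + i)" for x
      using that I by blast
    moreover have "Suc (i + i) div 2 = i" by simp
    ultimately show "runs_to ?p s' 3
        (\<lambda>s''. \<forall>x<2 * Suc i. snd ((fst s'')(8 := Suc i), snd s'') 9 x = x div 2)"
      unfolding seqs.simps by (intro runs_to_intros) (use I in auto)
  qed simp_all
  then show ?thesis by simp
qed

definition decode_prog :: "nat \<Rightarrow> nat \<Rightarrow> prog" where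
  "decode_prog x a = seqs [SetReg 13 (Reg x),
    For 14 (Reg 11) (seqs [
      SetArr a (Reg 14) (Minus (Reg 13) (times_exp 2 (Read 9 (Reg 13)))),
      SetReg 13 (Read 9 (Reg 13))])]"

lemma runs_to_decode_prog:
  assumes s: "fst s 11 = B" "\<And>y. y < 2 ^ B \<Longrightarrow> snd s 9 y = y div 2" "fst s x = v" "v < 2 ^ B"
    and a: "a \<noteq> 9"
  shows "runs_to (decode_prog x a) s (B * 5 + 4) (\<lambda>s'. \<forall>i<B. snd s' a i = of_bool (bit v i))"
  unfolding decode_prog_def seqs.simps(2)[of "SetReg 13 _"]
proof (rule runs_to_SetReg_Seq, simp, rule runs_to_single)
  let ?s = "((fst s)(13 := exp_val (Reg x) s), snd s)"
  let ?p = "seqs [SetArr a (Reg 14) (Minus (Reg 13) (times_exp 2 (Read 9 (Reg 13)))),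
      SetReg 13 (Read 9 (Reg 13))]"
  define I where "I i s' \<longleftrightarrow> fst s' 13 = v div 2 ^ i \<and> (\<forall>j<i. snd s' a j = of_bool (bit v j))"
    for i and s' :: store
  have "runs_to (For 14 (Reg 11) ?p) ?s (B * (3 + 2) + 2) (I B)"
  proof (rule runs_to_For)
    show "I 0 ((fst ?s)(14 := 0), snd ?s)" using s by (simp add: I_def)
    fix i s' assume f: "framed (insert 14 (wregs ?p)) (warrs ?p) ?s s'"
    show "exp_val (Reg 11) s' = B" using framed_reg[OF f, of 11] s by simp
    assume I: "I i s'" "fst s' 14 = i"
    have "v div 2 ^ i \<le> v" by (rule div_le_dividend)
    then have "v div 2 ^ i < 2 ^ B" using s(4) by (rule le_less_trans)
    then have "snd s' 9 (v div 2 ^ i) = v div 2 ^ i div 2"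
      using framed_arr[OF f, of 9] a s(2) by simp
    moreover have "v div 2 ^ i - 2 * (v div 2 ^ i div 2) = of_bool (bit v i)"
      by (simp add: minus_mult_div_eq_mod bit_iff_odd mod_2_eq_odd)
    ultimately show "runs_to ?p s' 3 (\<lambda>s''. I (Suc i) ((fst s'')(14 := Suc i), snd s''))"
      unfolding seqs.simps
      by (intro runs_to_intros)
         (use I a in \<open>auto simp: I_def less_Suc_eq div_mult2_eq[symmetric] mult.commute\<close>)
  qed simp
  then show "runs_to (For 14 (Reg 11) ?p) ?s (B * 5 + 2) (\<lambda>s'. \<forall>i<B. snd s' a i = of_bool (bit v i))"
    by (rule runs_to_weaken) (auto simp: I_def)
qed simp

text \<open>Counts violations, one summand per direction of travel, so that all tests of a pair of
  labels can be added up and compared with 0 once.\<close>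

definition link_exp :: "nat \<Rightarrow> nat \<Rightarrow> nat \<Rightarrow> nat \<Rightarrow> exp" where
  "link_exp r u v \<tau> = (let
      p = pos_exp r \<tau> (Reg 14); p' = pos_exp r (Suc \<tau>) (Reg 14);
      i = Read (20 + \<tau>) (Reg 14); i' = Read (20 + Suc \<tau>) (Reg 14)
    in Plus
      (and_exp (and_exp (eq_exp p (Const u)) (eq_exp p' (Const v)))
        (not_exp (eq_exp (Read 10 i) (Read 11 i'))))
      (and_exp (and_exp (eq_exp p (Const v)) (eq_exp p' (Const u)))
        (not_exp (eq_exp (Read 11 i) (Read 10 i')))))"

definition clause_exp :: "nat \<Rightarrow> nat \<Rightarrow> exp" where
  "clause_exp r u = (let
      unsat = (\<lambda>j. not_exp (eq_exp (Read 10 (Read (20 + 4 * r) (Plus (Reg 16) (Const j))))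
        (Read 2 (Plus (Reg 16) (Const j)))))
    in and_exp (eq_exp (Read 4 (Reg 16)) (Const u)) (and_exp (unsat 0) (and_exp (unsat 1) (unsat 2))))"

definition check_prog :: "nat \<Rightarrow> nat \<Rightarrow> nat \<Rightarrow> prog" where
  "check_prog r u v = seqs [
    SetReg 15 (Const 0),
    For 14 (Reg 5) (SetReg 15 (Plus (Reg 15) (sum_exp (map (link_exp r u v) [0..<4 * r])))),
    SetReg 16 (Const 0),
    For 14 (Reg 4) (seqs [
      SetReg 15 (Plus (Reg 15) (clause_exp r u)),
      SetReg 16 (Plus (Reg 16) (Const 3))])]"

context routing
begin

text \<open>Everything that the output phase reads but never writes.\<close>

definition ready :: "nat \<Rightarrow> store \<Rightarrow> bool" where
  "ready B s \<longleftrightarrow> fst s 4 = M \<and> fst s 5 = 3 * M \<and> fst s 11 = B \<and> fst s 12 = 2 ^ B \<and>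
    (\<forall>q<3 * M. snd s 2 q = of_bool (sgn q) \<and> snd s 4 q = home q \<and> snd s 5 q = src q \<and>
      snd s 6 q = mid q) \<and>
    (\<forall>\<tau>\<le>4 * r. \<forall>q<3 * M. snd s (20 + \<tau>) q = slot \<tau> q) \<and>
    (\<forall>y<2 ^ B. snd s 9 y = y div 2)"

lemma ready_framed:
  assumes f: "framed W A s s'" and s: "ready B s"
    and W: "W \<inter> {4, 5, 11, 12} = {}" and A: "A \<inter> ({2, 4, 5, 6, 9} \<union> {20..20 + 4 * r}) = {}"
  shows "ready B s'"
proof -
  have "fst s' x = fst s x" if "x \<in> {4, 5, 11, 12}" for x using framed_reg[OF f] W that by blast
  moreover have "snd s' x = snd s x" if "x \<in> {2, 4, 5, 6, 9}" for x
    using framed_arr[OF f] A that by blast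
  moreover have "snd s' (20 + \<tau>) = snd s (20 + \<tau>)" if "\<tau> \<le> 4 * r" for \<tau>
  proof -
    have "20 + \<tau> \<in> {20..20 + 4 * r}" using that by simp
    then show ?thesis using framed_arr[OF f] A by blast
  qed
  ultimately show ?thesis using s unfolding ready_def by simp
qed

lemma exp_val_link_exp:
  assumes s: "ready B s" "fst s 14 = q" "q < 3 * M" "\<tau> < 4 * r"
    and B: "\<And>\<tau> q. \<tau> \<le> 4 * r \<Longrightarrow> q < 3 * M \<Longrightarrow> slot \<tau> q < B"
    and ab: "\<And>i. i < B \<Longrightarrow> snd s 10 i = of_bool (bit a i)" "\<And>i. i < B \<Longrightarrow> snd s 11 i = of_bool (bit b i)"
  shows "exp_val (link_exp r u v \<tau>) s = 0 \<longleftrightarrow> link_ok u v a b \<tau> q"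
proof -
  have p: "exp_val (pos_exp r t (Reg 14)) s = pos t q" for t
    by (rule exp_val_pos_exp) (use s in \<open>simp_all add: ready_def\<close>)
  have sl: "snd s (20 + t) q = slot t q" "slot t q < B" if "t \<le> 4 * r" for t
    using s B that by (simp_all add: ready_def)
  show ?thesis
    using sl[of \<tau>] sl[of "Suc \<tau>"] s(4)
    by (auto simp: link_exp_def Let_def link_ok_def and_exp_def not_exp_def p s(2) ab)
qed

lemma exp_val_clause_exp:
  assumes s: "ready B s" "fst s 16 = 3 * c" "c < M"
    and B: "\<And>\<tau> q. \<tau> \<le> 4 * r \<Longrightarrow> q < 3 * M \<Longrightarrow> slot \<tau> q < B"
    and a: "\<And>i. i < B \<Longrightarrow> snd s 10 i = of_bool (bit a i)"
  shows "exp_val (clause_exp r u) s = 0 \<longleftrightarrow> clause_ok u a c"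
proof -
  have sl: "snd s (20 + 4 * r) (3 * c + j) = slot (4 * r) (3 * c + j)" "slot (4 * r) (3 * c + j) < B"
    "snd s 2 (3 * c + j) = of_bool (sgn (3 * c + j))" "snd s 4 (3 * c + j) = home (3 * c + j)"
    if "j < 3" for j
    using s B[of "4 * r" "3 * c + j"] that by (simp_all add: ready_def)
  have ex: "(\<exists>j<3. P j) \<longleftrightarrow> P 0 \<or> P 1 \<or> P 2" for P :: "nat \<Rightarrow> bool"
    by (auto simp: numeral_3_eq_3 less_Suc_eq numeral_2_eq_2)
  show ?thesis
    unfolding clause_ok_def ex
    using sl[of 0] sl[of 1] sl[of 2]
    by (auto simp: clause_exp_def Let_def and_exp_def not_exp_def s(2) a)
qed

lemma runs_to_check_prog:
  assumes s: "ready B s"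
    and B: "\<And>\<tau> q. \<tau> \<le> 4 * r \<Longrightarrow> q < 3 * M \<Longrightarrow> slot \<tau> q < B"
    and ab: "\<And>i. i < B \<Longrightarrow> snd s 10 i = of_bool (bit a i)" "\<And>i. i < B \<Longrightarrow> snd s 11 i = of_bool (bit b i)"
  shows "runs_to (check_prog r u v) s (14 * M + 7) (\<lambda>s'. fst s' 15 = 0 \<longleftrightarrow> ok u v a b)"
proof -
  let ?p = "SetReg 15 (Plus (Reg 15) (sum_exp (map (link_exp r u v) [0..<4 * r])))"
  let ?p' = "seqs [SetReg 15 (Plus (Reg 15) (clause_exp r u)), SetReg 16 (Plus (Reg 16) (Const 3))]"
  let ?links = "\<lambda>n. \<forall>q<n. \<forall>\<tau><4 * r. link_ok u v a b \<tau> q"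
  have 1: "runs_to (For 14 (Reg 5) ?p) ((fst s)(15 := exp_val (Const 0) s), snd s)
      (3 * M * (1 + 2) + 2) (\<lambda>s'. fst s' 15 = 0 \<longleftrightarrow> ?links (3 * M))" (is "runs_to _ ?s _ _")
  proof (rule runs_to_For)
    fix i s' assume f: "framed (insert 14 (wregs ?p)) (warrs ?p) ?s s'"
    have rs: "ready B ?s" using s by (simp add: ready_def)
    have rd: "ready B s'" by (rule ready_framed[OF f rs]) auto
    then show "exp_val (Reg 5) s' = 3 * M" by (simp add: ready_def)
    assume i: "i < 3 * M" "fst s' 15 = 0 \<longleftrightarrow> ?links i" "fst s' 14 = i"
    have e: "exp_val (link_exp r u v \<tau>) s' = 0 \<longleftrightarrow> link_ok u v a b \<tau> i" if "\<tau> < 4 * r" for \<tau>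
      by (rule exp_val_link_exp) (use rd i that B ab framed_arr[OF f, of 10] framed_arr[OF f, of 11] in auto)
    have "(\<Sum>e\<leftarrow>map (link_exp r u v) [0..<4 * r]. exp_val e s') = 0 \<longleftrightarrow>
        (\<forall>\<tau><4 * r. link_ok u v a b \<tau> i)" using e by (auto simp: sum_list_eq_0_iff)
    then show "runs_to ?p s' 1
        (\<lambda>s''. fst ((fst s'')(14 := Suc i), snd s'') 15 = 0 \<longleftrightarrow> ?links (Suc i))"
      by (intro runs_to_intros) (use i in \<open>auto simp: less_Suc_eq\<close>)
  qed simp_all
  let ?cls = "\<lambda>n. \<forall>c<n. clause_ok u a c"
  have 2: "runs_to (For 14 (Reg 4) ?p') s1 (M * (3 + 2) + 2)
      (\<lambda>s'. fst s' 16 = 3 * M \<and> (fst s' 15 = 0 \<longleftrightarrow> ?links (3 * M) \<and> ?cls M))"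
    if s1: "ready B s1" "snd s1 10 = snd s 10" "fst s1 15 = 0 \<longleftrightarrow> ?links (3 * M)" "fst s1 16 = 0" for s1
  proof (rule runs_to_For[where I = "\<lambda>n s'. fst s' 16 = 3 * n \<and>
      (fst s' 15 = 0 \<longleftrightarrow> ?links (3 * M) \<and> ?cls n)"])
    show "fst ((fst s1)(14 := 0), snd s1) 16 = 3 * 0 \<and>
      (fst ((fst s1)(14 := 0), snd s1) 15 = 0 \<longleftrightarrow> ?links (3 * M) \<and> ?cls 0)" using s1 by simp
    fix i s' assume f: "framed (insert 14 (wregs ?p')) (warrs ?p') s1 s'"
    have rd: "ready B s'" by (rule ready_framed[OF f s1(1)]) auto
    then show "exp_val (Reg 4) s' = M" by (simp add: ready_def)
    assume i: "i < M" "fst s' 16 = 3 * i \<and> (fst s' 15 = 0 \<longleftrightarrow> ?links (3 * M) \<and> ?cls i)"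
    have "exp_val (clause_exp r u) s' = 0 \<longleftrightarrow> clause_ok u a i"
      by (rule exp_val_clause_exp) (use rd i B ab framed_arr[OF f, of 10] s1 in auto)
    then show "runs_to ?p' s' 3 (\<lambda>s''. fst ((fst s'')(14 := Suc i), snd s'') 16 = 3 * Suc i \<and>
        (fst ((fst s'')(14 := Suc i), snd s'') 15 = 0 \<longleftrightarrow> ?links (3 * M) \<and> ?cls (Suc i)))"
      unfolding seqs.simps
      by (intro runs_to_intros) (use i in \<open>auto simp: less_Suc_eq\<close>)
  qed simp
  show ?thesis
    unfolding check_prog_def seqs.simps(2)[of "SetReg 15 (Const 0)"]
  proof (rule runs_to_SetReg_Seq, simp, rule runs_to_Cons[OF 1])
    fix s' assume b: "fst s' 15 = 0 \<longleftrightarrow> ?links (3 * M)"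
      and f: "framed (wregs (For 14 (Reg 5) ?p)) (warrs (For 14 (Reg 5) ?p))
        ((fst s)(15 := exp_val (Const 0) s), snd s) s'"
    have rs: "ready B ((fst s)(15 := exp_val (Const 0) s), snd s)" using s by (simp add: ready_def)
    have rd: "ready B s'" by (rule ready_framed[OF f rs]) auto
    let ?s' = "((fst s')(16 := exp_val (Const 0) s'), snd s')"
    have "runs_to (For 14 (Reg 4) ?p') ?s' (M * (3 + 2) + 2)
      (\<lambda>s'. fst s' 16 = 3 * M \<and> (fst s' 15 = 0 \<longleftrightarrow> ?links (3 * M) \<and> ?cls M))"
      by (rule 2) (use rd b framed_arr[OF f, of 10] in \<open>simp_all add: ready_def\<close>)
    then have "runs_to (For 14 (Reg 4) ?p') ?s' (M * 5 + 2) (\<lambda>s'. fst s' 15 = 0 \<longleftrightarrow> ok u v a b)"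
      by (rule runs_to_weaken) (auto simp: ok_def)
    then have "runs_to (seqs [For 14 (Reg 4) ?p']) ?s' (M * 5 + 3) (\<lambda>s'. fst s' 15 = 0 \<longleftrightarrow> ok u v a b)"
      by (rule runs_to_single) simp
    then show "runs_to (seqs [SetReg 16 (Const 0), For 14 (Reg 4) ?p']) s' (M * 5 + 4)
        (\<lambda>s'. fst s' 15 = 0 \<longleftrightarrow> ok u v a b)"
      unfolding seqs.simps(2)[of "SetReg 16 (Const 0)"]
      by (intro runs_to_SetReg_Seq) (simp_all add: add.commute)
  qed simp
qed

end

text \<open>Vanishing beyond the end is required because the relocated program expects an initial
  store.\<close>

definition out :: "nat \<Rightarrow> store \<Rightarrow> nat list \<Rightarrow> bool" where
  "out k s xs \<longleftrightarrow> fst s k = length xs \<and> snd s k = (\<lambda>i. if i < length xs then xs ! i else 0)"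

definition write_prog :: "nat \<Rightarrow> exp \<Rightarrow> prog" where
  "write_prog k e = seqs [SetArr k (Reg k) e, SetReg k (Plus (Reg k) (Const 1))]"

lemma wregs_write_prog [simp]: "wregs (write_prog k e) = {k}"
  and warrs_write_prog [simp]: "warrs (write_prog k e) = {k}"
  by (simp_all add: write_prog_def)

lemma runs_to_write_prog:
  assumes "out k s xs" "exp_val e s = v"
  shows "runs_to (write_prog k e) s 3 (\<lambda>s'. out k s' (xs @ [v]))"
  unfolding write_prog_def seqs.simps
  by (intro runs_to_intros) (use assms in \<open>auto simp: out_def fun_eq_iff nth_append less_Suc_eq\<close>)

lemma out_framed: "framed W A s s' \<Longrightarrow> k \<notin> W \<Longrightarrow> k \<notin> A \<Longrightarrow> out k s xs \<Longrightarrow> out k s' xs"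
  by (simp add: out_def framed_def)

text \<open>In the encoding the number of pairs precedes the pairs, but it is known only after they
  have been tested. A placeholder 0 is written and corrected afterwards.\<close>

lemma out_patch:
  assumes "out k s (xs @ y # ys)"
  shows "out k (fst s, (snd s)(k := (snd s k)(length xs := z))) (xs @ z # ys)"
  using assms by (auto simp: out_def fun_eq_iff nth_append nth_Cons')

definition pair_prog :: "nat \<Rightarrow> nat \<Rightarrow> nat \<Rightarrow> nat \<Rightarrow> prog" where
  "pair_prog k r u v = seqs [decode_prog 19 10, decode_prog 20 11, check_prog r u v,
    prog.If (Less (Reg 15) (Const 1))
      (seqs [write_prog k (Reg 19), write_prog k (Reg 20), SetReg 18 (Plus (Reg 18) (Const 1))])
      Skip]"

definition edge_prog :: "nat \<Rightarrow> nat \<Rightarrow> nat \<times> nat \<Rightarrow> prog" where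
  "edge_prog k r e = seqs [write_prog k (Const (fst e)), write_prog k (Const (snd e)),
    SetReg 17 (Reg k), write_prog k (Const 0), SetReg 18 (Const 0),
    For 19 (Reg 12) (For 20 (Reg 12) (pair_prog k r (fst e) (snd e))),
    SetArr k (Reg 17) (Reg 18)]"

definition write_instance :: "nat \<Rightarrow> nat \<Rightarrow> (nat \<times> nat) list \<Rightarrow> prog" where
  "write_instance k r es = seqs [write_prog k (Const (4 * r * 2 ^ r)),
    seqs (map (\<lambda>i. write_prog k (Const i)) [0..<4 * r * 2 ^ r]),
    write_prog k (Reg 12), For 8 (Reg 12) (write_prog k (Reg 8)),
    write_prog k (Const (length es)),
    seqs (map (\<lambda>i. edge_prog k r (es ! i)) [0..<length es])]"

definition pair_time :: "nat \<Rightarrow> nat \<Rightarrow> nat" where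
  "pair_time M B = B * 10 + M * 14 + 26"

definition edge_time :: "nat \<Rightarrow> nat \<Rightarrow> nat" where
  "edge_time M B = 2 ^ B * (2 ^ B * (pair_time M B + 2) + 4) + 15"

definition write_time :: "nat \<Rightarrow> nat \<Rightarrow> nat \<Rightarrow> nat \<Rightarrow> nat" where
  "write_time r M B n = 4 * r * 2 ^ r * 3 + 2 ^ B * 5 + n * edge_time M B + 14"

lemma write_time_mono:
  assumes "B \<le> \<Lambda>"
  shows "write_time r M B n \<le> write_time r M \<Lambda> n"
proof -
  have "(2::nat) ^ B \<le> 2 ^ \<Lambda>" using assms by simp
  then show ?thesis unfolding write_time_def edge_time_def pair_time_def
    using assms by (intro add_mono mult_mono) auto
qed

definition routed_prog :: "nat \<Rightarrow> (nat \<times> nat) list \<Rightarrow> prog" where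
  "routed_prog r es = seqs [mid_prog r, slot_prog r, power_prog, half_prog,
    write_instance (21 + 4 * r) r es]"

definition routed_time :: "nat \<Rightarrow> nat \<Rightarrow> nat \<Rightarrow> nat \<Rightarrow> nat" where
  "routed_time r n M \<Lambda> = 3 * M * 7 + 2 + (4 * r * (3 * M * 7 + 2) + 3 * M * 3 + 4 +
    (\<Lambda> * 3 + 4 + (2 ^ \<Lambda> * 5 + 2 + (write_time r M \<Lambda> n + 1))))"

abbreviation flat_pairs :: "(nat \<times> nat) list \<Rightarrow> nat list" where
  "flat_pairs ps \<equiv> concat (map (\<lambda>(a, b). [a, b]) ps)"

lemma wregs_decode_prog [simp]: "wregs (decode_prog x a) = {13, 14}"
  and warrs_decode_prog [simp]: "warrs (decode_prog x a) = {a}"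
  by (auto simp: decode_prog_def)

lemma wregs_check_prog [simp]: "wregs (check_prog r u v) = {14, 15, 16}"
  and warrs_check_prog [simp]: "warrs (check_prog r u v) = {}"
  by (auto simp: check_prog_def)

lemma wregs_pair_prog [simp]: "wregs (pair_prog k r u v) = {13, 14, 15, 16, 18, k}"
  and warrs_pair_prog [simp]: "warrs (pair_prog k r u v) = {10, 11, k}"
  by (auto simp: pair_prog_def)

lemma wregs_edge_prog [simp]: "wregs (edge_prog k r e) = {13, 14, 15, 16, 17, 18, 19, 20, k}"
  and warrs_edge_prog [simp]: "warrs (edge_prog k r e) = {10, 11, k}"
  by (auto simp: edge_prog_def)

context routing
begin

definition row_pairs :: "nat \<Rightarrow> nat \<Rightarrow> nat \<Rightarrow> nat \<Rightarrow> (nat \<times> nat) list" where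
  "row_pairs u v a n = map (Pair a) (filter (ok u v a) [0..<n])"

definition pairs :: "nat \<Rightarrow> nat \<Rightarrow> nat \<Rightarrow> nat \<Rightarrow> (nat \<times> nat) list" where
  "pairs u v n m = concat (map (\<lambda>a. row_pairs u v a m) [0..<n])"

definition csp_word :: "nat \<Rightarrow> (nat \<times> nat) list \<Rightarrow> nat list" where
  "csp_word B es = [4 * r * 2 ^ r] @ [0..<4 * r * 2 ^ r] @ [2 ^ B] @ [0..<2 ^ B] @ [length es] @
    concat (map (\<lambda>e. constr_word (e, pairs (fst e) (snd e) (2 ^ B) (2 ^ B))) es)"

lemma pairs_product: "pairs u v n m = filter (\<lambda>(a, b). ok u v a b) (List.product [0..<n] [0..<m])"
  by (simp add: pairs_def row_pairs_def product_concat_map filter_concat comp_def filter_map)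

lemma encodes_csp_word:
  assumes "distinct es" "set es = network_edges r"
  shows "encodes_csp2 (csp_word B es) (csp B)"
proof -
  let ?ps = "\<lambda>e. pairs (fst e) (snd e) (2 ^ B) (2 ^ B)"
  have "distinct (?ps e)" for e
    unfolding pairs_product by (intro distinct_filter distinct_product) auto
  moreover have "set (?ps e) = constr (csp B) e" for e
    by (auto simp: pairs_def row_pairs_def csp_def split: prod.splits)
  ultimately show ?thesis
    unfolding encodes_csp2_def
    by (intro exI[of _ "[0..<4 * r * 2 ^ r]"] exI[of _ "[0..<2 ^ B]"] exI[of _ "map (\<lambda>e. (e, ?ps e)) es"])
       (use assms in \<open>auto simp: csp_word_def csp_def comp_def lessThan_atLeast0\<close>)
qed

context
  fixes B :: nat and k :: nat
  assumes B: "\<And>\<tau> q. \<tau> \<le> 4 * r \<Longrightarrow> q < 3 * M \<Longrightarrow> slot \<tau> q < B"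
    and k: "k = 21 + 4 * r"
begin

lemma runs_to_write:
  assumes "ready B s" "out k s xs" "exp_val e s = v"
    "\<And>s'. ready B s' \<Longrightarrow> out k s' (xs @ [v]) \<Longrightarrow> framed {k} {k} s s' \<Longrightarrow> runs_to (seqs ps) s' V Q"
    "3 + V \<le> T"
  shows "runs_to (seqs (write_prog k e # ps)) s T Q"
proof (rule runs_to_Cons[OF runs_to_write_prog[OF assms(2,3)] _ assms(5)])
  fix s' assume "out k s' (xs @ [v])" and f: "framed (wregs (write_prog k e)) (warrs (write_prog k e)) s s'"
  moreover have "ready B s'" by (rule ready_framed[OF f assms(1)]) (use k in auto)
  ultimately show "runs_to (seqs ps) s' V Q" using assms(4) by simp
qed

lemma runs_to_pair_prog:
  assumes s: "ready B s" "out k s xs" "fst s 19 = a" "fst s 20 = b" "a < 2 ^ B" "b < 2 ^ B"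
  shows "runs_to (pair_prog k r u v) s (pair_time M B) (\<lambda>s'.
    out k s' (xs @ (if ok u v a b then [a, b] else [])) \<and>
    fst s' 18 = fst s 18 + of_bool (ok u v a b))" (is "runs_to _ _ _ ?Q")
  unfolding pair_prog_def
proof (rule runs_to_Cons)
  let ?if = "prog.If (Less (Reg 15) (Const 1))
      (seqs [write_prog k (Reg 19), write_prog k (Reg 20), SetReg 18 (Plus (Reg 18) (Const 1))]) Skip"
  let ?inv = "\<lambda>s'. ready B s' \<and> out k s' xs \<and> fst s' 18 = fst s 18 \<and> fst s' 19 = a \<and> fst s' 20 = b"
  have inv: "?inv s''" if "framed W A s' s''" "?inv s'" "W \<subseteq> {13, 14, 15, 16}" "A \<subseteq> {10, 11}" for W A s' s''
  proof -
    have f: "framed {13, 14, 15, 16} {10, 11} s' s''" by (rule framed_mono[OF that(1,3,4)])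
    have "ready B s''" by (rule ready_framed[OF f]) (use that in auto)
    moreover have "out k s'' xs" by (rule out_framed[OF f]) (use that k in auto)
    ultimately show ?thesis
      using that framed_reg[OF f, of 18] framed_reg[OF f, of 19] framed_reg[OF f, of 20] by simp
  qed
  show "runs_to (decode_prog 19 10) s (B * 5 + 4) (\<lambda>s'. \<forall>i<B. snd s' 10 i = of_bool (bit a i))"
    by (rule runs_to_decode_prog) (use s in \<open>auto simp: ready_def\<close>)
  fix s1 assume a: "\<forall>i<B. snd s1 10 i = of_bool (bit a i)"
    and f1: "framed (wregs (decode_prog 19 10)) (warrs (decode_prog 19 10)) s s1"
  have i1: "?inv s1" by (rule inv[OF f1]) (use s in auto)
  show "runs_to (seqs [decode_prog 20 11, check_prog r u v, ?if]) s1 (B * 5 + M * 14 + 22) ?Q"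
  proof (rule runs_to_Cons)
    show "runs_to (decode_prog 20 11) s1 (B * 5 + 4) (\<lambda>s'. \<forall>i<B. snd s' 11 i = of_bool (bit b i))"
      by (rule runs_to_decode_prog) (use s(6) i1 in \<open>auto simp: ready_def\<close>)
    fix s2 assume b: "\<forall>i<B. snd s2 11 i = of_bool (bit b i)"
      and f2: "framed (wregs (decode_prog 20 11)) (warrs (decode_prog 20 11)) s1 s2"
    have i2: "?inv s2" by (rule inv[OF f2 i1]) auto
    have a2: "\<forall>i<B. snd s2 10 i = of_bool (bit a i)" using framed_arr[OF f2, of 10] a by simp
    show "runs_to (seqs [check_prog r u v, ?if]) s2 (M * 14 + 18) ?Q"
    proof (rule runs_to_Cons)
      show "runs_to (check_prog r u v) s2 (14 * M + 7) (\<lambda>s'. fst s' 15 = 0 \<longleftrightarrow> ok u v a b)"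
        by (rule runs_to_check_prog[OF conjunct1[OF i2] B]) (use a2 b in auto)
      fix s3 assume c: "fst s3 15 = 0 \<longleftrightarrow> ok u v a b"
        and f3: "framed (wregs (check_prog r u v)) (warrs (check_prog r u v)) s2 s3"
      have i3: "?inv s3" by (rule inv[OF f3 i2]) auto
      then have g3: "ready B s3" "out k s3 xs" "exp_val (Reg 19) s3 = a" by auto
      have "runs_to ?if s3 10 ?Q"
      proof (rule runs_to_If)
        assume "test_val (Less (Reg 15) (Const 1)) s3"
        then have ok: "ok u v a b" using c by simp
        show "runs_to (seqs [write_prog k (Reg 19), write_prog k (Reg 20),
            SetReg 18 (Plus (Reg 18) (Const 1))]) s3 (10 - 1) ?Q"
        proof (rule runs_to_write[OF g3])
          fix s4 assume g4: "ready B s4" "out k s4 (xs @ [a])" and f4: "framed {k} {k} s3 s4"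
          have e4: "exp_val (Reg 20) s4 = b" using framed_reg[OF f4, of 20] i3 k by auto
          show "runs_to (seqs [write_prog k (Reg 20), SetReg 18 (Plus (Reg 18) (Const 1))]) s4 6 ?Q"
          proof (rule runs_to_write[OF g4 e4])
            fix s5 assume o5: "out k s5 ((xs @ [a]) @ [b])" and f5: "framed {k} {k} s4 s5"
            have "fst s5 18 = fst s 18"
              using framed_reg[OF f5, of 18] framed_reg[OF f4, of 18] i3 k by auto
            moreover have "out k ((fst s5)(18 := Suc (fst s5 18)), snd s5) ((xs @ [a]) @ [b])"
              using o5 k by (simp add: out_def)
            ultimately show "runs_to (seqs [SetReg 18 (Plus (Reg 18) (Const 1))]) s5 2 ?Q"
              unfolding seqs.simps by (intro runs_to_intros) (use ok in simp_all)
          qed simp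
        qed simp
      next
        assume "\<not> test_val (Less (Reg 15) (Const 1)) s3"
        then show "runs_to Skip s3 (10 - 1) ?Q" by (intro runs_to_Skip) (use c i3 in simp_all)
      qed simp
      then show "runs_to (seqs [?if]) s3 11 ?Q" by (rule runs_to_single) simp
    qed simp
  qed simp
qed (simp add: pair_time_def)

lemma runs_to_row:
  assumes s: "ready B s" "out k s xs" "fst s 19 = a" "a < 2 ^ B"
  shows "runs_to (For 20 (Reg 12) (pair_prog k r u v)) s (2 ^ B * (pair_time M B + 2) + 2) (\<lambda>s'.
    out k s' (xs @ flat_pairs (row_pairs u v a (2 ^ B))) \<and>
    fst s' 18 = fst s 18 + length (row_pairs u v a (2 ^ B)))"
proof (rule runs_to_For[where I = "\<lambda>b s'. out k s' (xs @ flat_pairs (row_pairs u v a b)) \<and>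
    fst s' 18 = fst s 18 + length (row_pairs u v a b)"])
  show "out k ((fst s)(20 := 0), snd s) (xs @ flat_pairs (row_pairs u v a 0)) \<and>
    fst ((fst s)(20 := 0), snd s) 18 = fst s 18 + length (row_pairs u v a 0)"
    using s k by (simp add: row_pairs_def out_def)
  show "20 \<notin> wregs (pair_prog k r u v)" using k by simp
  fix b s' assume f: "framed (insert 20 (wregs (pair_prog k r u v))) (warrs (pair_prog k r u v)) s s'"
  have rd: "ready B s'" by (rule ready_framed[OF f s(1)]) (use k in auto)
  then show "exp_val (Reg 12) s' = 2 ^ B" by (simp add: ready_def)
  have a: "fst s' 19 = a" using framed_reg[OF f, of 19] s k by simp
  assume b: "b < 2 ^ B" "fst s' 20 = b" and I: "out k s' (xs @ flat_pairs (row_pairs u v a b)) \<and>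
    fst s' 18 = fst s 18 + length (row_pairs u v a b)"
  have e: "row_pairs u v a (Suc b) = row_pairs u v a b @ (if ok u v a b then [(a, b)] else [])"
    by (simp add: row_pairs_def)
  show "runs_to (pair_prog k r u v) s' (pair_time M B) (\<lambda>s''.
      out k ((fst s'')(20 := Suc b), snd s'') (xs @ flat_pairs (row_pairs u v a (Suc b))) \<and>
      fst ((fst s'')(20 := Suc b), snd s'') 18 = fst s 18 + length (row_pairs u v a (Suc b)))"
    by (rule runs_to_weaken[OF runs_to_pair_prog[OF rd conjunct1[OF I] a b(2) s(4) b(1)]])
       (use I k in \<open>auto simp: e out_def split: if_splits\<close>)
qed

lemma runs_to_pairs:
  assumes s: "ready B s" "out k s xs" "fst s 18 = 0"
  shows "runs_to (For 19 (Reg 12) (For 20 (Reg 12) (pair_prog k r u v))) s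
    (2 ^ B * (2 ^ B * (pair_time M B + 2) + 2 + 2) + 2) (\<lambda>s'.
    out k s' (xs @ flat_pairs (pairs u v (2 ^ B) (2 ^ B))) \<and>
    fst s' 18 = length (pairs u v (2 ^ B) (2 ^ B)))"
proof (rule runs_to_For[where I = "\<lambda>a s'. out k s' (xs @ flat_pairs (pairs u v a (2 ^ B))) \<and>
    fst s' 18 = length (pairs u v a (2 ^ B))"])
  let ?p = "For 20 (Reg 12) (pair_prog k r u v)"
  show "out k ((fst s)(19 := 0), snd s) (xs @ flat_pairs (pairs u v 0 (2 ^ B))) \<and>
    fst ((fst s)(19 := 0), snd s) 18 = length (pairs u v 0 (2 ^ B))"
    using s k by (simp add: pairs_def out_def)
  show "19 \<notin> wregs ?p" using k by simp
  fix a s' assume f: "framed (insert 19 (wregs ?p)) (warrs ?p) s s'"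
  have rd: "ready B s'" by (rule ready_framed[OF f s(1)]) (use k in auto)
  then show "exp_val (Reg 12) s' = 2 ^ B" by (simp add: ready_def)
  assume a: "a < 2 ^ B" "fst s' 19 = a" and I: "out k s' (xs @ flat_pairs (pairs u v a (2 ^ B))) \<and>
    fst s' 18 = length (pairs u v a (2 ^ B))"
  have e: "pairs u v (Suc a) (2 ^ B) = pairs u v a (2 ^ B) @ row_pairs u v a (2 ^ B)"
    by (simp add: pairs_def)
  show "runs_to ?p s' (2 ^ B * (pair_time M B + 2) + 2) (\<lambda>s''.
      out k ((fst s'')(19 := Suc a), snd s'') (xs @ flat_pairs (pairs u v (Suc a) (2 ^ B))) \<and>
      fst ((fst s'')(19 := Suc a), snd s'') 18 = length (pairs u v (Suc a) (2 ^ B)))"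
    by (rule runs_to_weaken[OF runs_to_row[OF rd conjunct1[OF I] a(2,1)]])
       (use I k in \<open>auto simp: e out_def\<close>)
qed

lemma runs_to_edge_prog:
  assumes s: "ready B s" "out k s xs"
  shows "runs_to (edge_prog k r e) s (edge_time M B) (\<lambda>s'.
    out k s' (xs @ constr_word (e, pairs (fst e) (snd e) (2 ^ B) (2 ^ B))))" (is "runs_to _ _ _ ?Q")
proof -
  let ?u = "fst e" and ?v = "snd e" and ?ps = "pairs (fst e) (snd e) (2 ^ B) (2 ^ B)"
  let ?T = "2 ^ B * (2 ^ B * (pair_time M B + 2) + 4)"
  let ?loop = "For 19 (Reg 12) (For 20 (Reg 12) (pair_prog k r ?u ?v))"
  let ?ys = "(xs @ [?u]) @ [?v]"
  have w: "xs @ constr_word (e, ?ps) = ?ys @ length ?ps # flat_pairs ?ps" by (cases e) simp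
  show ?thesis unfolding edge_prog_def
  proof (rule runs_to_write[OF s exp_val.simps(1)])
    fix s1 assume s1: "ready B s1" "out k s1 (xs @ [?u])"
    show "runs_to (seqs [write_prog k (Const ?v), SetReg 17 (Reg k), write_prog k (Const 0),
        SetReg 18 (Const 0), ?loop, SetArr k (Reg 17) (Reg 18)]) s1 (?T + 12) ?Q"
    proof (rule runs_to_write[OF s1 exp_val.simps(1)])
      fix s2 assume s2: "ready B s2" "out k s2 ?ys"
      let ?s2 = "((fst s2)(17 := fst s2 k), snd s2)"
      have s2': "ready B ?s2" "out k ?s2 ?ys" "fst ?s2 17 = length ?ys"
        using s2 k by (simp_all add: out_def ready_def)
      have "runs_to (seqs [write_prog k (Const 0),
        SetReg 18 (Const 0), ?loop, SetArr k (Reg 17) (Reg 18)]) ?s2 (?T + 8) ?Q"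
      proof (rule runs_to_write[OF s2'(1,2) exp_val.simps(1)])
        fix s3 assume s3: "ready B s3" "out k s3 (?ys @ [0])" and f3: "framed {k} {k} ?s2 s3"
        have p3: "fst s3 17 = length ?ys" using framed_reg[OF f3, of 17] s2'(3) k by auto
        let ?s3 = "((fst s3)(18 := 0), snd s3)"
        have s3': "ready B ?s3" "out k ?s3 (?ys @ [0])" "fst ?s3 18 = 0"
          using s3 k by (simp_all add: out_def ready_def)
        have "runs_to (seqs [?loop, SetArr k (Reg 17) (Reg 18)]) ?s3 (?T + 4) ?Q"
        proof (rule runs_to_Cons[OF runs_to_pairs[OF s3']])
          fix s4 assume o4: "out k s4 ((?ys @ [0]) @ flat_pairs ?ps) \<and> fst s4 18 = length ?ps"
            and f4: "framed (wregs ?loop) (warrs ?loop) ?s3 s4"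
          have p4: "fst s4 17 = length ?ys" using framed_reg[OF f4, of 17] p3 k by auto
          have "out k s4 (?ys @ 0 # flat_pairs ?ps)" using o4 by simp
          then have "out k (fst s4, (snd s4)(k := (snd s4 k)(length ?ys := length ?ps)))
              (?ys @ length ?ps # flat_pairs ?ps)" by (rule out_patch)
          then show "runs_to (seqs [SetArr k (Reg 17) (Reg 18)]) s4 2 ?Q"
            unfolding seqs.simps w using p4 o4 by (intro runs_to_intros) (simp_all del: append_assoc)
        qed (simp add: algebra_simps)
        then show "runs_to (seqs [SetReg 18 (Const 0), ?loop, SetArr k (Reg 17) (Reg 18)]) s3 (?T + 5) ?Q"
          unfolding seqs.simps(2)[of "SetReg _ _"] by (intro runs_to_SetReg_Seq) (simp_all add: add.commute)
      qed simp
      then show "runs_to (seqs [SetReg 17 (Reg k), write_prog k (Const 0),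
        SetReg 18 (Const 0), ?loop, SetArr k (Reg 17) (Reg 18)]) s2 (?T + 9) ?Q"
        unfolding seqs.simps(2)[of "SetReg 17 _"] by (intro runs_to_SetReg_Seq) (simp_all add: add.commute)
    qed simp
  qed (simp add: edge_time_def)
qed

lemma runs_to_write_instance:
  assumes s: "ready B s" "out k s []"
  shows "runs_to (write_instance k r es) s (write_time r M B (length es)) (\<lambda>s'. out k s' (csp_word B es))"
proof -
  let ?N = "4 * r * 2 ^ r" and ?L = "2 ^ B :: nat" and ?E = "length es"
  let ?e = "\<lambda>i. edge_prog k r (es ! i)"
  let ?cw = "\<lambda>e. constr_word (e, pairs (fst e) (snd e) (2 ^ B) (2 ^ B))"
  let ?x1 = "[?N]" and ?x2 = "[?N] @ [0..<?N]" and ?x3 = "([?N] @ [0..<?N]) @ [?L]"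
  let ?x4 = "(([?N] @ [0..<?N]) @ [?L]) @ [0..<?L]"
  let ?x5 = "((([?N] @ [0..<?N]) @ [?L]) @ [0..<?L]) @ [?E]"
  let ?Q = "\<lambda>s'. out k s' (csp_word B es)"
  have vs: "runs_to (seqs (map (\<lambda>i. write_prog k (Const i)) [0..<?N])) s1 (?N * 3 + 1) (\<lambda>s'. out k s' ?x2)"
    if "out k s1 ?x1" for s1
  proof (rule runs_to_seqs[where I = "\<lambda>i s'. out k s' ([?N] @ [0..<i])"])
    show "out k s1 ([?N] @ [0..<0])" using that by simp
    fix i s' assume "out k s' ([?N] @ [0..<i])"
    then have "runs_to (write_prog k (Const i)) s' 3 (\<lambda>s'. out k s' (([?N] @ [0..<i]) @ [i]))"
      by (rule runs_to_write_prog) simp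
    then show "runs_to (write_prog k (Const i)) s' 3 (\<lambda>s'. out k s' ([?N] @ [0..<Suc i]))" by simp
  qed
  have as: "runs_to (For 8 (Reg 12) (write_prog k (Reg 8))) s1 (?L * (3 + 2) + 2) (\<lambda>s'. out k s' ?x4)"
    if s1: "out k s1 ?x3" "ready B s1" for s1
  proof (rule runs_to_For[where I = "\<lambda>i s'. out k s' (?x3 @ [0..<i])"])
    show "out k ((fst s1)(8 := 0), snd s1) (?x3 @ [0..<0])" using s1 k by (simp add: out_def)
    show "8 \<notin> wregs (write_prog k (Reg 8))" using k by simp
    fix i s' assume f: "framed (insert 8 (wregs (write_prog k (Reg 8)))) (warrs (write_prog k (Reg 8))) s1 s'"
    show "exp_val (Reg 12) s' = 2 ^ B"
      using framed_reg[OF f, of 12] s1(2) k by (auto simp: ready_def)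
    assume I: "out k s' (?x3 @ [0..<i])" "fst s' 8 = i"
    have "runs_to (write_prog k (Reg 8)) s' 3 (\<lambda>s'. out k s' ((?x3 @ [0..<i]) @ [i]))"
      by (rule runs_to_write_prog[OF I(1)]) (simp add: I)
    then show "runs_to (write_prog k (Reg 8)) s' 3
        (\<lambda>s''. out k ((fst s'')(8 := Suc i), snd s'') (?x3 @ [0..<Suc i]))"
      by (rule runs_to_weaken) (use k in \<open>auto simp: out_def\<close>)
  qed
  have xs: "runs_to (seqs (map ?e [0..<?E])) s1 (?E * edge_time M B + 1) ?Q"
    if s1: "out k s1 ?x5" "ready B s1" for s1
  proof -
    have "runs_to (seqs (map ?e [0..<?E])) s1 (?E * edge_time M B + 1)
      (\<lambda>s'. out k s' (?x5 @ concat (map (\<lambda>i. ?cw (es ! i)) [0..<?E])))"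
    proof (rule runs_to_seqs[where I = "\<lambda>j s'. out k s' (?x5 @ concat (map (\<lambda>i. ?cw (es ! i)) [0..<j]))"])
      show "out k s1 (?x5 @ concat (map (\<lambda>i. ?cw (es ! i)) [0..<0]))" using s1 by simp
      fix j s' assume j: "out k s' (?x5 @ concat (map (\<lambda>i. ?cw (es ! i)) [0..<j]))"
        and f: "framed (\<Union>j<?E. wregs (?e j)) (\<Union>j<?E. warrs (?e j)) s1 s'"
      have rd: "ready B s'" by (rule ready_framed[OF f s1(2)]) (use k in auto)
      show "runs_to (?e j) s' (edge_time M B)
          (\<lambda>s'. out k s' (?x5 @ concat (map (\<lambda>i. ?cw (es ! i)) [0..<Suc j])))"
        using runs_to_edge_prog[OF rd j, of "es ! j"] by simp
    qed
    moreover have "map (\<lambda>i. ?cw (es ! i)) [0..<?E] = map ?cw es"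
      using map_map[of ?cw "(!) es" "[0..<?E]"] by (simp add: map_nth comp_def)
    ultimately show ?thesis by (simp add: csp_word_def)
  qed
  show ?thesis unfolding write_instance_def
  proof (rule runs_to_write[OF s exp_val.simps(1)])
    let ?p2 = "seqs (map (\<lambda>i. write_prog k (Const i)) [0..<?N])"
    fix s1 assume s1: "ready B s1" "out k s1 ([] @ [?N])"
    then have o1: "out k s1 ?x1" by simp
    show "runs_to (seqs [?p2, write_prog k (Reg 12), For 8 (Reg 12) (write_prog k (Reg 8)),
        write_prog k (Const ?E), seqs (map ?e [0..<?E])]) s1
        (?N * 3 + 1 + (3 + (?L * 5 + 2 + (3 + (?E * edge_time M B + 2))))) ?Q"
    proof (rule runs_to_Cons[OF vs[OF o1]])
      fix s2 assume o2: "out k s2 ?x2" and f2: "framed (wregs ?p2) (warrs ?p2) s1 s2"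
      have r2: "ready B s2" by (rule ready_framed[OF f2 s1(1)]) (use k in auto)
      have L: "exp_val (Reg 12) s2 = ?L" using r2 by (simp add: ready_def)
      show "runs_to (seqs [write_prog k (Reg 12), For 8 (Reg 12) (write_prog k (Reg 8)),
          write_prog k (Const ?E), seqs (map ?e [0..<?E])]) s2
          (3 + (?L * 5 + 2 + (3 + (?E * edge_time M B + 2)))) ?Q"
      proof (rule runs_to_write[OF r2 o2 L])
        let ?p4 = "For 8 (Reg 12) (write_prog k (Reg 8))"
        fix s3 assume s3: "ready B s3" "out k s3 ?x3"
        show "runs_to (seqs [?p4, write_prog k (Const ?E), seqs (map ?e [0..<?E])]) s3
            (?L * 5 + 2 + (3 + (?E * edge_time M B + 2))) ?Q"
        proof (rule runs_to_Cons[OF as[OF s3(2,1)]])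
          fix s4 assume o4: "out k s4 ?x4" and f4: "framed (wregs ?p4) (warrs ?p4) s3 s4"
          have r4: "ready B s4" by (rule ready_framed[OF f4 s3(1)]) (use k in auto)
          show "runs_to (seqs [write_prog k (Const ?E), seqs (map ?e [0..<?E])]) s4
              (3 + (?E * edge_time M B + 2)) ?Q"
          proof (rule runs_to_write[OF r4 o4 exp_val.simps(1)])
            fix s5 assume s5: "ready B s5" "out k s5 ?x5"
            show "runs_to (seqs [seqs (map ?e [0..<?E])]) s5 (?E * edge_time M B + 2) ?Q"
              by (rule runs_to_single[OF xs[OF s5(2,1)]]) simp
          qed simp
        qed simp
      qed simp
    qed simp
  qed (simp add: write_time_def)
qed

end

lemma slot_less:
  assumes "\<And>\<tau> q. \<tau> \<in> {1..4 * r} \<Longrightarrow> q < 3 * M \<Longrightarrow> rank (pos \<tau>) q < B" "\<tau> \<le> 4 * r" "q < 3 * M"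
  shows "slot \<tau> q < B"
  using assms(1)[of "4 * r" "F (var q)"] assms(1)[of \<tau> q] assms(2,3) F_less r
  by (auto simp: slot_def)

text \<open>\<open>B\<close> is whatever register 11 holds after the slots have been assigned. It
  varies with the formula, hence the quantifier and the time bound in terms of
  \<open>\<Lambda>\<close>.\<close>

lemma runs_to_routed_prog:
  assumes s: "fst s 4 = M" "fst s 5 = 3 * M" "fst s 11 = 0"
    "\<And>q. q < 3 * M \<Longrightarrow> snd s 1 q = var q" "\<And>q. q < 3 * M \<Longrightarrow> snd s 2 q = of_bool (sgn q)"
    "\<And>q. q < 3 * M \<Longrightarrow> snd s 3 (var q) = F (var q)"
    "\<And>q. q < 3 * M \<Longrightarrow> snd s 4 q = home q"
    "\<And>i. snd s 7 i = 0" "\<And>i. snd s 8 i = 0" "out (21 + 4 * r) s []"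
    and \<Lambda>: "\<And>\<tau> q. q < 3 * M \<Longrightarrow> rank (pos \<tau>) q < \<Lambda>"
  shows "runs_to (routed_prog r es) s (routed_time r (length es) M \<Lambda>)
    (\<lambda>s'. \<exists>B\<le>\<Lambda>. (\<forall>\<tau>\<in>{1..4 * r}. \<forall>q<3 * M. rank (pos \<tau>) q < B) \<and>
      out (21 + 4 * r) s' (csp_word B es))" (is "runs_to _ _ _ ?Q")
  unfolding routed_prog_def routed_time_def
proof (rule runs_to_Cons[OF runs_to_mid_prog[OF s(2,4,6,7,8)]])
  let ?k = "21 + 4 * r"
  let ?t3 = "2 ^ \<Lambda> * 5 + 2 + (write_time r M \<Lambda> (length es) + 1)"
  let ?t2 = "\<Lambda> * 3 + 4 + ?t3"
  fix s1 assume m1: "\<forall>q<3 * M. snd s1 5 q = src q \<and> snd s1 6 q = mid q"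
    and f1: "framed (wregs (mid_prog r)) (warrs (mid_prog r)) s s1"
  have fr1: "fst s1 x = fst s x" if "x \<in> {4, 5, 11, ?k}" for x
    by (rule framed_reg[OF f1]) (use that in \<open>auto simp: mid_prog_def mid_body_def\<close>)
  have fa1: "snd s1 x = snd s x" if "x \<in> {1, 2, 3, 4, 8, ?k}" for x
    by (rule framed_arr[OF f1]) (use that in \<open>auto simp: mid_prog_def mid_body_def\<close>)
  show "runs_to (seqs [slot_prog r, power_prog, half_prog, write_instance ?k r es]) s1
    (4 * r * (3 * M * 7 + 2) + 3 * M * 3 + 4 + ?t2) ?Q"
  proof (rule runs_to_Cons[OF runs_to_slot_prog])
    fix s2 assume m2: "(\<forall>\<tau>\<le>4 * r. \<forall>q<3 * M. snd s2 (20 + \<tau>) q = slot \<tau> q) \<and> fst s2 11 \<le> \<Lambda> \<and>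
        (\<forall>\<tau>\<in>{1..4 * r}. \<forall>q<3 * M. rank (pos \<tau>) q < fst s2 11)"
      and f2: "framed (wregs (slot_prog r)) (warrs (slot_prog r)) s1 s2"
    define B where "B = fst s2 11"
    have B: "B \<le> \<Lambda>" "\<And>\<tau> q. \<tau> \<in> {1..4 * r} \<Longrightarrow> q < 3 * M \<Longrightarrow> rank (pos \<tau>) q < B"
      using m2 by (auto simp: B_def)
    have L: "(2::nat) ^ B \<le> 2 ^ \<Lambda>" using B(1) by simp
    have fr2: "fst s2 x = fst s1 x" if "x \<in> {4, 5, ?k}" for x
      by (rule framed_reg[OF f2]) (use that in \<open>auto simp: slot_prog_def slot_body_def\<close>)
    have fa2: "snd s2 x = snd s1 x" if "x \<in> {1, 2, 3, 4, 5, 6, ?k}" for x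
      by (rule framed_arr[OF f2]) (use that in \<open>auto simp: slot_prog_def slot_body_def\<close>)
    show "runs_to (seqs [power_prog, half_prog, write_instance ?k r es]) s2 ?t2 ?Q"
    proof (rule runs_to_Cons[OF runs_to_power_prog[OF B_def[symmetric]]])
      fix s3 assume m3: "fst s3 12 = 2 ^ B"
        and f3: "framed (wregs power_prog) (warrs power_prog) s2 s3"
      have fr3: "fst s3 x = fst s2 x" if "x \<in> {4, 5, 11, ?k}" for x
        by (rule framed_reg[OF f3]) (use that in \<open>auto simp: power_prog_def\<close>)
      have fa3: "snd s3 x = snd s2 x" for x
        by (rule framed_arr[OF f3]) (auto simp: power_prog_def)
      show "runs_to (seqs [half_prog, write_instance ?k r es]) s3 ?t3 ?Q"
      proof (rule runs_to_Cons[OF runs_to_half_prog[OF m3]])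
        fix s4 assume m4: "\<forall>x<2 * 2 ^ B. snd s4 9 x = x div 2"
          and f4: "framed (wregs half_prog) (warrs half_prog) s3 s4"
        have fr4: "fst s4 x = fst s3 x" if "x \<in> {4, 5, 11, 12, ?k}" for x
          by (rule framed_reg[OF f4]) (use that in \<open>auto simp: half_prog_def\<close>)
        have fa4: "snd s4 x = snd s3 x" if "x \<noteq> 9" for x
          by (rule framed_arr[OF f4]) (use that in \<open>auto simp: half_prog_def\<close>)
        have rd: "ready B s4"
          unfolding ready_def using s m1 m2 m3 m4 by (auto simp: fr4 fr3 fr2 fr1 fa4 fa3 fa2 fa1 B_def)
        have o: "out ?k s4 []"
          using s(10) by (simp add: out_def fr4 fr3 fr2 fr1 fa4 fa3 fa2 fa1)
        have "runs_to (write_instance ?k r es) s4 (write_time r M B (length es))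
            (\<lambda>s'. out ?k s' (csp_word B es))"
          by (rule runs_to_write_instance[OF slot_less[OF B(2)] refl rd o])
        then have "runs_to (write_instance ?k r es) s4 (write_time r M \<Lambda> (length es)) ?Q"
          by (rule runs_to_weaken) (use B write_time_mono[OF B(1)] in auto)
        then show "runs_to (seqs [write_instance ?k r es]) s4 (write_time r M \<Lambda> (length es) + 1) ?Q"
          by (rule runs_to_single) simp
      qed (use L in simp)
    qed (use B in simp)
  qed ((rule order_refl | use s m1 \<Lambda> in \<open>simp add: fr1 fa1; fail\<close>)+)
qed ((assumption | rule order_refl)+)

end

definition reduction :: "nat \<Rightarrow> nat \<Rightarrow> (nat \<times> nat) list \<Rightarrow> prog" where
  "reduction r m0 es = seqs [read_prog m0, home_prog r, rep_prog, routed_prog r es]"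

section \<open>Correctness and cost of the reduction\<close>

lemma floorlog_2_le: "floorlog 2 x \<le> x"
  by (simp add: floorlog_le_iff)

lemma enc_size_le:
  assumes "\<And>x. x \<in> set xs \<Longrightarrow> x \<le> b"
  shows "enc_size xs \<le> length xs * (b + 1)"
  using assms
proof (induction xs)
  case (Cons x xs)
  then have "enc_size xs \<le> length xs * (b + 1)" "x \<le> b" by auto
  then show ?case using floorlog_2_le[of x] unfolding enc_size_def by simp
qed (simp add: enc_size_def)

text \<open>Number of entries times a bound on their lengths. Estimating \<open>floorlog 2 x\<close>
  by \<open>x\<close> is wasteful, but only the degree 4 in \<open>2 ^ B\<close> matters;
  \<open>\<zeta>\<close> pays for it.\<close>

definition enc_bound :: "nat \<Rightarrow> nat \<Rightarrow> nat \<Rightarrow> nat" where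
  "enc_bound r n B = (3 + 4 * r * 2 ^ r + 2 ^ B + n * (3 + 2 * (2 ^ B * 2 ^ B))) *
    (4 * r * 2 ^ r + 2 ^ B * 2 ^ B + n + 1)"

lemma enc_bound_mono: "B \<le> \<Lambda> \<Longrightarrow> enc_bound r n B \<le> enc_bound r n \<Lambda>"
proof -
  assume "B \<le> \<Lambda>"
  then have "(2::nat) ^ B \<le> 2 ^ \<Lambda>" by simp
  then show ?thesis unfolding enc_bound_def by (intro mult_mono add_mono) auto
qed

definition formula_satisfies :: "nat \<Rightarrow> clause list \<Rightarrow> (nat \<Rightarrow> bool) \<Rightarrow> nat \<Rightarrow> bool" where
  "formula_satisfies n cs \<alpha> c \<longleftrightarrow> (\<exists>j<3. \<alpha> (copy_var n cs (3 * c + j)) = copy_sgn cs (3 * c + j))"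

text \<open>The properties of the output that remain once run-time choices, namely the
  representatives and \<open>B\<close>, are forgotten.\<close>

definition hard_instance :: "nat \<Rightarrow> nat \<Rightarrow> ((nat \<Rightarrow> bool) \<Rightarrow> nat \<Rightarrow> bool) \<Rightarrow> nat \<Rightarrow> csp2 \<Rightarrow> bool" where
  "hard_instance r M sat \<Lambda> \<Gamma> \<longleftrightarrow> is_csp2 \<Gamma> \<and> three_regular \<Gamma> \<and>
    card (verts \<Gamma>) = 4 * r * 2 ^ r \<and> card (edges \<Gamma>) \<le> 12 * r * 2 ^ r \<and> CSP \<Gamma> \<le> card (edges \<Gamma>) \<and>
    (\<forall>\<alpha>. (\<forall>c<M. sat \<alpha> c) \<longrightarrow> CSP \<Gamma> = card (edges \<Gamma>)) \<and>
    (\<forall>t. (\<forall>\<alpha>. t \<le> card {c. c < M \<and> \<not> sat \<alpha> c}) \<longrightarrow>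
      t \<le> (card (edges \<Gamma>) - CSP \<Gamma>) * (2 * \<Lambda>))"

lemma CSP_le:
  assumes "is_csp2 \<Gamma>" "alphabet \<Gamma> \<noteq> {}"
  shows "CSP \<Gamma> \<le> card (edges \<Gamma>)"
proof -
  have fin: "finite (verts \<Gamma>)" "finite (alphabet \<Gamma>)" using assms by (auto simp: is_csp2_def)
  have "edges \<Gamma> \<subseteq> verts \<Gamma> \<times> verts \<Gamma>" using assms by (auto simp: is_csp2_def)
  then have fe: "finite (edges \<Gamma>)" using fin finite_subset by blast
  have "verts \<Gamma> \<rightarrow>\<^sub>E alphabet \<Gamma> \<noteq> {}" using assms(2) by (auto simp: PiE_eq_empty_iff)
  then show ?thesis unfolding CSP_def
    using fin by (subst Max_le_iff) (auto intro!: card_mono[OF fe] finite_imageI finite_PiE)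
qed

context routing
begin

lemma rank_bound:
  assumes "0 < \<Delta>" "\<And>v. card {q. q < 3 * M \<and> var q = v} \<le> \<Delta>" "q < 3 * M"
  shows "rank (pos \<tau>) q < \<Delta> * (3 * (M div 2 ^ r + 1)) + 2 ^ r * 2 ^ r"
  using rank_pos_less[OF assms] unfolding load_bound_def[OF assms(1,2)] .

lemma enc_size_csp_word_le:
  assumes "set es = network_edges r"
  shows "enc_size (csp_word B es) \<le> enc_bound r (length es) B"
proof -
  let ?N = "4 * r * 2 ^ r" and ?L = "2 ^ B :: nat"
  let ?ps = "\<lambda>e. pairs (fst e) (snd e) ?L ?L"
  have lp: "length (?ps e) \<le> ?L * ?L" for e
    unfolding pairs_product by (rule order_trans[OF length_filter_le]) simp
  have fl: "length (flat_pairs ps) = 2 * length ps" for ps :: "(nat \<times> nat) list"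
    by (induction ps) auto
  have cw: "length (constr_word (e, ?ps e)) \<le> 3 + 2 * (?L * ?L)" for e
    using lp[of e] by (cases e) (simp add: fl)
  have "length (concat (map (\<lambda>e. constr_word (e, ?ps e)) es')) \<le> length es' * (3 + 2 * (?L * ?L))" for es'
  proof (induction es')
    case (Cons e es')
    then show ?case using cw[of e] by simp
  qed simp
  then have len: "length (csp_word B es) \<le> 3 + ?N + ?L + length es * (3 + 2 * (?L * ?L))"
    unfolding csp_word_def by simp
  have sq: "?L \<le> ?L * ?L" by simp
  have "x \<le> ?N + ?L * ?L + length es" if x: "x \<in> set (csp_word B es)" for x
  proof -
    have "x \<le> ?N + ?L * ?L" if e: "e \<in> set es" "x \<in> set (constr_word (e, ?ps e))" for e
    proof -
      obtain u v where uv: "e = (u, v)" by (cases e)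
      have "u < ?N" "v < ?N" using e(1) assms network_edges_verts[OF r] uv by auto
      moreover have "x = u \<or> x = v \<or> x = length (?ps e) \<or> (\<exists>(a, b)\<in>set (?ps e). x = a \<or> x = b)"
        using e(2) uv by auto
      moreover have "a < ?L \<and> b < ?L" if "(a, b) \<in> set (?ps e)" for a b
        using that by (auto simp: pairs_product)
      ultimately consider "x < ?N" | "x \<le> ?L * ?L" | "x < ?L" using lp[of e] by blast
      then show ?thesis using sq by cases linarith+
    qed
    then have "x \<le> ?N + ?L * ?L" if "x \<in> set (concat (map (\<lambda>e. constr_word (e, ?ps e)) es))"
      using that by auto
    moreover have "x = ?N \<or> x < ?N \<or> x \<le> ?L \<or> x = length es \<or>
        x \<in> set (concat (map (\<lambda>e. constr_word (e, ?ps e)) es))"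
      using x unfolding csp_word_def by auto
    ultimately show ?thesis using sq by linarith
  qed
  then have "enc_size (csp_word B es) \<le> length (csp_word B es) * (?N + ?L * ?L + length es + 1)"
    by (rule enc_size_le)
  also have "\<dots> \<le> enc_bound r (length es) B"
    unfolding enc_bound_def using len by (rule mult_right_mono) simp
  finally show ?thesis .
qed

lemma hard_instance_csp:
  assumes \<Delta>: "0 < \<Delta>" "\<And>v. card {q. q < 3 * M \<and> var q = v} \<le> \<Delta>"
    and B: "\<forall>\<tau>\<in>{1..4 * r}. \<forall>q<3 * M. rank (pos \<tau>) q < B"
  shows "hard_instance r M satisfies (\<Delta> * (3 * (M div 2 ^ r + 1)) + 2 ^ r * 2 ^ r) (csp B)"
proof -
  have B': "\<And>\<tau> q. \<tau> \<in> {1..4 * r} \<Longrightarrow> q < 3 * M \<Longrightarrow> rank (pos \<tau>) q < B" using B by blast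
  have csp: "is_csp2 (csp B)" by (rule is_csp2_csp[OF B'])
  have le: "CSP (csp B) \<le> card (edges (csp B))"
    by (rule CSP_le[OF csp]) (simp add: csp_def lessThan_empty_iff)
  have "t \<le> (card (edges (csp B)) - CSP (csp B)) *
      (2 * (\<Delta> * (3 * (M div 2 ^ r + 1)) + 2 ^ r * 2 ^ r))"
    if "\<forall>\<alpha>. t \<le> card {c. c < M \<and> \<not> satisfies \<alpha> c}" for t
  proof (cases t)
    case (Suc t')
    then have "t' < card {c. c < M \<and> \<not> satisfies \<alpha> c}" for \<alpha> using that by (meson Suc_le_lessD)
    then show ?thesis
      using CSP_sound[OF \<Delta>, of t' B] unfolding load_bound_def[OF \<Delta>] Suc by simp
  qed simp
  then show ?thesis
    unfolding hard_instance_def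
    using csp three_regular_csp card_verts_csp card_edges_csp le CSP_complete[OF B'] by blast
qed

end

section \<open>The whole reduction and its growth in the alphabet size\<close>

definition reduction_time :: "nat \<Rightarrow> nat \<Rightarrow> nat \<Rightarrow> nat \<Rightarrow> nat \<Rightarrow> nat \<Rightarrow> nat" where
  "reduction_time r m0 n m M \<Lambda> = (m0 + 1) * (21 * m + 12) + 8 + (M * 8 + 5 + (3 * M * 3 + 2 +
    (routed_time r n M \<Lambda> + 1)))"

text \<open>Nothing above the output is written, so the output together with the untouched rest
  forms an initial store for the relocated program.\<close>

lemma reduction_writes:
  "wregs (reduction r m0 es) \<subseteq> {..21 + 4 * r}" "warrs (reduction r m0 es) \<subseteq> {..21 + 4 * r}"
  by (auto simp: reduction_def read_prog_def read_copy_def read_body_def home_prog_def home_body_def rep_prog_def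
      routed_prog_def mid_prog_def mid_body_def slot_prog_def slot_body_def power_prog_def half_prog_def
      write_instance_def)

lemma runs_to_reduction:
  fixes n m0 r \<Delta> :: nat and cs :: "clause list" and es :: "(nat \<times> nat) list"
  defines "m \<equiv> length cs"
  defines "M \<equiv> (if m < m0 then m0 * m else m)"
  defines "\<Lambda> \<equiv> \<Delta> * (3 * (M div 2 ^ r + 1)) + 2 ^ r * 2 ^ r"
  assumes w: "w = [n, m] @ concat (map clause_word cs)" and r: "0 < r"
    and \<Delta>: "0 < \<Delta>" "\<And>v. card {q. q < 3 * M \<and> copy_var n cs q = v} \<le> \<Delta>"
    and es: "distinct es" "set es = network_edges r"
  shows "runs_to (reduction r m0 es) (init_store w) (reduction_time r m0 (length es) m M \<Lambda>)
    (\<lambda>s. \<exists>\<Gamma> v. hard_instance r M (formula_satisfies n cs) \<Lambda> \<Gamma> \<and> encodes_csp2 v \<Gamma> \<and>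
      enc_size v \<le> enc_bound r (length es) \<Lambda> \<and> shifted (21 + 4 * r) (init_store v) s)"
    (is "runs_to _ _ _ ?S")
proof -
  let ?var = "copy_var n cs" and ?sgn = "copy_sgn cs" and ?k = "21 + 4 * r"
  let ?R = "\<lambda>s. \<exists>\<Gamma> v. hard_instance r M (formula_satisfies n cs) \<Lambda> \<Gamma> \<and> encodes_csp2 v \<Gamma> \<and>
      enc_size v \<le> enc_bound r (length es) \<Lambda> \<and> out ?k s v"
  let ?t = "routed_time r (length es) M \<Lambda>"
  have "runs_to (reduction r m0 es) (init_store w) (reduction_time r m0 (length es) m M \<Lambda>) ?R"
    unfolding reduction_def reduction_time_def
  proof (rule runs_to_Cons[OF runs_to_read_prog[of w n cs m0, folded m_def, folded M_def]])
    show "w = [n, m] @ concat (map clause_word cs)" by (rule w)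
    fix s1 assume m1: "fst s1 4 = M \<and> fst s1 5 = 3 * M \<and>
        (\<forall>q < 3 * M. snd s1 1 q = ?var q \<and> snd s1 2 q = of_bool (?sgn q))"
      and f1: "framed (wregs (read_prog m0)) (warrs (read_prog m0)) (init_store w) s1"
    have fr1: "fst s1 x = 0" if "x \<in> {11, ?k}" for x
      using framed_reg[OF f1, of x] that
      by (auto simp: read_prog_def read_copy_def read_body_def init_store_def)
    have fa1: "snd s1 x i = 0" if "x \<in> {7, 8, ?k}" for x i
      using framed_arr[OF f1, of x] that
      by (auto simp: read_prog_def read_copy_def read_body_def init_store_def)
    show "runs_to (seqs [home_prog r, rep_prog, routed_prog r es]) s1 (M * 8 + 5 + (3 * M * 3 + 2 + (?t + 1))) ?R"
    proof (rule runs_to_Cons[OF runs_to_home_prog[OF conjunct1[OF m1]]])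
      fix s2 assume m2: "\<forall>q<3 * M. snd s2 4 q = (q div 3) mod 2 ^ r"
        and f2: "framed (wregs (home_prog r)) (warrs (home_prog r)) s1 s2"
      have fr2: "fst s2 x = fst s1 x" if "x \<in> {4, 5, 11, ?k}" for x
        by (rule framed_reg[OF f2]) (use that in \<open>auto simp: home_prog_def home_body_def\<close>)
      have fa2: "snd s2 x = snd s1 x" if "x \<in> {1, 2, 7, 8, ?k}" for x
        by (rule framed_arr[OF f2]) (use that in \<open>auto simp: home_prog_def home_body_def\<close>)
      have v2: "fst s2 5 = 3 * M" "\<And>q. q < 3 * M \<Longrightarrow> snd s2 1 q = ?var q"
        using m1 by (auto simp: fr2 fa2)
      show "runs_to (seqs [rep_prog, routed_prog r es]) s2 (3 * M * 3 + 2 + (?t + 1)) ?R"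
      proof (rule runs_to_Cons[OF runs_to_rep_prog[where var = ?var, OF v2]])
        fix s3 assume m3: "\<forall>q<3 * M. snd s3 3 (?var q) < 3 * M \<and> ?var (snd s3 3 (?var q)) = ?var q"
          and f3: "framed (wregs rep_prog) (warrs rep_prog) s2 s3"
        have fr3: "fst s3 x = fst s2 x" if "x \<in> {4, 5, 11, ?k}" for x
          by (rule framed_reg[OF f3]) (use that in \<open>auto simp: rep_prog_def\<close>)
        have fa3: "snd s3 x = snd s2 x" if "x \<in> {1, 2, 4, 7, 8, ?k}" for x
          by (rule framed_arr[OF f3]) (use that in \<open>auto simp: rep_prog_def\<close>)
        \<comment> \<open>\<open>F\<close> is instantiated with the array found at run time; no
          particular choice of representatives is needed.\<close>
        interpret routing r M ?var "snd s3 3" ?sgn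
          by unfold_locales (use r m3 in auto)
        have rk: "rank (pos \<tau>) q < \<Lambda>" if "q < 3 * M" for \<tau> q
          unfolding \<Lambda>_def by (rule rank_bound[OF \<Delta> that])
        have "runs_to (routed_prog r es) s3 ?t (\<lambda>s'. \<exists>B\<le>\<Lambda>. (\<forall>\<tau>\<in>{1..4 * r}. \<forall>q<3 * M. rank (pos \<tau>) q < B) \<and>
            out ?k s' (csp_word B es))"
          by (rule runs_to_routed_prog)
             (use m1 m2 rk in \<open>auto simp: fr3 fr2 fr1 fa3 fa2 fa1 out_def home_def\<close>)
        then have "runs_to (routed_prog r es) s3 ?t ?R"
        proof (rule runs_to_weaken)
          fix s' assume "\<exists>B\<le>\<Lambda>. (\<forall>\<tau>\<in>{1..4 * r}. \<forall>q<3 * M. rank (pos \<tau>) q < B) \<and>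
            out ?k s' (csp_word B es)"
          then obtain B where B: "B \<le> \<Lambda>" "\<forall>\<tau>\<in>{1..4 * r}. \<forall>q<3 * M. rank (pos \<tau>) q < B"
            "out ?k s' (csp_word B es)" by blast
          have "satisfies = formula_satisfies n cs"
            by (simp add: fun_eq_iff satisfies_def formula_satisfies_def)
          then have "hard_instance r M (formula_satisfies n cs) \<Lambda> (csp B)"
            using hard_instance_csp[OF \<Delta> B(2)] unfolding \<Lambda>_def by simp
          moreover have "enc_size (csp_word B es) \<le> enc_bound r (length es) \<Lambda>"
            using enc_size_csp_word_le[OF es(2)] enc_bound_mono[OF B(1)] order_trans by blast
          ultimately show "?R s'" using encodes_csp_word[OF es] B(3) by blast
        qed simp
        then show "runs_to (seqs [routed_prog r es]) s3 (?t + 1) ?R"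
          by (rule runs_to_single) simp
      qed ((assumption | rule order_refl)+)
    qed ((assumption | rule order_refl)+)
  qed ((assumption | rule order_refl)+)
  then show ?thesis
  proof (rule runs_to_weaken)
    fix s assume R: "?R s"
      and f: "framed (wregs (reduction r m0 es)) (warrs (reduction r m0 es)) (init_store w) s"
    have f': "framed {..?k} {..?k} (init_store w) s"
      by (rule framed_mono[OF f reduction_writes])
    have z: "fst s (x + ?k) = 0" "snd s (x + ?k) = (\<lambda>_. 0)" if "x \<noteq> 0" for x
      using framed_reg[OF f', of "x + ?k"] framed_arr[OF f', of "x + ?k"] that
      by (auto simp: init_store_def)
    have "shifted ?k (init_store v) s" if "out ?k s v" for v
      unfolding shifted_def
    proof (intro conjI allI)
      fix x
      show "fst s (x + ?k) = fst (init_store v) x"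
        using z[of x] that by (cases "x = 0") (auto simp: out_def init_store_def)
      show "snd s (x + ?k) = snd (init_store v) x"
        using z[of x] that by (cases "x = 0") (auto simp: out_def init_store_def)
    qed
    then show "?S s" using R by blast
  qed simp
qed

text \<open>Growth of degree \<open>d\<close> in \<open>2 ^ \<Lambda>\<close>, with a constant that
  may depend on the network but not on the formula. The premises make \<open>m\<close> and
  \<open>M\<close> quantities of degree 1.\<close>

definition dominated :: "nat \<Rightarrow> nat \<Rightarrow> (nat \<Rightarrow> nat \<Rightarrow> nat \<Rightarrow> nat) \<Rightarrow> bool" where
  "dominated R d f \<longleftrightarrow> (\<exists>c. \<forall>m M \<Lambda>. m \<le> R * 2 ^ \<Lambda> \<longrightarrow> M \<le> R * 2 ^ \<Lambda> \<longrightarrow> f m M \<Lambda> \<le> c * (2 ^ \<Lambda>) ^ d)"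

lemma dominated_const: "dominated R 0 (\<lambda>m M \<Lambda>. c)"
  unfolding dominated_def by (auto intro: exI[of _ c])

lemma dominated_m: "dominated R 1 (\<lambda>m M \<Lambda>. m)"
  and dominated_M: "dominated R 1 (\<lambda>m M \<Lambda>. M)"
  unfolding dominated_def by (rule exI[of _ R], simp)+

lemma dominated_\<Lambda>: "dominated R 1 (\<lambda>m M \<Lambda>. \<Lambda>)"
  and dominated_power: "dominated R 1 (\<lambda>m M \<Lambda>. 2 ^ \<Lambda>)"
  unfolding dominated_def by (rule exI[of _ 1], simp add: less_imp_le less_exp)+

lemma dominated_add:
  assumes "dominated R d f" "dominated R d' g"
  shows "dominated R (max d d') (\<lambda>m M \<Lambda>. f m M \<Lambda> + g m M \<Lambda>)"
proof -
  obtain c c' where c: "\<And>m M \<Lambda>. m \<le> R * 2 ^ \<Lambda> \<Longrightarrow> M \<le> R * 2 ^ \<Lambda> \<Longrightarrow> f m M \<Lambda> \<le> c * (2 ^ \<Lambda>) ^ d"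
    "\<And>m M \<Lambda>. m \<le> R * 2 ^ \<Lambda> \<Longrightarrow> M \<le> R * 2 ^ \<Lambda> \<Longrightarrow> g m M \<Lambda> \<le> c' * (2 ^ \<Lambda>) ^ d'"
    using assms unfolding dominated_def by blast
  have "f m M \<Lambda> + g m M \<Lambda> \<le> (c + c') * (2 ^ \<Lambda>) ^ max d d'"
    if "m \<le> R * 2 ^ \<Lambda>" "M \<le> R * 2 ^ \<Lambda>" for m M \<Lambda>
  proof -
    have "((2::nat) ^ \<Lambda>) ^ d \<le> (2 ^ \<Lambda>) ^ max d d'" "((2::nat) ^ \<Lambda>) ^ d' \<le> (2 ^ \<Lambda>) ^ max d d'"
      by (auto intro!: power_increasing)
    then have "c * (2 ^ \<Lambda>) ^ d \<le> c * (2 ^ \<Lambda>) ^ max d d'" "c' * (2 ^ \<Lambda>) ^ d' \<le> c' * (2 ^ \<Lambda>) ^ max d d'"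
      by (intro mult_left_mono; simp)+
    then show ?thesis unfolding add_mult_distrib using c[OF that] by linarith
  qed
  then show ?thesis unfolding dominated_def by blast
qed

lemma dominated_mult:
  assumes "dominated R d f" "dominated R d' g"
  shows "dominated R (d + d') (\<lambda>m M \<Lambda>. f m M \<Lambda> * g m M \<Lambda>)"
proof -
  obtain c c' where c: "\<And>m M \<Lambda>. m \<le> R * 2 ^ \<Lambda> \<Longrightarrow> M \<le> R * 2 ^ \<Lambda> \<Longrightarrow> f m M \<Lambda> \<le> c * (2 ^ \<Lambda>) ^ d"
    "\<And>m M \<Lambda>. m \<le> R * 2 ^ \<Lambda> \<Longrightarrow> M \<le> R * 2 ^ \<Lambda> \<Longrightarrow> g m M \<Lambda> \<le> c' * (2 ^ \<Lambda>) ^ d'"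
    using assms unfolding dominated_def by blast
  have "f m M \<Lambda> * g m M \<Lambda> \<le> (c * c') * (2 ^ \<Lambda>) ^ (d + d')"
    if "m \<le> R * 2 ^ \<Lambda>" "M \<le> R * 2 ^ \<Lambda>" for m M \<Lambda>
    using mult_mono[OF c(1)[OF that] c(2)[OF that]] by (simp add: power_add ac_simps)
  then show ?thesis unfolding dominated_def by blast
qed

lemma dominated_eq: "dominated R d f \<Longrightarrow> d = d' \<Longrightarrow> dominated R d' f"
  by simp

lemmas dominated_intros = dominated_const dominated_m dominated_M dominated_\<Lambda> dominated_power
  dominated_add dominated_mult

text \<open>All pairs of labels contribute degree 2, and the test of one pair, linear in
  \<open>M\<close> and \<open>\<Lambda>\<close>, one more.\<close>

lemma dominated_reduction_time: "dominated R 3 (\<lambda>m M \<Lambda>. reduction_time r m0 n m M \<Lambda>)"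
  unfolding reduction_time_def routed_time_def write_time_def edge_time_def pair_time_def
  by (rule dominated_eq, (rule dominated_intros)+, simp)

lemma dominated_enc_bound: "dominated R 4 (\<lambda>m M \<Lambda>. enc_bound r n \<Lambda>)"
  unfolding enc_bound_def
  by (rule dominated_eq, (rule dominated_intros)+, simp)

section \<open>Copies of a formula\<close>

lemma lit_var_occurrences:
  assumes "c < length cs" "j < 3"
  shows "lit_var (occurrences cs ! (3 * c + j)) \<in> clause_vars (cs ! c)"
proof -
  obtain l1 l2 l3 where "cs ! c = (l1, l2, l3)" by (cases "cs ! c")
  moreover have "j = 0 \<or> j = 1 \<or> j = 2" using assms(2) by auto
  ultimately show ?thesis using occurrences_nth[OF assms] by auto
qed

context
  fixes D :: nat and \<phi> :: sat3 and cs :: "clause list"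
  assumes sat3: "is_sat3 D \<phi>" and cs: "distinct cs" "set cs = clauses \<phi>"
begin

lemma card_nth: "card {c. c < length cs \<and> P (cs ! c)} = card {c \<in> clauses \<phi>. P c}"
proof -
  have img: "(!) cs ` {c. c < length cs \<and> P (cs ! c)} = {c \<in> clauses \<phi>. P c}"
    unfolding cs(2)[symmetric] set_conv_nth by blast
  have inj: "inj_on ((!) cs) {c. c < length cs \<and> P (cs ! c)}"
    using cs(1) by (auto simp: inj_on_def nth_eq_iff_index_eq)
  show ?thesis using card_image[OF inj] img by simp
qed

lemma length_eq: "length cs = card (clauses \<phi>)"
  using distinct_card[OF cs(1)] cs(2) by simp

lemma finite_clauses: "finite (clauses \<phi>)"
  using cs(2) by (metis List.finite_set)

lemma vars_less: "c < length cs \<Longrightarrow> v \<in> clause_vars (cs ! c) \<Longrightarrow> v < nvars \<phi>"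
  using sat3 cs(2) nth_mem[of c cs] unfolding is_sat3_def by blast

lemma var_less: "p < 3 * length cs \<Longrightarrow> lit_var (occurrences cs ! p) < nvars \<phi>"
  using lit_var_occurrences[of "p div 3" cs "p mod 3"] vars_less[of "p div 3"] by auto

text \<open>\<open>v div n\<close> determines the copy and \<open>v mod n\<close> the original
  variable, where \<open>n\<close> is \<open>nvars \<phi>\<close>. That variable lies in at most
  \<open>D\<close> clauses, with three positions each.\<close>

lemma card_copy_var_le:
  assumes M: "M = t * length cs"
  shows "card {q. q < 3 * M \<and> copy_var (nvars \<phi>) cs q = v} \<le> 3 * D"
proof (cases "length cs = 0 \<or> nvars \<phi> = 0")
  case True
  \<comment> \<open>Without variables there is no clause, since a clause mentions some variable
    below \<open>nvars \<phi>\<close>.\<close>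
  then have "length cs = 0" using var_less[of 0] by fastforce
  then show ?thesis using M by simp
next
  case False
  let ?n = "nvars \<phi>" and ?m = "length cs"
  let ?S = "{q. q < 3 * M \<and> copy_var ?n cs q = v}"
  let ?C = "{c. c < ?m \<and> v mod ?n \<in> clause_vars (cs ! c)}"
  let ?f = "\<lambda>q. (q mod (3 * ?m) div 3, q mod 3)"
  have q: "q div (3 * ?m) = v div ?n" "lit_var (occurrences cs ! (q mod (3 * ?m))) = v mod ?n"
    if "q \<in> ?S" for q
  proof -
    let ?x = "lit_var (occurrences cs ! (q mod (3 * ?m)))"
    have x: "?x < ?n" by (rule var_less) (use False in auto)
    have "v = ?x + q div (3 * ?m) * ?n" using that by (simp add: copy_var_def)
    then show "q div (3 * ?m) = v div ?n" "?x = v mod ?n" using x by auto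
  qed
  have m3: "q mod (3 * ?m) mod 3 = q mod 3" for q by (simp add: mod_mod_cancel)
  have "inj_on ?f ?S"
  proof (rule inj_onI)
    fix q q' assume a: "q \<in> ?S" "q' \<in> ?S" "?f q = ?f q'"
    have "q mod (3 * ?m) = q mod (3 * ?m) div 3 * 3 + q mod (3 * ?m) mod 3" for q
      by (rule div_mult_mod_eq[symmetric])
    then have "q mod (3 * ?m) = q mod (3 * ?m) div 3 * 3 + q mod 3" for q using m3 by metis
    then have "q mod (3 * ?m) = q' mod (3 * ?m)" using a(3) by (metis prod.inject)
    then show "q = q'" using q(1)[OF a(1)] q(1)[OF a(2)] by (metis div_mult_mod_eq)
  qed
  moreover have "?f ` ?S \<subseteq> ?C \<times> {..<3}"
  proof
    fix y assume "y \<in> ?f ` ?S"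
    then obtain q0 where q0: "q0 \<in> ?S" "y = ?f q0" by blast
    let ?c = "q0 mod (3 * ?m) div 3"
    have "q0 mod (3 * ?m) < ?m * 3" using False by (simp add: mult.commute)
    then have c: "?c < ?m" by (rule less_mult_imp_div_less)
    have "q0 mod (3 * ?m) = 3 * ?c + q0 mod 3"
      using m3[of q0] by (metis mult_div_mod_eq)
    then have "v mod ?n \<in> clause_vars (cs ! ?c)"
      using lit_var_occurrences[OF c, of "q0 mod 3"] q(2)[OF q0(1)] by simp
    then show "y \<in> ?C \<times> {..<3}" using c q0(2) by simp
  qed
  ultimately have "card ?S \<le> card (?C \<times> {..<3::nat})" by (intro card_inj_on_le) auto
  also have "\<dots> = card {c \<in> clauses \<phi>. v mod ?n \<in> clause_vars c} * 3"
    using card_nth[of "\<lambda>c. v mod ?n \<in> clause_vars c"] by (simp add: card_cartesian_product)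
  also have "\<dots> \<le> D * 3" using sat3 False unfolding is_sat3_def by (intro mult_right_mono) auto
  finally show ?thesis by simp
qed

text \<open>Links the two size measures: loads grow with the number of clauses, while the permitted
  time is measured in variables.\<close>

lemma card_clauses_le: "card (clauses \<phi>) \<le> D * nvars \<phi>"
proof -
  have "clauses \<phi> \<subseteq> (\<Union>v<nvars \<phi>. {c \<in> clauses \<phi>. v \<in> clause_vars c})"
  proof
    fix c assume c: "c \<in> clauses \<phi>"
    obtain l1 l2 l3 where "c = (l1, l2, l3)" by (cases c)
    then have "lit_var l1 \<in> clause_vars c" by simp
    then show "c \<in> (\<Union>v<nvars \<phi>. {c \<in> clauses \<phi>. v \<in> clause_vars c})"
      using c sat3 unfolding is_sat3_def by blast
  qed
  then have "card (clauses \<phi>) \<le> card (\<Union>v<nvars \<phi>. {c \<in> clauses \<phi>. v \<in> clause_vars c})"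
    using finite_clauses by (intro card_mono) auto
  also have "\<dots> \<le> (\<Sum>v<nvars \<phi>. card {c \<in> clauses \<phi>. v \<in> clause_vars c})"
    by (rule card_UN_le) simp
  also have "\<dots> \<le> (\<Sum>v<nvars \<phi>. D)"
    by (rule sum_mono) (use sat3 in \<open>simp add: is_sat3_def\<close>)
  finally show ?thesis by (simp add: mult.commute)
qed

lemma formula_satisfies_copy:
  assumes c: "c < length cs"
  shows "formula_satisfies (nvars \<phi>) cs \<alpha> (i * length cs + c) \<longleftrightarrow>
    clause_true (\<lambda>v. \<alpha> (v + i * nvars \<phi>)) (cs ! c)"
proof -
  let ?m = "length cs"
  obtain l1 l2 l3 where l: "cs ! c = (l1, l2, l3)" by (cases "cs ! c")
  have e: "copy_var (nvars \<phi>) cs (3 * (i * ?m + c) + j) =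
      lit_var (clause_literals (cs ! c) ! j) + i * nvars \<phi> \<and>
    copy_sgn cs (3 * (i * ?m + c) + j) = is_Pos (clause_literals (cs ! c) ! j)" if j: "j < 3" for j
  proof -
    have "3 * c + j < 3 * ?m" using c j by linarith
    moreover have "3 * (i * ?m + c) + j = i * (3 * ?m) + (3 * c + j)" by (simp add: algebra_simps)
    ultimately have "(3 * (i * ?m + c) + j) div (3 * ?m) = i"
      "(3 * (i * ?m + c) + j) mod (3 * ?m) = 3 * c + j"
      by (metis add.right_neutral div_less div_mult_self3 gr_implies_not0,
        metis mod_less mod_mult_self3)
    then show ?thesis using occurrences_nth[OF c j] by (simp add: copy_var_def copy_sgn_def)
  qed
  have ex: "(\<exists>j<3. P j) \<longleftrightarrow> P 0 \<or> P 1 \<or> P 2" for P :: "nat \<Rightarrow> bool"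
    by (auto simp: numeral_3_eq_3 less_Suc_eq numeral_2_eq_2)
  have lt: "\<beta> (lit_var l) = is_Pos l \<longleftrightarrow> lit_true \<beta> l" for \<beta> l by (cases l) auto
  show ?thesis
    unfolding formula_satisfies_def ex
    using e[of 0] e[of 1] e[of 2] lt[of "\<lambda>v. \<alpha> (v + i * nvars \<phi>)"] by (simp add: l)
qed

lemma clause_true_cong:
  "(\<And>v. v \<in> clause_vars c \<Longrightarrow> \<alpha> v = \<beta> v) \<Longrightarrow> clause_true \<alpha> c = clause_true \<beta> c"
proof -
  assume a: "\<And>v. v \<in> clause_vars c \<Longrightarrow> \<alpha> v = \<beta> v"
  obtain l1 l2 l3 where c: "c = (l1, l2, l3)" by (cases c)
  have "lit_true \<alpha> l = lit_true \<beta> l" if "lit_var l \<in> clause_vars c" for l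
    using a[OF that] by (cases l) auto
  then show ?thesis using c by simp
qed

lemma card_satisfied_le: "card {c \<in> clauses \<phi>. clause_true \<alpha> c} \<le> SAT \<phi>"
proof -
  let ?f = "\<lambda>\<alpha>. card {c \<in> clauses \<phi>. clause_true \<alpha> c}"
  let ?\<alpha> = "restrict \<alpha> {..<nvars \<phi>}"
  have "clause_true \<alpha> c = clause_true ?\<alpha> c" if "c \<in> clauses \<phi>" for c
    using sat3 that unfolding is_sat3_def by (intro clause_true_cong) auto
  then have "?f \<alpha> = ?f ?\<alpha>" by (metis (mono_tags, lifting))
  also have "\<dots> \<le> SAT \<phi>"
    unfolding SAT_def by (rule Max_ge) (auto intro!: finite_imageI finite_PiE)
  finally show ?thesis .
qed

text \<open>Shifting indices turns \<open>\<alpha>\<close> into an assignment of each copy, and none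
  of these satisfies more than \<open>SAT \<phi>\<close> clauses. Copying thus preserves the
  relative gap.\<close>

lemma unsatisfied_copies:
  "t * (card (clauses \<phi>) - SAT \<phi>) \<le>
    card {c. c < t * length cs \<and> \<not> formula_satisfies (nvars \<phi>) cs \<alpha> c}"
proof -
  let ?m = "length cs" and ?n = "nvars \<phi>"
  let ?U = "\<lambda>i. {c. c < ?m \<and> \<not> clause_true (\<lambda>v. \<alpha> (v + i * ?n)) (cs ! c)}"
  let ?g = "\<lambda>(i, c). i * ?m + c"
  have u: "card (clauses \<phi>) - SAT \<phi> \<le> card (?U i)" for i
  proof -
    let ?\<beta> = "\<lambda>v. \<alpha> (v + i * ?n)"
    have "card (?U i) = card {c \<in> clauses \<phi>. \<not> clause_true ?\<beta> c}" by (rule card_nth)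
    also have "{c \<in> clauses \<phi>. \<not> clause_true ?\<beta> c} = clauses \<phi> - {c \<in> clauses \<phi>. clause_true ?\<beta> c}"
      by auto
    also have "card \<dots> = card (clauses \<phi>) - card {c \<in> clauses \<phi>. clause_true ?\<beta> c}"
      using finite_clauses by (intro card_Diff_subset) auto
    finally show ?thesis using card_satisfied_le[of ?\<beta>] by linarith
  qed
  have "t * (card (clauses \<phi>) - SAT \<phi>) = (\<Sum>i<t. card (clauses \<phi>) - SAT \<phi>)" by simp
  also have "\<dots> \<le> (\<Sum>i<t. card (?U i))" by (rule sum_mono) (rule u)
  also have "\<dots> = card (SIGMA i:{..<t}. ?U i)" by (subst card_SigmaI) auto
  also have "\<dots> \<le> card {c. c < t * ?m \<and> \<not> formula_satisfies ?n cs \<alpha> c}"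
  proof (rule card_inj_on_le[of ?g])
    show "inj_on ?g (SIGMA i:{..<t}. ?U i)"
    proof (rule inj_onI)
      fix x y assume a: "x \<in> (SIGMA i:{..<t}. ?U i)" "y \<in> (SIGMA i:{..<t}. ?U i)" "?g x = ?g y"
      obtain i c i' c' where xy: "x = (i, c)" "y = (i', c')" by (metis surj_pair)
      have "(j * ?m + d) div ?m = j" if "d < ?m" for j d
        using that by (metis add.right_neutral div_less div_mult_self3 gr_implies_not0)
      moreover have "c < ?m" "c' < ?m" using a xy by auto
      ultimately have "i = i'" using a(3) xy by (metis case_prod_conv)
      then show "x = y" using a(3) xy by simp
    qed
    show "?g ` (SIGMA i:{..<t}. ?U i) \<subseteq> {c. c < t * ?m \<and> \<not> formula_satisfies ?n cs \<alpha> c}"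
    proof clarify
      fix i c assume a: "i < t" "c < ?m" "\<not> clause_true (\<lambda>v. \<alpha> (v + i * ?n)) (cs ! c)"
      have "i * ?m + c < Suc i * ?m" using a(2) by simp
      also have "\<dots> \<le> t * ?m" using a(1) by (intro mult_right_mono) auto
      finally show "i * ?m + c < t * ?m \<and> \<not> formula_satisfies ?n cs \<alpha> (i * ?m + c)"
        using a formula_satisfies_copy[OF a(2)] by simp
    qed
  qed simp
  finally show ?thesis .
qed

lemma satisfied_copies:
  assumes "SAT \<phi> = card (clauses \<phi>)"
  shows "\<exists>\<alpha>. \<forall>c<t * length cs. formula_satisfies (nvars \<phi>) cs \<alpha> c"
proof -
  let ?m = "length cs" and ?n = "nvars \<phi>"
  let ?f = "\<lambda>\<alpha>. card {c \<in> clauses \<phi>. clause_true \<alpha> c}"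
  have "restrict (\<lambda>_. True) {..<?n} \<in> {..<?n} \<rightarrow>\<^sub>E (UNIV :: bool set)" by auto
  then have "?f ` ({..<?n} \<rightarrow>\<^sub>E UNIV) \<noteq> {}" by blast
  moreover have "finite (?f ` ({..<?n} \<rightarrow>\<^sub>E UNIV))" by (intro finite_imageI finite_PiE) auto
  ultimately have "SAT \<phi> \<in> ?f ` ({..<?n} \<rightarrow>\<^sub>E UNIV)"
    unfolding SAT_def by (rule Max_in[rotated])
  then obtain \<alpha> where "?f \<alpha> = card (clauses \<phi>)" using assms by auto
  then have "{c \<in> clauses \<phi>. clause_true \<alpha> c} = clauses \<phi>"
    using finite_clauses by (intro card_subset_eq) auto
  then have all: "clause_true \<alpha> (cs ! c)" if "c < ?m" for c
    using nth_mem[OF that] cs(2) by blast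
  \<comment> \<open>An optimal assignment is repeated periodically in all copies.\<close>
  have "formula_satisfies ?n cs (\<lambda>v. \<alpha> (v mod ?n)) c" if "c < t * ?m" for c
  proof -
    have m: "c mod ?m < ?m" using that by (cases "?m = 0") auto
    have "clause_true (\<lambda>v. \<alpha> ((v + c div ?m * ?n) mod ?n)) (cs ! (c mod ?m)) =
        clause_true \<alpha> (cs ! (c mod ?m))"
      by (rule clause_true_cong) (use vars_less[OF m] in auto)
    then show ?thesis
      using formula_satisfies_copy[OF m, of "\<lambda>v. \<alpha> (v mod ?n)" "c div ?m"] all[OF m] by simp
  qed
  then show ?thesis by blast
qed

end

section \<open>The lower bound\<close>

lemma ex_network_size:
  assumes "0 < r0" "4 * r0 * 2 ^ r0 \<le> (k::nat)"
  shows "\<exists>r\<ge>r0. 4 * r * 2 ^ r \<le> k \<and> k < 8 * Suc r * 2 ^ r"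
proof -
  \<comment> \<open>As \<open>8 * Suc r * 2 ^ r = 4 * Suc r * 2 ^ Suc r\<close>, this says that the
    network for \<open>Suc r\<close> has more than \<open>k\<close> vertices.\<close>
  define P where "P r \<longleftrightarrow> k < 8 * Suc r * 2 ^ r" for r
  define r where "r = (LEAST r. P r)"
  have "k < 2 ^ k" by (rule less_exp)
  also have "(2::nat) ^ k \<le> 8 * Suc k * 2 ^ k" by simp
  finally have "P k" by (simp add: P_def)
  then have P: "P r" unfolding r_def by (rule LeastI)
  have "r0 \<le> r"
  proof (rule ccontr)
    assume "\<not> r0 \<le> r"
    then have le: "Suc r \<le> r0" by simp
    have "8 * Suc r * 2 ^ r = 4 * Suc r * 2 ^ Suc r" by simp
    also have "\<dots> \<le> 4 * r0 * 2 ^ r0"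
      using le by (intro mult_le_mono power_increasing) auto
    finally show False using P assms(2) unfolding P_def by linarith
  qed
  then obtain r' where r': "r = Suc r'" using assms(1) by (cases r) auto
  have "\<not> P r'" using not_less_Least[of r' P] r' unfolding r_def by simp
  moreover have "8 * Suc r' * 2 ^ r' = 4 * r * 2 ^ r" by (simp add: r')
  ultimately have "4 * r * 2 ^ r \<le> k" unfolding P_def by linarith
  then show ?thesis using P \<open>r0 \<le> r\<close> unfolding P_def by blast
qed

text \<open>\<open>r\<close> and \<open>2 ^ r\<close> have the orders of \<open>log k\<close> and
  \<open>k / log k\<close>. The first bound is used for the soundness gap, the last for the exponent
  of the running time.\<close>

lemma log_network_size:
  assumes "0 < r" "4 * r * 2 ^ r \<le> (k::nat)" "k < 8 * Suc r * 2 ^ r"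
  shows "real r \<le> log 2 (real k)" "0 < log 2 (real k)" "real k / log 2 (real k) \<le> 8 * 2 ^ r"
proof -
  have "(2::nat) ^ Suc r \<le> 4 * r * 2 ^ r" using assms(1) by simp
  then have "(2::nat) ^ Suc r \<le> k" using assms(2) by linarith
  then have "real (2 ^ Suc r) \<le> real k" by (rule of_nat_mono)
  then have "2 powr real (Suc r) \<le> real k" by (simp only: of_nat_power of_nat_numeral powr_realpow)
  moreover have "0 < k" using assms(1,2) by (cases k) auto
  ultimately have l: "real (Suc r) \<le> log 2 (real k)" by (subst le_log_iff) auto
  then show "real r \<le> log 2 (real k)" "0 < log 2 (real k)" by auto
  have "real k \<le> real (8 * Suc r * 2 ^ r)" using assms(3) by (intro of_nat_mono) simp
  also have "\<dots> = 8 * 2 ^ r * real (Suc r)" by simp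
  also have "\<dots> \<le> 8 * 2 ^ r * log 2 (real k)" using l by (intro mult_left_mono) auto
  finally show "real k / log 2 (real k) \<le> 8 * 2 ^ r"
    using l by (simp add: divide_le_eq)
qed

lemma load_le_real:
  fixes D M R :: nat
  assumes "0 < R"
  shows "real (3 * D * (3 * (M div R + 1)) + R * R) \<le> 9 * real D * (real M / real R + 1) + real R * real R"
proof -
  have "real (M div R) \<le> real M / real R" by (rule of_nat_div_le_of_nat)
  then have "9 * real D * (real (M div R) + 1) \<le> 9 * real D * (real M / real R + 1)"
    by (intro mult_left_mono) auto
  then show ?thesis by (simp add: algebra_simps)
qed

text \<open>Supplies the premises of \<open>dominated\<close>.\<close>

lemma less_power_load:
  fixes M R D :: nat
  assumes "0 < R" "0 < D"
  shows "M \<le> R * 2 ^ (3 * D * (3 * (M div R + 1)) + R * R)"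
proof -
  have "M < R * (M div R + 1)" using dividend_less_times_div[OF assms(1), of M] by simp
  also have "M div R + 1 \<le> 3 * D * (3 * (M div R + 1)) + R * R"
  proof -
    have "1 * (M div R + 1) \<le> 9 * D * (M div R + 1)" using assms(2) by (intro mult_right_mono) auto
    then show ?thesis by (simp add: algebra_simps)
  qed
  also have "\<dots> \<le> 2 ^ (3 * D * (3 * (M div R + 1)) + R * R)" by (rule less_imp_le[OF less_exp])
  finally show ?thesis by simp
qed

section \<open>Transfer of the gap and of the running time\<close>

lemma runs_shifted:
  assumes red: "exec red (init_store w) t s" and s: "shifted k (init_store v) s"
    and p: "runs p v t' accept"
  shows "runs (Seq red (Seq (shift_prog k p) (SetReg 0 (Reg k)))) w (t + (t' + 1)) accept"
proof -
  obtain s1 where s1: "exec p (init_store v) t' s1" "accept \<longleftrightarrow> fst s1 0 = 1"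
    using p unfolding runs_def by blast
  obtain s2 where s2: "exec (shift_prog k p) s t' s2" "shifted k s1 s2"
    using exec_shift_prog[OF s1(1) s] by blast
  have "fst s2 k = fst s1 0" using s2(2) unfolding shifted_def by (metis add_0)
  then have "accept \<longleftrightarrow> fst ((fst s2)(0 := exp_val (Reg k) s2), snd s2) 0 = 1"
    using s1(2) by simp
  moreover have "exec (Seq red (Seq (shift_prog k p) (SetReg 0 (Reg k)))) (init_store w)
      (t + (t' + 1)) ((fst s2)(0 := exp_val (Reg k) s2), snd s2)"
    using red s2(1) exec.SetReg by (blast intro: exec.Seq)
  ultimately show ?thesis unfolding runs_def by blast
qed

text \<open>The hypothesis \<open>R ^ 3 \<le> M\<close> makes the rounding errors in the load negligible. It is the
  reason for copying small formulas.\<close>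

lemma gap_transfer:
  fixes D r m S u T M E :: nat and \<epsilon> \<chi> L :: real
  defines "R \<equiv> 2 ^ r :: nat"
  defines "\<Lambda> \<equiv> 3 * D * (3 * (M div R + 1)) + R * R"
  assumes S: "real S < (1 - \<epsilon>) * real m" and M: "M = T * m" "R ^ 3 \<le> M" and D: "0 < D"
    and \<epsilon>: "0 < \<epsilon>" and \<chi>: "\<chi> = \<epsilon> / (456 * real D)" and L: "real r \<le> L" "0 < L"
    and E: "E \<le> 12 * r * 2 ^ r" "u \<le> E" and le: "T * (m - S) \<le> (E - u) * (2 * \<Lambda>)"
  shows "real u < (1 - \<chi> / L) * real E"
proof -
  have R: "0 < R" by (simp add: R_def)
  have M0: "0 < M" using M(2) R by (metis less_le_trans zero_less_power)
  have T: "0 < T" using M0 M(1) by (cases T) auto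
  have "\<epsilon> * real m < real m - real S" using S by (simp add: algebra_simps)
  also have "\<dots> \<le> real (m - S)" by linarith
  finally have "real T * (\<epsilon> * real m) < real T * real (m - S)" using T by simp
  then have 1: "\<epsilon> * real M < real (T * (m - S))" using M(1) by (simp add: ac_simps)
  have "real R ^ 3 \<le> real M" using M(2) by (metis of_nat_mono of_nat_power)
  then have R2: "real R * real R \<le> real M / real R" using R by (simp add: field_simps power3_eq_cube)
  have "1 \<le> real R" using R by simp
  then have "1 * 1 \<le> real R * real R" by (intro mult_mono) auto
  then have MR: "1 \<le> real M / real R" using R2 by linarith
  have D1: "1 \<le> real D" using D by simp
  have "real \<Lambda> \<le> 9 * real D * (real M / real R + 1) + real R * real R"
    unfolding \<Lambda>_def by (rule load_le_real[OF R])
  also have "\<dots> \<le> 9 * real D * (2 * (real M / real R)) + 1 * (real M / real R)"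
    using MR R2 D1 by (intro add_mono mult_left_mono) auto
  also have "\<dots> \<le> 9 * real D * (2 * (real M / real R)) + real D * (real M / real R)"
    using D1 MR by (intro add_left_mono mult_right_mono) auto
  \<comment> \<open>19 = 9 * 2 + 1: the summand 1 in \<open>M / R + 1\<close> at most doubles the
    main term, and \<open>R * R\<close> costs one more \<open>M / R\<close>.\<close>
  finally have \<Lambda>: "real \<Lambda> \<le> 19 * real D * (real M / real R)" by simp
  have "real (T * (m - S)) \<le> real ((E - u) * (2 * \<Lambda>))" by (rule of_nat_mono[OF le])
  also have "\<dots> = 2 * real (E - u) * real \<Lambda>" by simp
  also have "\<dots> \<le> 2 * real (E - u) * (19 * real D * (real M / real R))"
    using \<Lambda> by (intro mult_left_mono) auto
  finally have "\<epsilon> * real M < 2 * real (E - u) * (19 * real D * (real M / real R))" using 1 by linarith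
  then have "\<epsilon> * real M < (real (E - u) * 38 * real D / real R) * real M" by (simp add: ac_simps)
  then have "\<epsilon> < real (E - u) * 38 * real D / real R" using M0 by (simp only: mult_less_cancel_right)
  then have 2: "\<epsilon> * real R / (38 * real D) < real (E - u)"
    using R D by (simp add: field_simps)
  have "\<chi> / L * real E \<le> \<chi> / L * real (12 * r * 2 ^ r)"
    using E(1) \<chi> \<epsilon> L by (intro mult_left_mono of_nat_mono) auto
  also have "\<dots> = \<chi> * 12 * real R * (real r / L)" by (simp add: R_def)
  also have "\<dots> \<le> \<chi> * 12 * real R * 1"
    using L \<chi> \<epsilon> by (intro mult_left_mono) (auto simp: divide_le_eq)
  \<comment> \<open>456 = 12 * 38, with 12 from the number of edges and 38 = 2 * 19 from the two
    ends of an edge and the load.\<close>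
  also have "\<dots> = \<epsilon> * real R / (38 * real D)" using \<chi> D by (simp add: field_simps)
  finally have "\<chi> / L * real E < real (E - u)" using 2 by linarith
  then show ?thesis using E(2) by (simp add: algebra_simps of_nat_diff)
qed

text \<open>\<open>\<Lambda>\<close> is at most \<open>9 * D^2 / R * n\<close> plus a constant
  \<open>b\<close> independent of the formula. The reduction, of degree 3, and the algorithm, of
  degree \<open>4 * \<theta>\<close>, thus have exponents with leading coefficients
  \<open>27 * D^2 / R\<close> and \<open>36 * D^2 * \<theta> / R\<close>; both are at most
  \<open>\<delta>\<close>, and the rest goes into the constant.\<close>

lemma time_transfer:
  fixes D r m0 n m M t t1 e :: nat and \<delta> \<theta> C c1 c2 :: real
  defines "R \<equiv> 2 ^ r :: nat"
  defines "\<Lambda> \<equiv> 3 * D * (3 * (M div R + 1)) + R * R"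
  defines "b \<equiv> 9 * real D * (real m0 * real m0 / real R + 1) + real R * real R"
  assumes M: "M \<le> m + m0 * m0" and m: "m \<le> D * n"
    and R: "27 * (real D)\<^sup>2 \<le> \<delta> * real R" and \<theta>: "0 \<le> \<theta>" "36 * (real D)\<^sup>2 * \<theta> \<le> \<delta> * real R"
    and c: "0 \<le> c1" "0 \<le> c2" and \<delta>: "0 < \<delta>"
    and t1: "real t1 \<le> c1 * (2 ^ \<Lambda>) ^ 3" and e: "real e \<le> c2 * (2 ^ \<Lambda>) ^ 4"
    and t: "real t \<le> C * real e powr \<theta>"
  shows "real (t1 + (t + 1)) \<le>
    (c1 * 2 powr (3 * b) + \<bar>C\<bar> * (c2 powr \<theta> * 2 powr (4 * \<theta> * b)) + 1) * 2 powr (\<delta> * real n)"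
proof -
  have R0: "0 < real R" by (simp add: R_def)
  have "real M \<le> real (m + m0 * m0)" using M by (rule of_nat_mono)
  also have "\<dots> \<le> real D * real n + real m0 * real m0" using of_nat_mono[OF m] by simp
  finally have MR: "real M / real R \<le> (real D * real n + real m0 * real m0) / real R"
    using R0 by (simp add: divide_right_mono)
  have "real \<Lambda> \<le> 9 * real D * (real M / real R + 1) + real R * real R"
    unfolding \<Lambda>_def by (rule load_le_real) (simp add: R_def)
  also have "\<dots> \<le> 9 * real D * ((real D * real n + real m0 * real m0) / real R + 1) + real R * real R"
    using MR by (intro add_right_mono mult_left_mono) auto
  also have "\<dots> = 9 * (real D)\<^sup>2 / real R * real n + b"
    by (simp add: b_def add_divide_distrib power2_eq_square algebra_simps)
  finally have \<Lambda>: "real \<Lambda> \<le> 9 * (real D)\<^sup>2 / real R * real n + b" .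
  have scale: "x * real \<Lambda> \<le> \<delta> * real n + x * b" if x: "0 \<le> x" "9 * (real D)\<^sup>2 * x \<le> \<delta> * real R" for x
  proof -
    have "x * real \<Lambda> \<le> x * (9 * (real D)\<^sup>2 / real R * real n + b)"
      using \<Lambda> x(1) by (rule mult_left_mono)
    also have "\<dots> = (9 * (real D)\<^sup>2 * x / real R) * real n + x * b" by (simp add: algebra_simps)
    also have "\<dots> \<le> \<delta> * real n + x * b"
      using x(2) R0 by (intro add_right_mono mult_right_mono) (auto simp: divide_le_eq)
    finally show ?thesis .
  qed
  have pw: "((2::real) ^ \<Lambda>) ^ j = 2 powr (real j * real \<Lambda>)" for j
  proof -
    have "((2::real) ^ \<Lambda>) ^ j = 2 ^ (j * \<Lambda>)" by (simp add: power_mult[symmetric] mult.commute)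
    also have "\<dots> = 2 powr real (j * \<Lambda>)" by (rule powr_realpow[symmetric]) simp
    finally show ?thesis by simp
  qed
  let ?N = "2 powr (\<delta> * real n)"
  have "3 * real \<Lambda> \<le> \<delta> * real n + 3 * b" by (rule scale) (use R in auto)
  then have "(2 ^ \<Lambda>) ^ 3 \<le> 2 powr (3 * b) * ?N"
    unfolding pw by (simp add: powr_add[symmetric] add.commute)
  then have A: "real t1 \<le> c1 * 2 powr (3 * b) * ?N"
    using t1 mult_left_mono[OF _ c(1)] by (fastforce simp: mult.assoc)
  have "4 * \<theta> * real \<Lambda> \<le> \<delta> * real n + 4 * \<theta> * b" by (rule scale) (use \<theta> in auto)
  then have q: "2 powr (4 * \<theta> * real \<Lambda>) \<le> 2 powr (4 * \<theta> * b) * ?N"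
    by (simp add: powr_add[symmetric] add.commute)
  have "real e powr \<theta> \<le> (c2 * (2 ^ \<Lambda>) ^ 4) powr \<theta>" using e \<theta>(1) by (intro powr_mono2) auto
  also have "\<dots> = c2 powr \<theta> * 2 powr (4 * \<theta> * real \<Lambda>)"
    unfolding pw using c(2) by (simp add: powr_mult powr_powr ac_simps)
  also have "\<dots> \<le> c2 powr \<theta> * (2 powr (4 * \<theta> * b) * ?N)" using q by (intro mult_left_mono) auto
  finally have ep: "real e powr \<theta> \<le> c2 powr \<theta> * (2 powr (4 * \<theta> * b) * ?N)" .
  \<comment> \<open>\<open>C\<close> is not known to be nonnegative.\<close>
  have "real t \<le> \<bar>C\<bar> * real e powr \<theta>"
    using t by (rule order_trans) (intro mult_right_mono, auto)
  also have "\<dots> \<le> \<bar>C\<bar> * (c2 powr \<theta> * (2 powr (4 * \<theta> * b) * ?N))"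
    using ep by (intro mult_left_mono) auto
  finally have B: "real t \<le> \<bar>C\<bar> * (c2 powr \<theta> * 2 powr (4 * \<theta> * b)) * ?N" by (simp add: mult.assoc)
  have "1 \<le> ?N" using \<delta> by (simp add: ge_one_powr_ge_zero)
  then show ?thesis using A B by (simp add: distrib_right)
qed

theorem theoremA7:
  assumes "gap_eth"
  shows "\<exists>\<zeta>>0. \<exists>\<chi>>0. \<exists>k0::nat. \<forall>k\<ge>k0.
    \<not> (\<exists>p (C::real). \<forall>\<Gamma> w.
        is_csp2 \<Gamma> \<and> three_regular \<Gamma> \<and> card (verts \<Gamma>) \<le> k \<and> encodes_csp2 w \<Gamma> \<longrightarrow>
        (\<exists>t accept. runs p w t accept \<and>
          real t \<le> C * real (enc_size w) powr (\<zeta> * (real k / log 2 (real k))) \<and>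
          (CSP \<Gamma> = card (edges \<Gamma>) \<longrightarrow> accept) \<and>
          (real (CSP \<Gamma>) < (1 - \<chi> / log 2 (real k)) * real (card (edges \<Gamma>)) \<longrightarrow> \<not> accept)))"
proof -
  obtain D' :: nat and \<delta> \<epsilon> :: real where \<delta>: "0 < \<delta>" and \<epsilon>: "0 < \<epsilon>"
    and hard: "\<not> (\<exists>p (C::real). \<forall>\<phi> w. is_sat3 D' \<phi> \<and> encodes_sat3 w \<phi> \<longrightarrow>
          (\<exists>t accept. runs p w t accept \<and>
            real t \<le> C * 2 powr (\<delta> * real (nvars \<phi>)) \<and>
            (SAT \<phi> = card (clauses \<phi>) \<longrightarrow> accept) \<and>
            (real (SAT \<phi>) < (1 - \<epsilon>) * real (card (clauses \<phi>)) \<longrightarrow> \<not> accept)))"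
    using assms unfolding gap_eth_def by blast
  \<comment> \<open>\<open>D'\<close> may be 0, whereas \<open>D\<close> occurs in
    denominators.\<close>
  define D where "D = Suc D'"
  \<comment> \<open>288 = 36 * 8: since \<open>k / log k\<close> is at most
    \<open>8 * 2 ^ r\<close>, the exponent \<open>\<theta>\<close> below then satisfies
    \<open>36 * D^2 * \<theta> \<le> \<delta> * 2 ^ r\<close>.\<close>
  define \<zeta> where "\<zeta> = \<delta> / (288 * (real D)\<^sup>2)"
  define \<chi> where "\<chi> = \<epsilon> / (456 * real D)"
  have D: "0 < D" by (simp add: D_def)
  have pos: "0 < \<zeta>" "0 < \<chi>" using \<delta> \<epsilon> D by (auto simp: \<zeta>_def \<chi>_def)
  \<comment> \<open>The reduction itself must fit into \<open>2 powr (\<delta> * n)\<close>. This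
    requires a large network, hence a large \<open>k\<close>, and determines
    \<open>k0\<close>.\<close>
  obtain r1 where r1: "27 * (real D)\<^sup>2 / \<delta> < 2 ^ r1" using real_arch_pow[of 2] by auto
  define r0 where "r0 = Suc r1"
  have r0: "27 * (real D)\<^sup>2 \<le> \<delta> * 2 ^ r" if "r0 \<le> r" for r
  proof -
    have "(2::real) ^ r1 \<le> 2 ^ r" using that by (intro power_increasing) (auto simp: r0_def)
    then have "\<delta> * 2 ^ r1 \<le> \<delta> * 2 ^ r" using \<delta> by (intro mult_left_mono) auto
    moreover have "27 * (real D)\<^sup>2 < \<delta> * 2 ^ r1" using r1 \<delta> by (simp add: divide_less_eq mult.commute)
    ultimately show ?thesis by linarith
  qed
  define solves where "solves k p C \<longleftrightarrow> (\<forall>\<Gamma> w.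
      is_csp2 \<Gamma> \<and> three_regular \<Gamma> \<and> card (verts \<Gamma>) \<le> k \<and> encodes_csp2 w \<Gamma> \<longrightarrow>
      (\<exists>t accept. runs p w t accept \<and>
        real t \<le> C * real (enc_size w) powr (\<zeta> * (real k / log 2 (real k))) \<and>
        (CSP \<Gamma> = card (edges \<Gamma>) \<longrightarrow> accept) \<and>
        (real (CSP \<Gamma>) < (1 - \<chi> / log 2 (real k)) * real (card (edges \<Gamma>)) \<longrightarrow> \<not> accept)))"
    for k p and C :: real
  have "\<not> solves k p C" if k: "4 * r0 * 2 ^ r0 \<le> k" for k p C
  proof
    define \<theta> where "\<theta> = \<zeta> * (real k / log 2 (real k))"
    assume "solves k p C"
    note solve = this[unfolded solves_def, folded \<theta>_def, rule_format]
    obtain r where r: "r0 \<le> r" "4 * r * 2 ^ r \<le> k" "k < 8 * Suc r * 2 ^ r"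
      using ex_network_size[OF _ k] by (auto simp: r0_def)
    have r_pos: "0 < r" using r(1) by (simp add: r0_def)
    note lg = log_network_size[OF r_pos r(2,3)]
    define R where "R = (2 ^ r :: nat)"
    \<comment> \<open>With \<open>m0\<close> copies of a small nonempty formula there are at least
      \<open>R ^ 3\<close> clauses, as \<open>gap_transfer\<close> demands.\<close>
    define m0 where "m0 = R ^ 3"
    have R: "0 < R" "real R = 2 ^ r" by (simp_all add: R_def)
    have \<theta>0: "0 \<le> \<theta>" using pos lg by (simp add: \<theta>_def)
    have \<theta>: "36 * (real D)\<^sup>2 * \<theta> \<le> \<delta> * real R"
    proof -
      have "\<theta> \<le> \<zeta> * (8 * real R)" unfolding \<theta>_def R(2) using lg(3) pos by (intro mult_left_mono) auto
      then have "36 * (real D)\<^sup>2 * \<theta> \<le> 36 * (real D)\<^sup>2 * (\<zeta> * (8 * real R))" by (intro mult_left_mono) auto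
      also have "\<dots> = \<delta> * real R" using D by (simp add: \<zeta>_def)
      finally show ?thesis .
    qed
    obtain es where es: "distinct es" "set es = network_edges r"
      using finite_distinct_list[OF finite_network_edges[OF r_pos]] by blast
    obtain c1 where c1: "\<And>m M \<Lambda>. m \<le> R * 2 ^ \<Lambda> \<Longrightarrow> M \<le> R * 2 ^ \<Lambda> \<Longrightarrow>
        reduction_time r m0 (length es) m M \<Lambda> \<le> c1 * (2 ^ \<Lambda>) ^ 3"
      using dominated_reduction_time[of R r m0 "length es"] unfolding dominated_def by blast
    obtain c2 where c2: "\<And>\<Lambda>. enc_bound r (length es) \<Lambda> \<le> c2 * (2 ^ \<Lambda>) ^ 4"
      using dominated_enc_bound[of R r "length es"] unfolding dominated_def by (meson zero_le)
    define b where "b = 9 * real D * (real m0 * real m0 / real R + 1) + real R * real R"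
    define C' where "C' = real c1 * 2 powr (3 * b) +
      \<bar>C\<bar> * (real c2 powr \<theta> * 2 powr (4 * \<theta> * b)) + 1"
    define k' where "k' = 21 + 4 * r"
    define prog where "prog = Seq (reduction r m0 es) (Seq (shift_prog k' p) (SetReg 0 (Reg k')))"
    have "\<exists>t accept. runs prog w t accept \<and> real t \<le> C' * 2 powr (\<delta> * real (nvars \<phi>)) \<and>
        (SAT \<phi> = card (clauses \<phi>) \<longrightarrow> accept) \<and>
        (real (SAT \<phi>) < (1 - \<epsilon>) * real (card (clauses \<phi>)) \<longrightarrow> \<not> accept)"
      if \<phi>: "is_sat3 D' \<phi>" and w: "encodes_sat3 w \<phi>" for \<phi> w
    proof -
      obtain cs where cs: "distinct cs" "set cs = clauses \<phi>"
        and w': "w = [nvars \<phi>, length cs] @ concat (map clause_word cs)"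
        using w unfolding encodes_sat3_def by blast
      define m where "m = length cs"
      define T where "T = (if m < m0 then m0 else 1)"
      define M where "M = (if m < m0 then m0 * m else m)"
      define \<Lambda> where "\<Lambda> = 3 * D * (3 * (M div R + 1)) + R * R"
      have M: "M = T * m" by (simp add: M_def T_def)
      have m_card: "m = card (clauses \<phi>)" using length_eq[OF \<phi> cs] by (simp add: m_def)
      have "m \<le> D' * nvars \<phi>" using card_clauses_le[OF \<phi> cs] m_card by simp
      then have mn: "m \<le> D * nvars \<phi>" by (simp add: D_def)
      have "m0 * m \<le> m0 * m0" if "m < m0" using that by simp
      then have Mm: "M \<le> m + m0 * m0" unfolding M_def by (metis le_add1 trans_le_add2)
      have mM: "m \<le> M" by (auto simp: M_def)
      have deg: "card {q. q < 3 * M \<and> copy_var (nvars \<phi>) cs q = v} \<le> 3 * D" for v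
        using card_copy_var_le[OF \<phi> cs, of M T v] M by (simp add: m_def D_def)
      have "runs_to (reduction r m0 es) (init_store w) (reduction_time r m0 (length es) m M \<Lambda>)
        (\<lambda>s. \<exists>\<Gamma> v. hard_instance r M (formula_satisfies (nvars \<phi>) cs) \<Lambda> \<Gamma> \<and> encodes_csp2 v \<Gamma> \<and>
          enc_size v \<le> enc_bound r (length es) \<Lambda> \<and> shifted k' (init_store v) s)"
        using runs_to_reduction[OF w' r_pos, of "3 * D" m0 es] deg D es
        unfolding m_def M_def \<Lambda>_def R_def k'_def by simp
      then obtain t1 s \<Gamma> v where red: "exec (reduction r m0 es) (init_store w) t1 s"
          "t1 \<le> reduction_time r m0 (length es) m M \<Lambda>"
        and \<Gamma>: "hard_instance r M (formula_satisfies (nvars \<phi>) cs) \<Lambda> \<Gamma>" "encodes_csp2 v \<Gamma>"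
          "enc_size v \<le> enc_bound r (length es) \<Lambda>" "shifted k' (init_store v) s"
        unfolding runs_to_def by blast
      obtain t accept where t: "runs p v t accept" "real t \<le> C * real (enc_size v) powr \<theta>"
        and acc: "CSP \<Gamma> = card (edges \<Gamma>) \<Longrightarrow> accept"
          "real (CSP \<Gamma>) < (1 - \<chi> / log 2 (real k)) * real (card (edges \<Gamma>)) \<Longrightarrow> \<not> accept"
        using solve[of \<Gamma> v] \<Gamma>(1,2) r(2) unfolding hard_instance_def by auto
      have run: "runs prog w (t1 + (t + 1)) accept"
        unfolding prog_def by (rule runs_shifted[OF red(1) \<Gamma>(4) t(1)])
      have "M \<le> R * 2 ^ \<Lambda>" unfolding \<Lambda>_def by (rule less_power_load[OF R(1) D])
      then have "reduction_time r m0 (length es) m M \<Lambda> \<le> c1 * (2 ^ \<Lambda>) ^ 3"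
        using mM by (intro c1) auto
      then have "t1 \<le> c1 * (2 ^ \<Lambda>) ^ 3" using red(2) by linarith
      then have t1: "real t1 \<le> real c1 * (2 ^ \<Lambda>) ^ 3" using of_nat_mono by fastforce
      have "enc_size v \<le> c2 * (2 ^ \<Lambda>) ^ 4" using \<Gamma>(3) c2[of \<Lambda>] by linarith
      then have e: "real (enc_size v) \<le> real c2 * (2 ^ \<Lambda>) ^ 4" using of_nat_mono by fastforce
      have "real (t1 + (t + 1)) \<le> C' * 2 powr (\<delta> * real (nvars \<phi>))"
        unfolding C'_def b_def R_def
        by (rule time_transfer[OF Mm mn, where r = r])
           (use r0[OF r(1)] \<theta>0 \<theta> \<delta> t1 e t(2) in \<open>simp_all add: R_def \<Lambda>_def\<close>)
      moreover have accept if sat: "SAT \<phi> = card (clauses \<phi>)"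
      proof -
        obtain \<alpha> where "\<forall>c<T * length cs. formula_satisfies (nvars \<phi>) cs \<alpha> c"
          using satisfied_copies[OF \<phi> cs sat] by blast
        then have "CSP \<Gamma> = card (edges \<Gamma>)"
          using \<Gamma>(1) M unfolding hard_instance_def m_def by blast
        then show ?thesis by (rule acc(1))
      qed
      moreover have "\<not> accept" if gap: "real (SAT \<phi>) < (1 - \<epsilon>) * real (card (clauses \<phi>))"
      proof (rule acc(2))
        have "T * (m - SAT \<phi>) \<le> (card (edges \<Gamma>) - CSP \<Gamma>) * (2 * \<Lambda>)"
          using \<Gamma>(1) unsatisfied_copies[OF \<phi> cs, of T] M
          unfolding hard_instance_def m_card[symmetric] m_def[symmetric] by blast
        moreover have "R ^ 3 \<le> M"
        proof -
          \<comment> \<open>An empty formula has no gap: the strict inequality would read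
            \<open>SAT \<phi> < 0\<close>.\<close>
          have "m \<noteq> 0" using gap m_card by (cases "m = 0") auto
          then show ?thesis by (auto simp: M_def m0_def not_less)
        qed
        ultimately show "real (CSP \<Gamma>) < (1 - \<chi> / log 2 (real k)) * real (card (edges \<Gamma>))"
          using gap_transfer[OF gap[folded m_card] M, of r D \<chi> "log 2 (real k)" "card (edges \<Gamma>)" "CSP \<Gamma>"]
            \<Gamma>(1) D \<epsilon> \<chi>_def lg(1,2)
          unfolding hard_instance_def R_def \<Lambda>_def by blast
      qed
      ultimately show ?thesis using run by blast
    qed
    then show False using hard by blast
  qed
  then show ?thesis using pos unfolding solves_def by blast
qed

end
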